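(* Let $W$ be one of the Weyl groups $W_{A_{n-1}}$, $W_{D_n}$ or $W_{B_n}$, and let $\ddot{\mathfrak H}^-_W$ be the rational spin double affine Hecke algebra of $W$. The multiplication of the subalgebras induces an isomorphism of vector spaces $$\mathcal C[\xi_1,\dots,\xi_n]\otimes\mathbb CW^-\otimes\mathbb C[y_1,\dots,y_n]\longrightarrow\ddot{\mathfrak H}^-_W .$$ Equivalently, the set $\{\xi^\alpha\sigma y^\gamma\}$, where $\sigma$ runs over a basis of $\mathbb CW^-$ and $\alpha,\gamma\in\mathbb Z_+^n$, forms a basis of $\ddot{\mathfrak H}^-_W$.
   Context: Ground field $\mathbb C$; $\mathbb Z_+$ denotes the nonnegative integers. $\mathcal C[\xi_1,\dots,\xi_n]$ is the skew-polynomial algebra generated by $\xi_1,\dots,\xi_n$ with $\xi_i\xi_j=-\xi_j\xi_i$ for $i\ne j$. $\xi^\alpha=\xi_1^{\alpha_1}\cdots\xi_n^{\alpha_n}$, $y^\gamma=y_1^{\gamma_1}\cdots y_n^{\gamma_n}$. $W_{A_{n-1}}=S_n$; $W_{B_n}$ ($n\ge2$) and $W_{D_n}$ ($n\geq 4$) are the Weyl groups of types $B_n$, $D_n$. Spin Weyl group algebra $\mathbb CW^-$. Type $A_{n-1}$: generated by $t_1,\dots,t_{n-1}$ with $t_i^2=1$, $t_it_{i+1}t_i=t_{i+1}t_it_{i+1}$, $(t_it_j)^2=-1$ if $|i-j|>1$. Type $B_n$: add $t_n$ with $t_n^2=1$, $(t_it_n)^2=-1$ for $i\ne n-1,n$,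 $(t_{n-1}t_n)^4=-1$. Type $D_n$: add $t_n$ with $t_n^2=1$, $(t_it_n)^2=-1$ for $i\neq n-2,n$, $t_{n-2}t_nt_{n-2}=t_nt_{n-2}t_n$. Put $t_{i\uparrow j}=t_it_{i+1}\cdots t_j$ if $i\le j$ and $1$ otherwise; $t_{i\downarrow j}=t_it_{i-1}\cdots t_j$ if $i\ge j$ and $1$ otherwise. For $1\le i<j\le n$ put $[i,j]=(-1)^{j-i-1}t_{j-1}\cdots t_{i+1}t_it_{i+1}\cdots t_{j-1}$, $[j,i]=-[i,j]$; $\overline{[i,j]}=\overline{[j,i]}=(-1)^{j-i-1}t_{j\uparrow n-1}t_{i\uparrow n-2}\,t_n\,t_{n-2\downarrow i}t_{n-1\downarrow j}$ in type $D_n$, and $=(-1)^{j-i}t_{j\uparrow n-1}t_{i\uparrow n-2}\,t_nt_{n-1}t_n\,t_{n-2\downarrow i}t_{n-1\downarrow j}$ in type $B_n$; $\overline{[i]}=(-1)^{n-i}t_i\cdots t_{n-1}t_nt_{n-1}\cdots t_i$ ($1\le i\le n$) in type $B_n$. The algebra $\ddot{\mathfrak H}^-_W$. Let $u\in\mathbb C$ (and $v\in\mathbb C$ in type $B_n$). $\ddot{\mathfrak H}^-_W$ is generated by $\xi_i,y_i$ ($1\le i\le n$) and $\mathbb CW^-$, subject to: $y_iy_j=y_jy_i$; $\xi_i\xi_j=-\xi_j\xi_i$ ($i\ne j$); for $1\le i\le n-1$: $t_iy_i=y_{i+1}t_i$, $t_i\xi_i=-\xi_{i+1}t_i$, and $t_iy_j=y_jt_i$,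 $t_i\xi_j=-\xi_jt_i$ for $j\ne i,i+1$; and type $A_{n-1}$: $[y_j,\xi_i]=-u[i,j]$ ($i\ne j$), $[y_i,\xi_i]=u\sum_{k\ne i}[i,k]$; type $D_n$: $t_ny_n=-y_{n-1}t_n$, $t_n\xi_n=-\xi_{n-1}t_n$, $t_ny_j=y_jt_n$ and $t_n\xi_j=-\xi_jt_n$ ($j\ne n-1,n$), $[y_j,\xi_i]=-u[i,j]+u\overline{[i,j]}$ ($i\ne j$), $[y_i,\xi_i]=u\sum_{k\ne i}([i,k]+\overline{[i,k]})$; type $B_n$: $t_ny_n=-y_nt_n$, $t_n\xi_n=-\xi_nt_n$, $t_ny_j=y_jt_n$ and $t_n\xi_j=-\xi_jt_n$ ($j\ne n$), $[y_j,\xi_i]=-u[i,j]+u\overline{[i,j]}$ ($i\ne j$), $[y_i,\xi_i]=u\sum_{k\ne i}([i,k]+\overline{[i,k]})+v\overline{[i]}$. (The left-hand sides $[y_j,\xi_i]=y_j\xi_i-\xi_iy_j$ are commutators; $[i,j]$ with integer entries is the element of $\mathbb CW^-$ above.) *)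

theory Defs
  imports
    "HOL-Library.Poly_Mapping"
    "HOL-Algebra.QuotRing"
    "Jordan_Normal_Form.VS_Connect"
begin

section \<open>Complex vector spaces and algebras given by generators and relations\<close>

abbreviation CC :: "complex ring"
  where "CC \<equiv> class_ring"

text \<open>The field \<^const>\<open>monoid.mult\<close> of \<open>free_module\<close> is a dummy; only the vector space
  structure is meaningful.\<close>

definition free_module :: "'x set \<Rightarrow> (complex, 'x \<Rightarrow>\<^sub>0 complex) module"
  where "free_module S =
    \<lparr>carrier = {p. Poly_Mapping.keys p \<subseteq> S}, monoid.mult = (\<lambda>_ _. 0), one = 0, ring.zero = 0, add = (+),
     module.smult = (\<lambda>c. Poly_Mapping.map ((*) c))\<rparr>"

text \<open>For a submonoid \<open>S\<close>: the monoid algebra of \<open>S\<close> (the monoid is written additively, as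
  required by the convolution product of \<^theory>\<open>HOL-Library.Poly_Mapping\<close>).\<close>

definition monoid_algebra :: "'m::monoid_add set \<Rightarrow> (complex, 'm \<Rightarrow>\<^sub>0 complex) module"
  where "monoid_algebra S = (free_module S)\<lparr>monoid.mult := (*), one := 1\<rparr>"

text \<open>Quotient of a vector space by a subspace, or of an algebra by a two-sided ideal.
  Apart from scalar multiplication this is \<^const>\<open>FactRing\<close>.\<close>

definition quotient_module :: "('a, 'b) module \<Rightarrow> 'b set \<Rightarrow> ('a, 'b set) module"
  where "quotient_module M N =
    \<lparr>carrier = a_rcosets\<^bsub>M\<^esub> N, monoid.mult = rcoset_mult M N, one = N +>\<^bsub>M\<^esub> \<one>\<^bsub>M\<^esub>, ring.zero = N, add = set_add M,
     module.smult = (\<lambda>c X. \<Union>x\<in>X. N +>\<^bsub>M\<^esub> (c \<odot>\<^bsub>M\<^esub> x))\<rparr>"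

definition tensor_relations ::
    "(complex, 'a) module \<Rightarrow> (complex, 'b) module \<Rightarrow> ('a \<times> 'b \<Rightarrow>\<^sub>0 complex) set"
  where "tensor_relations V W =
    (let e = (\<lambda>x y. Poly_Mapping.single (x, y) (1::complex)) in
      {e (x \<oplus>\<^bsub>V\<^esub> x') y - e x y - e x' y | x x' y.
         x \<in> carrier V \<and> x' \<in> carrier V \<and> y \<in> carrier W}
    \<union> {e x (y \<oplus>\<^bsub>W\<^esub> y') - e x y - e x y' | x y y'.
         x \<in> carrier V \<and> y \<in> carrier W \<and> y' \<in> carrier W}
    \<union> {e (c \<odot>\<^bsub>V\<^esub> x) y - Poly_Mapping.single (x, y) c | c x y. x \<in> carrier V \<and> y \<in> carrier W}
    \<union> {e x (c \<odot>\<^bsub>W\<^esub> y) - Poly_Mapping.single (x, y) c | c x y. x \<in> carrier V \<and> y \<in> carrier W})"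

definition tensor_subspace ::
    "(complex, 'a) module \<Rightarrow> (complex, 'b) module \<Rightarrow> ('a \<times> 'b \<Rightarrow>\<^sub>0 complex) set"
  where "tensor_subspace V W =
    LinearCombinations.module.span CC (free_module (carrier V \<times> carrier W)) (tensor_relations V W)"

definition tensor ::
    "(complex, 'a) module \<Rightarrow> (complex, 'b) module \<Rightarrow> (complex, ('a \<times> 'b \<Rightarrow>\<^sub>0 complex) set) module"
  where "tensor V W = quotient_module (free_module (carrier V \<times> carrier W)) (tensor_subspace V W)"

definition pure_tensor ::
    "(complex, 'a) module \<Rightarrow> (complex, 'b) module \<Rightarrow> 'a \<Rightarrow> 'b \<Rightarrow> ('a \<times> 'b \<Rightarrow>\<^sub>0 complex) set"
  where "pure_tensor V W x y =
    tensor_subspace V W +>\<^bsub>free_module (carrier V \<times> carrier W)\<^esub> Poly_Mapping.single (x, y) 1"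

text \<open>Lists as the free monoid, so that the free algebra is a monoid algebra.\<close>

instantiation list :: (type) monoid_add
begin
definition zero_list :: "'a list" where "zero_list = []"
definition plus_list :: "'a list \<Rightarrow> 'a list \<Rightarrow> 'a list" where "plus_list xs ys = xs @ ys"
instance by standard (auto simp: zero_list_def plus_list_def)
end

definition free_algebra :: "'g set \<Rightarrow> (complex, 'g list \<Rightarrow>\<^sub>0 complex) module"
  where "free_algebra G = monoid_algebra (lists G)"

text \<open>Relations \<open>l = r\<close> are given by elements \<open>l - r\<close> of the free algebra.\<close>

definition presented_algebra ::
    "'g set \<Rightarrow> ('g list \<Rightarrow>\<^sub>0 complex) set \<Rightarrow> (complex, ('g list \<Rightarrow>\<^sub>0 complex) set) module"
  where "presented_algebra G R = quotient_module (free_algebra G) (Idl\<^bsub>free_algebra G\<^esub> R)"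

definition presented_class ::
    "'g set \<Rightarrow> ('g list \<Rightarrow>\<^sub>0 complex) set \<Rightarrow> ('g list \<Rightarrow>\<^sub>0 complex) \<Rightarrow> ('g list \<Rightarrow>\<^sub>0 complex) set"
  where "presented_class G R p = (Idl\<^bsub>free_algebra G\<^esub> R) +>\<^bsub>free_algebra G\<^esub> p"

text \<open>The homomorphism from an algebra presented by fewer generators and relations, sending each
  generator to the generator of the same name: all representatives \<open>x\<close> of a coset \<open>X\<close> give
  the same class, see \<open>induced_map_presented_class\<close> below.\<close>

definition induced_map ::
    "'g set \<Rightarrow> ('g list \<Rightarrow>\<^sub>0 complex) set \<Rightarrow> ('g list \<Rightarrow>\<^sub>0 complex) set \<Rightarrow> ('g list \<Rightarrow>\<^sub>0 complex) set"
  where "induced_map G R X = (\<Union>x\<in>X. presented_class G R x)"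


subsection \<open>These are vector spaces and rings\<close>

text \<open>In particular \<^const>\<open>vectorspace.basis\<close> is meaningful for them.\<close>

lemma lookup_map_times: "Poly_Mapping.lookup (Poly_Mapping.map ((*) c) p) k = c * Poly_Mapping.lookup p (k::'x) " for c :: complex
  by (simp add: Poly_Mapping.map.rep_eq when_def)

lemma vectorspace_free_module_update:
  "vectorspace CC ((free_module S)\<lparr>monoid.mult := m, one := e\<rparr>)" (is "vectorspace CC ?M")
proof -
  have keys_map: "Poly_Mapping.keys (Poly_Mapping.map ((*) c) p) \<subseteq> Poly_Mapping.keys p"
    for c :: complex and p :: "'x \<Rightarrow>\<^sub>0 complex"
    by (auto simp: in_keys_iff lookup_map_times)
  have keys_add: "Poly_Mapping.keys (p + q) \<subseteq> S"
    if "Poly_Mapping.keys p \<subseteq> S" "Poly_Mapping.keys q \<subseteq> S" for p q :: "'x \<Rightarrow>\<^sub>0 complex" and S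
    using that Poly_Mapping.keys_add[of p q] by blast
  have "abelian_group ?M"
  proof (rule abelian_groupI)
    fix x assume "x \<in> carrier ?M"
    then show "\<exists>y\<in>carrier ?M. y \<oplus>\<^bsub>?M\<^esub> x = \<zero>\<^bsub>?M\<^esub>"
      by (intro bexI[of _ "- x"]) (auto simp: free_module_def in_keys_iff)
  qed (auto simp: free_module_def keys_add algebra_simps dest: subsetD[OF Poly_Mapping.keys_add])
  moreover have "cring CC"
    by (meson class_field domain.axioms(1) field.axioms(1))
  ultimately have "module CC ?M"
    by (intro moduleI) (auto simp: free_module_def  intro!: poly_mapping_eqI
      simp: lookup_map_times lookup_add algebra_simps dest: subsetD[OF keys_map])
  then show ?thesis by (simp add: vectorspace_def class_field)
qed

lemma vectorspace_free_module: "vectorspace CC (free_module S)"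
  using vectorspace_free_module_update[where S = S and m = "\<lambda>_ _. 0" and e = 0] by (simp add: free_module_def)

lemma vectorspace_monoid_algebra: "vectorspace CC (monoid_algebra S)"
  unfolding monoid_algebra_def by (rule vectorspace_free_module_update)

lemma abelian_subgroup_submodule:
  assumes M: "vectorspace K M" and N: "submodule K N M"
  shows "abelian_subgroup N M"
proof -
  interpret vectorspace K M by fact
  interpret N: submodule K N M by fact
  show ?thesis
  proof (intro abelian_subgroupI3 additive_subgroup.intro group.subgroupI)
    show "inv\<^bsub>add_monoid M\<^esub> a \<in> N" if "a \<in> N" for a
    proof -
      have "(\<ominus>\<^bsub>K\<^esub> \<one>\<^bsub>K\<^esub>) \<odot>\<^bsub>M\<^esub> a \<in> N" using that by auto
      moreover have "(\<ominus>\<^bsub>K\<^esub> \<one>\<^bsub>K\<^esub>) \<odot>\<^bsub>M\<^esub> a = \<ominus>\<^bsub>M\<^esub> a"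
        using that N.subset smult_minus_1 by blast
      ultimately show ?thesis by (simp add: a_inv_def)
    qed
    show "N \<noteq> {}" using N.zero_closed by blast
  qed (use N.subset M.a_group M.abelian_group_axioms in auto)
qed

lemma smult_quotient:
  assumes M: "vectorspace K M" and N: "submodule K N M"
    and c: "c \<in> carrier K" and x: "x \<in> carrier M"
  shows "c \<odot>\<^bsub>quotient_module M N\<^esub> (N +>\<^bsub>M\<^esub> x) = N +>\<^bsub>M\<^esub> (c \<odot>\<^bsub>M\<^esub> x)"
proof -
  interpret vectorspace K M by fact
  interpret N: submodule K N M by fact
  interpret abelian_subgroup N M by (rule abelian_subgroup_submodule) fact+
  have "N +>\<^bsub>M\<^esub> (c \<odot>\<^bsub>M\<^esub> z) = N +>\<^bsub>M\<^esub> (c \<odot>\<^bsub>M\<^esub> x)" if "z \<in> N +>\<^bsub>M\<^esub> x" for z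
  proof -
    from that obtain h where h: "h \<in> N" "z = h \<oplus>\<^bsub>M\<^esub> x" by (auto simp: a_r_coset_def')
    then have "h \<in> carrier M" using N.subset by blast
    with h c x have "c \<odot>\<^bsub>M\<^esub> z = c \<odot>\<^bsub>M\<^esub> h \<oplus>\<^bsub>M\<^esub> c \<odot>\<^bsub>M\<^esub> x" by (simp add: smult_r_distr)
    with h c have "c \<odot>\<^bsub>M\<^esub> z \<in> N +>\<^bsub>M\<^esub> (c \<odot>\<^bsub>M\<^esub> x)" by (auto simp: a_r_coset_def')
    with c x show ?thesis by (metis a_repr_independence' smult_closed)
  qed
  then have "(\<Union>z\<in>N +>\<^bsub>M\<^esub> x. N +>\<^bsub>M\<^esub> (c \<odot>\<^bsub>M\<^esub> z)) = (\<Union>z\<in>N +>\<^bsub>M\<^esub> x. N +>\<^bsub>M\<^esub> (c \<odot>\<^bsub>M\<^esub> x))"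
    by (rule SUP_cong[OF refl])
  also have "\<dots> = N +>\<^bsub>M\<^esub> (c \<odot>\<^bsub>M\<^esub> x)"
    using a_rcos_self[OF x] by blast
  finally show ?thesis by (simp add: quotient_module_def)
qed

lemma vectorspace_quotient:
  assumes M: "vectorspace K M" and N: "submodule K N M"
  shows "vectorspace K (quotient_module M N)"
proof -
  interpret vectorspace K M by fact
  interpret N: submodule K N M by fact
  interpret abelian_subgroup N M by (rule abelian_subgroup_submodule) fact+
  let ?Q = "quotient_module M N"
  have carr: "\<exists>x\<in>carrier M. X = N +>\<^bsub>M\<^esub> x" if "X \<in> carrier ?Q" for X
    using that by (simp add: quotient_module_def A_RCOSETS_def')
  have in_carr: "N +>\<^bsub>M\<^esub> x \<in> carrier ?Q" if "x \<in> carrier M" for x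
    using that by (auto simp: quotient_module_def A_RCOSETS_def')
  have add: "(N +>\<^bsub>M\<^esub> x) \<oplus>\<^bsub>?Q\<^esub> (N +>\<^bsub>M\<^esub> x') = N +>\<^bsub>M\<^esub> (x \<oplus>\<^bsub>M\<^esub> x')"
    if "x \<in> carrier M" "x' \<in> carrier M" for x x'
    using that by (simp add: quotient_module_def a_rcos_sum)
  have zero: "\<zero>\<^bsub>?Q\<^esub> = N +>\<^bsub>M\<^esub> \<zero>\<^bsub>M\<^esub>"
    using N.subset by (simp add: quotient_module_def)
  have ab: "abelian_group ?Q"
  proof (rule abelian_groupI)
    fix X assume "X \<in> carrier ?Q"
    then obtain x where x: "x \<in> carrier M" "X = N +>\<^bsub>M\<^esub> x" using carr by blast
    then show "\<exists>Y\<in>carrier ?Q. Y \<oplus>\<^bsub>?Q\<^esub> X = \<zero>\<^bsub>?Q\<^esub>"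
      by (intro bexI[of _ "N +>\<^bsub>M\<^esub> (\<ominus>\<^bsub>M\<^esub> x)"]) (simp_all add: add zero in_carr M.l_neg)
  next
    fix X Y assume "X \<in> carrier ?Q" "Y \<in> carrier ?Q"
    then obtain x z where "x \<in> carrier M" "X = N +>\<^bsub>M\<^esub> x" "z \<in> carrier M" "Y = N +>\<^bsub>M\<^esub> z"
      using carr by metis
    then show "X \<oplus>\<^bsub>?Q\<^esub> Y \<in> carrier ?Q" "X \<oplus>\<^bsub>?Q\<^esub> Y = Y \<oplus>\<^bsub>?Q\<^esub> X"
      by (simp_all add: add in_carr M.a_comm)
    fix Z assume "Z \<in> carrier ?Q"
    then obtain w where "w \<in> carrier M" "Z = N +>\<^bsub>M\<^esub> w" using carr by metis
    with \<open>x \<in> carrier M\<close> \<open>X = N +>\<^bsub>M\<^esub> x\<close> \<open>z \<in> carrier M\<close> \<open>Y = N +>\<^bsub>M\<^esub> z\<close>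
    show "X \<oplus>\<^bsub>?Q\<^esub> Y \<oplus>\<^bsub>?Q\<^esub> Z = X \<oplus>\<^bsub>?Q\<^esub> (Y \<oplus>\<^bsub>?Q\<^esub> Z)"
      by (simp add: add M.a_assoc)
  next
    fix X assume "X \<in> carrier ?Q"
    then show "\<zero>\<^bsub>?Q\<^esub> \<oplus>\<^bsub>?Q\<^esub> X = X" by - (drule carr, elim bexE, simp add: add zero)
  qed (simp add: zero in_carr)
  note sm = smult_quotient[OF M N]
  have "module K ?Q"
  proof (rule moduleI[OF _ ab])
    show "cring K" ..
  next
    fix a X assume "a \<in> carrier K" "X \<in> carrier ?Q"
    then show "a \<odot>\<^bsub>?Q\<^esub> X \<in> carrier ?Q" by - (drule carr, elim bexE, simp add: sm in_carr)
  next
    fix a b X assume "a \<in> carrier K" "b \<in> carrier K" "X \<in> carrier ?Q"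
    then show "(a \<oplus>\<^bsub>K\<^esub> b) \<odot>\<^bsub>?Q\<^esub> X = a \<odot>\<^bsub>?Q\<^esub> X \<oplus>\<^bsub>?Q\<^esub> b \<odot>\<^bsub>?Q\<^esub> X"
      by - (drule carr, elim bexE, simp add: sm add smult_l_distr)
  next
    fix a X Y assume "a \<in> carrier K" "X \<in> carrier ?Q" "Y \<in> carrier ?Q"
    then show "a \<odot>\<^bsub>?Q\<^esub> (X \<oplus>\<^bsub>?Q\<^esub> Y) = a \<odot>\<^bsub>?Q\<^esub> X \<oplus>\<^bsub>?Q\<^esub> a \<odot>\<^bsub>?Q\<^esub> Y"
      by - (drule carr, drule carr, elim bexE, simp add: sm add smult_r_distr)
  next
    fix a b X assume "a \<in> carrier K" "b \<in> carrier K" "X \<in> carrier ?Q"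
    then show "(a \<otimes>\<^bsub>K\<^esub> b) \<odot>\<^bsub>?Q\<^esub> X = a \<odot>\<^bsub>?Q\<^esub> (b \<odot>\<^bsub>?Q\<^esub> X)"
      by - (drule carr, elim bexE, simp add: sm smult_assoc1)
  next
    fix X assume "X \<in> carrier ?Q"
    then show "\<one>\<^bsub>K\<^esub> \<odot>\<^bsub>?Q\<^esub> X = X" by - (drule carr, elim bexE, simp add: sm)
  qed
  then show ?thesis using field_axioms by (simp add: vectorspace_def)
qed


lemma vectorspace_tensor:
  assumes "vectorspace CC V" "vectorspace CC W"
  shows "vectorspace CC (tensor V W)"
proof -
  interpret V: vectorspace CC V by fact
  interpret W: vectorspace CC W by fact
  let ?F = "free_module (carrier V \<times> carrier W)"
  interpret F: vectorspace CC ?F by (rule vectorspace_free_module)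
  have keys_diff: "Poly_Mapping.keys (p - q) \<subseteq> A"
    if "Poly_Mapping.keys p \<subseteq> A" "Poly_Mapping.keys q \<subseteq> A" for p q :: "'x \<Rightarrow>\<^sub>0 complex" and A
    using that Poly_Mapping.keys_diff[of p q] by blast
  have "tensor_relations V W \<subseteq> carrier ?F"
  proof
    fix r assume "r \<in> tensor_relations V W"
    then show "r \<in> carrier ?F"
      unfolding tensor_relations_def Let_def
      by (elim UnE CollectE exE conjE) (simp_all add: free_module_def keys_diff)
  qed
  then show ?thesis
    unfolding tensor_def tensor_subspace_def
    by (rule vectorspace_quotient[OF F.vectorspace_axioms F.span_is_submodule])
qed


lemma ring_monoid_algebra:
  assumes "0 \<in> S" "\<And>a b. a \<in> S \<Longrightarrow> b \<in> S \<Longrightarrow> a + b \<in> S"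
  shows "ring (monoid_algebra S)"
proof -
  interpret F: vectorspace CC "free_module S" by (rule vectorspace_free_module)
  have km: "Poly_Mapping.keys (p * q) \<subseteq> S"
    if "Poly_Mapping.keys p \<subseteq> S" "Poly_Mapping.keys q \<subseteq> S" for p q :: "_ \<Rightarrow>\<^sub>0 complex"
    using that assms(2) Poly_Mapping.keys_mult[of p q] by fast
  have "abelian_group (monoid_algebra S)"
    using F.M.abelian_group_axioms
    by (simp add: monoid_algebra_def abelian_group_def abelian_group_axioms_def abelian_monoid_def)
  moreover have "Group.monoid (monoid_algebra S)"
    by (rule monoidI) (use assms km in \<open>auto simp: monoid_algebra_def free_module_def algebra_simps\<close>)
  ultimately show ?thesis
    by (rule ringI) (auto simp: monoid_algebra_def free_module_def algebra_simps)
qed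

lemma ring_free_algebra: "ring (free_algebra G)"
  unfolding free_algebra_def
  by (rule ring_monoid_algebra) (auto simp: zero_list_def plus_list_def)

lemma vectorspace_free_algebra: "vectorspace CC (free_algebra G)"
  unfolding free_algebra_def by (rule vectorspace_monoid_algebra)

lemma free_algebra_simps:
  "carrier (free_algebra G) = {p. Poly_Mapping.keys p \<subseteq> lists G}"
  "p \<otimes>\<^bsub>free_algebra G\<^esub> q = p * q" "p \<oplus>\<^bsub>free_algebra G\<^esub> q = p + q"
  "\<one>\<^bsub>free_algebra G\<^esub> = 1" "\<zero>\<^bsub>free_algebra G\<^esub> = 0"
  "c \<odot>\<^bsub>free_algebra G\<^esub> p = Poly_Mapping.single [] c * p"
  by (simp_all add: free_algebra_def monoid_algebra_def free_module_def
      mult_map_scale_conv_mult zero_list_def)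

lemma submodule_ideal_free_algebra:
  assumes "ideal I (free_algebra G)"
  shows "submodule CC I (free_algebra G)"
proof -
  interpret vectorspace CC "free_algebra G" by (rule vectorspace_free_algebra)
  interpret ideal I "free_algebra G" by fact
  show ?thesis
  proof
    fix c :: complex and p assume p: "p \<in> I"
    have "Poly_Mapping.single [] c \<in> carrier (free_algebra G)"
      by (simp add: free_algebra_simps)
    from I_l_closed[OF p this] show "c \<odot>\<^bsub>free_algebra G\<^esub> p \<in> I"
      by (simp add: free_algebra_simps)
  qed (use module_axioms a_subset in \<open>auto simp: module_def\<close>)
qed

lemma presented_algebra_vectorspace:
  assumes "R \<subseteq> carrier (free_algebra G)"
  shows "vectorspace CC (presented_algebra G R)"
  unfolding presented_algebra_def
  by (rule vectorspace_quotient[OF vectorspace_free_algebra submodule_ideal_free_algebra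
      [OF ring.genideal_ideal[OF ring_free_algebra assms]]])

lemma presented_algebra_ring:
  assumes "R \<subseteq> carrier (free_algebra G)"
  shows "ring (presented_algebra G R)"
proof -
  interpret ideal "Idl\<^bsub>free_algebra G\<^esub> R" "free_algebra G"
    by (rule ring.genideal_ideal[OF ring_free_algebra assms])
  let ?P = "presented_algebra G R" and ?Q = "free_algebra G Quot (Idl\<^bsub>free_algebra G\<^esub> R)"
  interpret Q: ring ?Q by (rule quotient_is_ring)
  interpret V: vectorspace CC ?P by (rule presented_algebra_vectorspace) fact
  have eq: "carrier ?P = carrier ?Q" "monoid.mult ?P = monoid.mult ?Q" "\<one>\<^bsub>?P\<^esub> = \<one>\<^bsub>?Q\<^esub>"
    "add ?P = add ?Q"
    by (simp_all add: presented_algebra_def quotient_module_def FactRing_def)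
  have "Group.monoid ?P"
    by (rule monoidI) (simp_all only: eq Q.m_closed Q.one_closed Q.m_assoc Q.l_one Q.r_one)
  with V.M.abelian_group_axioms show ?thesis
    by (rule ringI) (simp_all only: eq Q.l_distr Q.r_distr)
qed

lemma induced_map_presented_class:
  assumes GH: "G \<subseteq> H" and R: "R \<subseteq> carrier (free_algebra G)"
    and Q: "Q \<subseteq> carrier (free_algebra H)" and RQ: "R \<subseteq> Q"
    and p: "p \<in> carrier (free_algebra G)"
  shows "induced_map H Q (presented_class G R p) = presented_class H Q p"
proof -
  let ?F = "free_algebra G" and ?E = "free_algebra H"
  interpret F: ring ?F by (rule ring_free_algebra)
  interpret E: ring ?E by (rule ring_free_algebra)
  interpret I: ideal "Idl\<^bsub>?F\<^esub> R" ?F by (rule F.genideal_ideal) fact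
  interpret J: ideal "Idl\<^bsub>?E\<^esub> Q" ?E by (rule E.genideal_ideal) fact
  have FE: "carrier ?F \<subseteq> carrier ?E"
    using GH lists_mono[OF GH] by (auto simp: free_algebra_simps)
  have "ideal (Idl\<^bsub>?E\<^esub> Q \<inter> carrier ?F) ?F"
  proof (rule idealI)
    show "subgroup (Idl\<^bsub>?E\<^esub> Q \<inter> carrier ?F) (add_monoid ?F)"
    proof (rule group.subgroupI)
      show "group (add_monoid ?F)" by (rule F.a_group)
    next
      fix a assume a: "a \<in> Idl\<^bsub>?E\<^esub> Q \<inter> carrier ?F"
      have "\<ominus>\<^bsub>?F\<^esub> a = - a"
        using a by (intro F.minus_equality) (auto simp: free_algebra_simps)
      moreover have "\<ominus>\<^bsub>?E\<^esub> a = - a"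
        using a FE by (intro E.minus_equality) (auto simp: free_algebra_simps)
      ultimately show "inv\<^bsub>add_monoid ?F\<^esub> a \<in> Idl\<^bsub>?E\<^esub> Q \<inter> carrier ?F"
        using a J.a_inv_closed F.a_inv_closed by (metis IntD1 IntD2 IntI a_inv_def)
    next
      show "Idl\<^bsub>?E\<^esub> Q \<inter> carrier ?F \<noteq> {}"
        using J.zero_closed F.zero_closed by (auto simp: free_algebra_simps)
    qed (use J.a_closed F.a_closed in \<open>auto simp: free_algebra_simps\<close>)
  next
    fix a x assume ax: "a \<in> Idl\<^bsub>?E\<^esub> Q \<inter> carrier ?F" "x \<in> carrier ?F"
    then have a: "a \<in> Idl\<^bsub>?E\<^esub> Q" "a \<in> carrier ?F" and x: "x \<in> carrier ?E" using FE by blast+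
    show "x \<otimes>\<^bsub>?F\<^esub> a \<in> Idl\<^bsub>?E\<^esub> Q \<inter> carrier ?F" "a \<otimes>\<^bsub>?F\<^esub> x \<in> Idl\<^bsub>?E\<^esub> Q \<inter> carrier ?F"
      using J.I_l_closed[OF a(1) x] J.I_r_closed[OF a(1) x] F.m_closed[OF ax(2) a(2)]
        F.m_closed[OF a(2) ax(2)]
      by (simp_all add: free_algebra_simps(2))
  qed (rule F.ring_axioms)
  moreover have "R \<subseteq> Idl\<^bsub>?E\<^esub> Q \<inter> carrier ?F"
    using R RQ E.genideal_self[OF Q] by blast
  ultimately have "Idl\<^bsub>?F\<^esub> R \<subseteq> Idl\<^bsub>?E\<^esub> Q"
    using F.genideal_minimal by blast
  moreover have pE: "p \<in> carrier ?E" using p FE by blast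
  ultimately have "Idl\<^bsub>?E\<^esub> Q +>\<^bsub>?E\<^esub> x = Idl\<^bsub>?E\<^esub> Q +>\<^bsub>?E\<^esub> p" if "x \<in> Idl\<^bsub>?F\<^esub> R +>\<^bsub>?F\<^esub> p" for x
  proof -
    have "x \<in> Idl\<^bsub>?E\<^esub> Q +>\<^bsub>?E\<^esub> p"
      using that \<open>Idl\<^bsub>?F\<^esub> R \<subseteq> Idl\<^bsub>?E\<^esub> Q\<close>
      by (auto simp: a_r_coset_def' free_algebra_simps(3))
    then show ?thesis using J.a_repr_independence'[OF _ pE] by simp
  qed
  moreover have "p \<in> Idl\<^bsub>?F\<^esub> R +>\<^bsub>?F\<^esub> p" using p by (rule I.a_rcos_self)
  ultimately show ?thesis
    unfolding induced_map_def presented_class_def by (metis (no_types, lifting) SUP_cong SUP_const empty_iff)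
qed


section \<open>The rational spin double affine Hecke algebras\<close>

text \<open>\<open>TypeA\<close> with parameter \<open>n\<close> stands for the type \<open>A\<close> of rank \<open>n - 1\<close>, so that in all three
  types \<open>n\<close> is the number of variables \<open>\<xi>\<^sub>i\<close> and \<open>y\<^sub>i\<close>.\<close>

datatype weyl_type = TypeA | TypeB | TypeD

fun admissible :: "weyl_type \<Rightarrow> nat \<Rightarrow> bool"
  where
    "admissible TypeA n \<longleftrightarrow> 1 \<le> n"
  | "admissible TypeB n \<longleftrightarrow> 2 \<le> n"
  | "admissible TypeD n \<longleftrightarrow> 4 \<le> n"

datatype generator = Gen_xi nat | Gen_y nat | Gen_t nat

type_synonym free_elem = "generator list \<Rightarrow>\<^sub>0 complex"

definition xi :: "nat \<Rightarrow> free_elem" where "xi i = Poly_Mapping.single [Gen_xi i] 1"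
definition yv :: "nat \<Rightarrow> free_elem" where "yv i = Poly_Mapping.single [Gen_y i] 1"
definition tv :: "nat \<Rightarrow> free_elem" where "tv i = Poly_Mapping.single [Gen_t i] 1"
definition scalar :: "complex \<Rightarrow> free_elem" where "scalar c = Poly_Mapping.single [] c"

fun t_indices :: "weyl_type \<Rightarrow> nat \<Rightarrow> nat set"
  where
    "t_indices TypeA n = {1..n-1}"
  | "t_indices TypeB n = {1..n}"
  | "t_indices TypeD n = {1..n}"


subsection \<open>The spin Weyl group algebra\<close>

definition spin_relations_A :: "nat \<Rightarrow> free_elem set"
  where "spin_relations_A n =
      {tv i ^ 2 - 1 | i. i \<in> {1..n-1}}
    \<union> {tv i * tv (i+1) * tv i - tv (i+1) * tv i * tv (i+1) | i. i \<in> {1..n-1} \<and> i + 1 \<in> {1..n-1}}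
    \<union> {(tv i * tv j) ^ 2 + 1 | i j. i \<in> {1..n-1} \<and> j \<in> {1..n-1} \<and> \<bar>int i - int j\<bar> > 1}"

fun spin_relations :: "weyl_type \<Rightarrow> nat \<Rightarrow> free_elem set"
  where
    "spin_relations TypeA n = spin_relations_A n"
  | "spin_relations TypeB n = spin_relations_A n
      \<union> {tv n ^ 2 - 1}
      \<union> {(tv i * tv n) ^ 2 + 1 | i. i \<in> {1..n} - {n-1, n}}
      \<union> {(tv (n-1) * tv n) ^ 4 + 1}"
  | "spin_relations TypeD n = spin_relations_A n
      \<union> {tv n ^ 2 - 1}
      \<union> {(tv i * tv n) ^ 2 + 1 | i. i \<in> {1..n} - {n-2, n}}
      \<union> {tv (n-2) * tv n * tv (n-2) - tv n * tv (n-2) * tv n}"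

definition spin_weyl_algebra :: "weyl_type \<Rightarrow> nat \<Rightarrow> (complex, free_elem set) module"
  where "spin_weyl_algebra W n = presented_algebra (Gen_t ` t_indices W n) (spin_relations W n)"

definition t_up :: "nat \<Rightarrow> nat \<Rightarrow> free_elem"
  where "t_up i j = prod_list (map tv [i..<Suc j])"

definition t_down :: "nat \<Rightarrow> nat \<Rightarrow> free_elem"
  where "t_down i j = prod_list (map tv (rev [j..<Suc i]))"

definition bracket :: "nat \<Rightarrow> nat \<Rightarrow> free_elem"
  where "bracket i j =
    (if i < j then (-1) ^ (j-i-1) * t_down (j-1) (i+1) * tv i * t_up (i+1) (j-1)
     else - ((-1) ^ (i-j-1) * t_down (i-1) (j+1) * tv j * t_up (j+1) (i-1)))"

definition bracket_bar_lt :: "weyl_type \<Rightarrow> nat \<Rightarrow> nat \<Rightarrow> nat \<Rightarrow> free_elem"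
  where "bracket_bar_lt W n i j =
    (case W of
       TypeA \<Rightarrow> 0
     | TypeB \<Rightarrow> (-1) ^ (j-i) * t_up j (n-1) * t_up i (n-2) * (tv n * tv (n-1) * tv n)
                 * t_down (n-2) i * t_down (n-1) j
     | TypeD \<Rightarrow> (-1) ^ (j-i-1) * t_up j (n-1) * t_up i (n-2) * tv n
                 * t_down (n-2) i * t_down (n-1) j)"

text \<open>Only used for \<open>i \<noteq> j\<close>, and not in type \<open>A\<close>.\<close>

definition bracket_bar :: "weyl_type \<Rightarrow> nat \<Rightarrow> nat \<Rightarrow> nat \<Rightarrow> free_elem"
  where "bracket_bar W n i j = bracket_bar_lt W n (min i j) (max i j)"

definition bracket_single :: "nat \<Rightarrow> nat \<Rightarrow> free_elem"
  where "bracket_single n i = (-1) ^ (n-i) * t_up i n * t_down (n-1) i"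


subsection \<open>The double affine algebra\<close>

definition skew_relations :: "nat \<Rightarrow> free_elem set"
  where "skew_relations n =
    {xi i * xi j + xi j * xi i | i j. i \<in> {1..n} \<and> j \<in> {1..n} \<and> i \<noteq> j}"

definition skew_polynomials :: "nat \<Rightarrow> (complex, free_elem set) module"
  where "skew_polynomials n = presented_algebra (Gen_xi ` {1..n}) (skew_relations n)"

definition exponents :: "nat \<Rightarrow> (nat \<Rightarrow>\<^sub>0 nat) set"
  where "exponents n = {\<gamma>. Poly_Mapping.keys \<gamma> \<subseteq> {1..n}}"

definition polynomials :: "nat \<Rightarrow> (complex, (nat \<Rightarrow>\<^sub>0 nat) \<Rightarrow>\<^sub>0 complex) module"
  where "polynomials n = monoid_algebra (exponents n)"

definition action_relations_A :: "nat \<Rightarrow> free_elem set"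
  where "action_relations_A n =
      {tv i * yv i - yv (i+1) * tv i | i. i \<in> {1..n-1}}
    \<union> {tv i * xi i + xi (i+1) * tv i | i. i \<in> {1..n-1}}
    \<union> {tv i * yv j - yv j * tv i | i j. i \<in> {1..n-1} \<and> j \<in> {1..n} - {i, i+1}}
    \<union> {tv i * xi j + xi j * tv i | i j. i \<in> {1..n-1} \<and> j \<in> {1..n} - {i, i+1}}"

fun action_relations :: "weyl_type \<Rightarrow> nat \<Rightarrow> free_elem set"
  where
    "action_relations TypeA n = action_relations_A n"
  | "action_relations TypeB n = action_relations_A n
      \<union> {tv n * yv n + yv n * tv n, tv n * xi n + xi n * tv n}
      \<union> {tv n * yv j - yv j * tv n | j. j \<in> {1..n} - {n}}
      \<union> {tv n * xi j + xi j * tv n | j. j \<in> {1..n} - {n}}"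
  | "action_relations TypeD n = action_relations_A n
      \<union> {tv n * yv n + yv (n-1) * tv n, tv n * xi n + xi (n-1) * tv n}
      \<union> {tv n * yv j - yv j * tv n | j. j \<in> {1..n} - {n-1, n}}
      \<union> {tv n * xi j + xi j * tv n | j. j \<in> {1..n} - {n-1, n}}"

text \<open>The prescribed value of \<open>y\<^sub>j \<xi>\<^sub>i - \<xi>\<^sub>i y\<^sub>j\<close>. The parameter \<open>v\<close> only matters in type \<open>B\<close>.\<close>

fun commutator_value :: "weyl_type \<Rightarrow> nat \<Rightarrow> complex \<Rightarrow> complex \<Rightarrow> nat \<Rightarrow> nat \<Rightarrow> free_elem"
  where
    "commutator_value TypeA n u v j i =
      (if i \<noteq> j then - scalar u * bracket i j
       else scalar u * (\<Sum>k\<in>{1..n} - {i}. bracket i k))"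
  | "commutator_value TypeD n u v j i =
      (if i \<noteq> j then - scalar u * bracket i j + scalar u * bracket_bar TypeD n i j
       else scalar u * (\<Sum>k\<in>{1..n} - {i}. bracket i k + bracket_bar TypeD n i k))"
  | "commutator_value TypeB n u v j i =
      (if i \<noteq> j then - scalar u * bracket i j + scalar u * bracket_bar TypeB n i j
       else scalar u * (\<Sum>k\<in>{1..n} - {i}. bracket i k + bracket_bar TypeB n i k)
            + scalar v * bracket_single n i)"

definition daha_generators :: "weyl_type \<Rightarrow> nat \<Rightarrow> generator set"
  where "daha_generators W n = Gen_xi ` {1..n} \<union> Gen_y ` {1..n} \<union> Gen_t ` t_indices W n"

definition daha_relations :: "weyl_type \<Rightarrow> nat \<Rightarrow> complex \<Rightarrow> complex \<Rightarrow> free_elem set"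
  where "daha_relations W n u v =
      spin_relations W n
    \<union> {yv i * yv j - yv j * yv i | i j. i \<in> {1..n} \<and> j \<in> {1..n}}
    \<union> skew_relations n
    \<union> action_relations W n
    \<union> {(yv j * xi i - xi i * yv j) - commutator_value W n u v j i | i j.
         i \<in> {1..n} \<and> j \<in> {1..n}}"

definition rational_spin_daha ::
    "weyl_type \<Rightarrow> nat \<Rightarrow> complex \<Rightarrow> complex \<Rightarrow> (complex, free_elem set) module"
  where "rational_spin_daha W n u v =
    presented_algebra (daha_generators W n) (daha_relations W n u v)"

definition daha_class :: "weyl_type \<Rightarrow> nat \<Rightarrow> complex \<Rightarrow> complex \<Rightarrow> free_elem \<Rightarrow> free_elem set"
  where "daha_class W n u v = presented_class (daha_generators W n) (daha_relations W n u v)"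

text \<open>The canonical map to the double affine algebra, both from the skew-polynomial algebra and
  from the spin Weyl group algebra.\<close>

definition to_daha :: "weyl_type \<Rightarrow> nat \<Rightarrow> complex \<Rightarrow> complex \<Rightarrow> free_elem set \<Rightarrow> free_elem set"
  where "to_daha W n u v = induced_map (daha_generators W n) (daha_relations W n u v)"

definition xi_power :: "nat \<Rightarrow> (nat \<Rightarrow>\<^sub>0 nat) \<Rightarrow> free_elem"
  where "xi_power n \<alpha> = prod_list (map (\<lambda>i. xi i ^ Poly_Mapping.lookup \<alpha> i) [1..<Suc n])"

definition y_power :: "nat \<Rightarrow> (nat \<Rightarrow>\<^sub>0 nat) \<Rightarrow> free_elem"
  where "y_power n \<gamma> = prod_list (map (\<lambda>i. yv i ^ Poly_Mapping.lookup \<gamma> i) [1..<Suc n])"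

text \<open>Evaluation of a polynomial at the commuting elements \<open>y\<^sub>1, \<dots>, y\<^sub>n\<close>.\<close>

definition poly_to_daha ::
    "weyl_type \<Rightarrow> nat \<Rightarrow> complex \<Rightarrow> complex \<Rightarrow> ((nat \<Rightarrow>\<^sub>0 nat) \<Rightarrow>\<^sub>0 complex) \<Rightarrow> free_elem set"
  where "poly_to_daha W n u v p =
    daha_class W n u v
      (\<Sum>\<gamma>\<in>Poly_Mapping.keys p. scalar (Poly_Mapping.lookup p \<gamma>) * y_power n \<gamma>)"


subsection \<open>Well-formedness of the presentations\<close>

text \<open>All relations lie in the respective free algebra, so that the generated ideals are genuine
  ones and the quotients are vector spaces.\<close>

lemma free_algebra_closed:
  fixes p q :: "'g list \<Rightarrow>\<^sub>0 complex"
  shows "0 \<in> carrier (free_algebra G)" "1 \<in> carrier (free_algebra G)"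
    "p \<in> carrier (free_algebra G) \<Longrightarrow> q \<in> carrier (free_algebra G) \<Longrightarrow> p * q \<in> carrier (free_algebra G)"
    "p \<in> carrier (free_algebra G) \<Longrightarrow> q \<in> carrier (free_algebra G) \<Longrightarrow> p + q \<in> carrier (free_algebra G)"
    "p \<in> carrier (free_algebra G) \<Longrightarrow> - p \<in> carrier (free_algebra G)"
    "p \<in> carrier (free_algebra G) \<Longrightarrow> q \<in> carrier (free_algebra G) \<Longrightarrow> p - q \<in> carrier (free_algebra G)"
proof -
  interpret ring "free_algebra G" by (rule ring_free_algebra)
  show 0: "0 \<in> carrier (free_algebra G)" "1 \<in> carrier (free_algebra G)"
    using zero_closed one_closed by (simp_all add: free_algebra_simps(4,5))
  show m: "p * q \<in> carrier (free_algebra G)" "p + q \<in> carrier (free_algebra G)"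
    if "p \<in> carrier (free_algebra G)" "q \<in> carrier (free_algebra G)" for p q
    using m_closed[OF that] a_closed[OF that] by (simp_all add: free_algebra_simps(2,3))
  show u: "- p \<in> carrier (free_algebra G)" if "p \<in> carrier (free_algebra G)" for p
    using that by (simp add: free_algebra_simps(1))
  show "p - q \<in> carrier (free_algebra G)"
    if "p \<in> carrier (free_algebra G)" "q \<in> carrier (free_algebra G)" for p q
    using m(2)[OF that(1) u[OF that(2)]] by simp
qed

lemma free_algebra_closed_power:
  "p \<in> carrier (free_algebra G) \<Longrightarrow> p ^ k \<in> carrier (free_algebra G)"
  by (induction k) (simp_all add: free_algebra_closed)

lemma free_algebra_closed_prod_list:
  "(\<And>p. p \<in> set ps \<Longrightarrow> p \<in> carrier (free_algebra G)) \<Longrightarrow> prod_list ps \<in> carrier (free_algebra G)"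
  by (induction ps) (simp_all add: free_algebra_closed)

lemma free_algebra_closed_sum:
  "(\<And>k. k \<in> A \<Longrightarrow> f k \<in> carrier (free_algebra G)) \<Longrightarrow> sum f A \<in> carrier (free_algebra G)"
  by (induction A rule: infinite_finite_induct) (simp_all add: free_algebra_closed)

lemma free_algebra_closed_gen:
  "tv i \<in> carrier (free_algebra G) \<longleftrightarrow> Gen_t i \<in> G"
  "xi i \<in> carrier (free_algebra G) \<longleftrightarrow> Gen_xi i \<in> G"
  "yv i \<in> carrier (free_algebra G) \<longleftrightarrow> Gen_y i \<in> G"
  "scalar c \<in> carrier (free_algebra G)"
  by (simp_all add: free_algebra_simps(1) tv_def xi_def yv_def scalar_def)

lemmas free_algebra_closed_intros = free_algebra_closed free_algebra_closed_power
  free_algebra_closed_prod_list free_algebra_closed_sum free_algebra_closed_gen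

lemma spin_relations_subset:
  assumes W: "admissible W n" and G: "Gen_t ` t_indices W n \<subseteq> G"
  shows "spin_relations W n \<subseteq> carrier (free_algebra G)"
proof -
  have t: "tv i \<in> carrier (free_algebra G)" if "i \<in> t_indices W n" for i
    using that G by (auto simp: free_algebra_closed_gen)
  have "tv i \<in> carrier (free_algebra G)" if "1 \<le> i" "i \<le> n - 1" for i
    using that by (cases W) (auto intro!: t)
  then have A: "spin_relations_A n \<subseteq> carrier (free_algebra G)"
    unfolding spin_relations_A_def
    by (auto intro!: free_algebra_closed free_algebra_closed_power)
  show ?thesis
  proof (cases W)
    case TypeA
    with A show ?thesis by simp
  next
    case TypeB
    with t have "tv i \<in> carrier (free_algebra G)" if "1 \<le> i" "i \<le> n" for i using that by simp
    with A TypeB W show ?thesis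
      by (auto intro!: free_algebra_closed free_algebra_closed_power)
  next
    case TypeD
    with t have "tv i \<in> carrier (free_algebra G)" if "1 \<le> i" "i \<le> n" for i using that by simp
    with A TypeD W show ?thesis
      by (auto intro!: free_algebra_closed free_algebra_closed_power)
  qed
qed

lemma skew_relations_subset:
  "Gen_xi ` {1..n} \<subseteq> G \<Longrightarrow> skew_relations n \<subseteq> carrier (free_algebra G)"
  unfolding skew_relations_def
  by (auto intro!: free_algebra_closed simp: free_algebra_closed_gen image_subset_iff)

lemma bracket_closed:
  assumes "\<And>k. 1 \<le> k \<Longrightarrow> k \<le> n - 1 \<Longrightarrow> tv k \<in> carrier (free_algebra G)"
    and "1 \<le> i" "i \<le> n" "1 \<le> j" "j \<le> n" "i \<noteq> j"
  shows "bracket i j \<in> carrier (free_algebra G)"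
  using assms unfolding bracket_def t_up_def t_down_def
  by (auto intro!: free_algebra_closed free_algebra_closed_power free_algebra_closed_prod_list)

lemma bracket_bar_closed:
  assumes "\<And>k. 1 \<le> k \<Longrightarrow> k \<le> n \<Longrightarrow> tv k \<in> carrier (free_algebra G)"
    and "1 \<le> i" "i \<le> n" "1 \<le> j" "j \<le> n" "2 \<le> n"
  shows "bracket_bar W n i j \<in> carrier (free_algebra G)"
  using assms unfolding bracket_bar_def bracket_bar_lt_def t_up_def t_down_def
  by (cases W) (auto intro!: free_algebra_closed free_algebra_closed_power free_algebra_closed_prod_list)

lemma bracket_single_closed:
  assumes "\<And>k. 1 \<le> k \<Longrightarrow> k \<le> n \<Longrightarrow> tv k \<in> carrier (free_algebra G)" and "1 \<le> i" "i \<le> n"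
  shows "bracket_single n i \<in> carrier (free_algebra G)"
  using assms unfolding bracket_single_def t_up_def t_down_def
  by (auto intro!: free_algebra_closed free_algebra_closed_power free_algebra_closed_prod_list)

lemma action_relations_A_subset:
  assumes "\<And>k. 1 \<le> k \<Longrightarrow> k \<le> n - 1 \<Longrightarrow> tv k \<in> carrier (free_algebra G)"
    and "\<And>k. 1 \<le> k \<Longrightarrow> k \<le> n \<Longrightarrow> xi k \<in> carrier (free_algebra G)"
    and "\<And>k. 1 \<le> k \<Longrightarrow> k \<le> n \<Longrightarrow> yv k \<in> carrier (free_algebra G)"
  shows "action_relations_A n \<subseteq> carrier (free_algebra G)"
  using assms unfolding action_relations_A_def by (auto intro!: free_algebra_closed)

lemma daha_relations_subset:
  assumes W: "admissible W n"
  shows "daha_relations W n u v \<subseteq> carrier (free_algebra (daha_generators W n))"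
proof -
  define G where "G = daha_generators W n"
  let ?C = "carrier (free_algebra G)"
  have t: "tv i \<in> ?C" if "i \<in> t_indices W n" for i
    using that by (auto simp: free_algebra_closed_gen daha_generators_def G_def)
  have t': "tv i \<in> ?C" if "1 \<le> i" "i \<le> n - 1" for i
    by (rule t) (use that in \<open>cases W; auto\<close>)
  have xy: "xi i \<in> ?C" "yv i \<in> ?C" if "1 \<le> i" "i \<le> n" for i
    using that by (auto simp: free_algebra_closed_gen daha_generators_def G_def)
  have s: "scalar c \<in> ?C" for c by (simp add: free_algebra_closed_gen)
  note cl = free_algebra_closed free_algebra_closed_sum
  have tn: "tv i \<in> ?C" if "W \<noteq> TypeA" "1 \<le> i" "i \<le> n" for i
    by (rule t) (use that in \<open>cases W; auto\<close>)
  have n2: "2 \<le> n" if "W \<noteq> TypeA" using that W by (cases W) auto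
  have act: "action_relations W n \<subseteq> ?C"
    using action_relations_A_subset[of n, OF t' xy] tn n2 W
    by (cases W) (auto intro!: cl xy)
  have br: "bracket i j \<in> ?C" if "1 \<le> i" "i \<le> n" "1 \<le> j" "j \<le> n" "i \<noteq> j" for i j
    using that by (intro bracket_closed[of n]) (auto intro: t')
  have bb: "bracket_bar W' n i j \<in> ?C"
    if "W \<noteq> TypeA" "1 \<le> i" "i \<le> n" "1 \<le> j" "j \<le> n" for i j W'
    using that by (intro bracket_bar_closed) (auto intro: tn n2)
  have bs: "bracket_single n i \<in> ?C" if "W \<noteq> TypeA" "1 \<le> i" "i \<le> n" for i
    using that by (intro bracket_single_closed) (auto intro: tn)
  have com: "commutator_value W n u v j i \<in> ?C" if "1 \<le> i" "i \<le> n" "1 \<le> j" "j \<le> n" for i j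
    using that by (cases W) (auto intro!: cl br bb bs s)
  have spin: "spin_relations W n \<subseteq> ?C"
    by (rule spin_relations_subset[OF W]) (auto simp: G_def daha_generators_def)
  have skew: "skew_relations n \<subseteq> ?C"
    by (rule skew_relations_subset) (auto simp: G_def daha_generators_def)
  show ?thesis
    unfolding daha_relations_def G_def[symmetric]
    using spin act skew by (auto intro!: cl xy com)
qed

lemma vectorspace_skew_polynomials: "vectorspace CC (skew_polynomials n)"
  unfolding skew_polynomials_def
  by (intro presented_algebra_vectorspace skew_relations_subset order.refl)

lemma vectorspace_polynomials: "vectorspace CC (polynomials n)"
  unfolding polynomials_def by (rule vectorspace_monoid_algebra)

lemma vectorspace_spin_weyl_algebra:
  "admissible W n \<Longrightarrow> vectorspace CC (spin_weyl_algebra W n)"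
  unfolding spin_weyl_algebra_def
  by (intro presented_algebra_vectorspace spin_relations_subset order.refl)

lemma vectorspace_rational_spin_daha:
  "admissible W n \<Longrightarrow> vectorspace CC (rational_spin_daha W n u v)"
  unfolding rational_spin_daha_def
  by (intro presented_algebra_vectorspace daha_relations_subset)

end

theory Submission
  imports Defs "HOL-Library.Function_Algebras" "HOL-Combinatorics.Transposition"
begin

text \<open>Spanning is a matter of moving all \<open>\<xi>\<close> to the left and all \<open>y\<close> to the right.  For linear independence,
  let the free algebra act from the right on the functionals \<open>f\<close> on ordered words \<open>\<xi>\<^bsub>x\<^esub> t\<^bsub>w\<^esub> y\<^bsub>p\<^esub>\<close> that respect
  the relations of the three subalgebras; the action of \<open>y\<^sub>j\<close> is defined by recursion on \<open>x\<close> through the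
  commutators \<open>[y\<^sub>j, \<xi>\<^sub>i]\<close>.  That the relations of the algebra hold in this module comes down to the
  equivariance of the elements \<open>[i, j]\<close> under the signed conjugations \<open>a \<mapsto> - t\<^sub>k a t\<^sub>k\<close>, which satisfy the
  ordinary Coxeter relations.  Evaluating the action of an ordered monomial on \<open>f\<close> at the empty word
  returns the value of \<open>f\<close> on that monomial, so every functional on \<open>\<xi>\<^sup>\<alpha> \<otimes> \<sigma> \<otimes> y\<^sup>\<gamma>\<close> factors through the algebra.\<close>

section \<open>Right actions of free algebras on function spaces\<close>

text \<open>The obstacle is the middle factor: no basis of \<open>CW^-\<close> is at hand, so its
  elements have no normal forms to compare. Functions on unreduced words avoid the question. With (f
  a)(b) = f(a b) every operator is the transpose of a left multiplication, and the spin relations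
  enter only as conditions that cut out \<open>U\<close>. The signed conjugations come from Clifford
  algebras: if t_k is pictured as a unit vector normal to its mirror, then a -> -t_k a t_k is the
  reflection itself. Hence [i, j], the barred [i, j] and the barred [i] behave like the roots e_i -
  e_j, e_i + e_j and e_i, which predicts every sign below. The y_i carry the signed permutation
  action, the \<xi>_i only the permutation and a uniform sign -1. Two identities decide whether the
  operators of the y fit: [y_j, \<xi>_a \<xi>_b + \<xi>_b \<xi>_a] = 0 for a \<noteq> b, and the
  Jacobi identity for y_j, y_k, \<xi>_i. Neither can be checked on one commutator alone:
  contributions of the diagonal [y_i, \<xi>_i] have to be matched with those of an off-diagonal
  one.\<close>

lemma poly_mapping_sum_single:
  "p = (\<Sum>k\<in>Poly_Mapping.keys p. Poly_Mapping.single k (Poly_Mapping.lookup p k))"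
  by (rule poly_mapping_eqI) (auto simp: lookup_sum lookup_single when_def in_keys_iff)

lemma poly_mapping_induct_single [case_names single sum]:
  assumes "\<And>k c. P (Poly_Mapping.single k c)" "\<And>p q. P p \<Longrightarrow> P q \<Longrightarrow> P (p + q)"
  shows "P (p :: 'a \<Rightarrow>\<^sub>0 'b::comm_monoid_add)"
proof -
  \<comment> \<open>The empty sum, and the conventional value of an infinite one, is 0, which is
    reached as a \<open>single\<close> with coefficient 0 at an arbitrary key.\<close>
  have "P (\<Sum>k\<in>A. Poly_Mapping.single k (h k))" for A and h :: "'a \<Rightarrow> 'b"
    by (induction A rule: infinite_finite_induct) (use assms assms(1)[of undefined 0] in auto)
  then show ?thesis using poly_mapping_sum_single[of p] by metis
qed

definition scale :: "complex \<Rightarrow> ('b \<Rightarrow> complex) \<Rightarrow> ('b \<Rightarrow> complex)"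
  where "scale c f = (\<lambda>b. c * f b)"

lemma scale_apply [simp]: "scale c f b = c * f b"
  by (simp add: scale_def)

lemma scale_one: "scale 1 f = f" and scale_minus_one: "scale (-1) f = - f"
  and scale_scale: "scale c (scale d f) = scale (c * d) f"
  by (simp_all add: fun_eq_iff)

definition linear_op :: "(('b \<Rightarrow> complex) \<Rightarrow> ('b \<Rightarrow> complex)) \<Rightarrow> bool"
  where "linear_op D \<longleftrightarrow> (\<forall>f g. D (f + g) = D f + D g) \<and> (\<forall>c f. D (scale c f) = scale c (D f))"

lemma linear_opI:
  assumes "\<And>f g b. D (f + g) b = D f b + D g b" "\<And>c f b. D (scale c f) b = c * D f b"
  shows "linear_op D"
  unfolding linear_op_def by (intro conjI allI ext) (simp_all add: assms)

lemma linear_op_add: "linear_op D \<Longrightarrow> D (f + g) = D f + D g"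
  and linear_op_scale: "linear_op D \<Longrightarrow> D (scale c f) = scale c (D f)"
  by (simp_all add: linear_op_def)

lemma linear_op_zero: "linear_op D \<Longrightarrow> D 0 = 0"
  using linear_op_add[of D 0 0] by simp

lemma linear_op_minus: "linear_op D \<Longrightarrow> D (- f) = - D f"
  using linear_op_scale[of D "-1" f] by (simp add: scale_minus_one)

lemma linear_op_diff: "linear_op D \<Longrightarrow> D (f - g) = D f - D g"
  using linear_op_add[of D f "- g"] linear_op_minus[of D g] by simp

lemma linear_op_sum:
  assumes D: "linear_op D"
  shows "D (\<Sum>k\<in>A. f k) = (\<Sum>k\<in>A. D (f k))"
  by (induction A rule: infinite_finite_induct)
     (simp_all only: sum.infinite sum.empty sum.insert not_False_eq_True linear_op_zero[OF D] linear_op_add[OF D])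

lemmas linear_op_rules = linear_op_zero linear_op_add linear_op_minus linear_op_diff linear_op_scale linear_op_sum

lemma linear_op_id: "linear_op (\<lambda>f. f)"
  and linear_op_comp: "linear_op D \<Longrightarrow> linear_op E \<Longrightarrow> linear_op (\<lambda>f. E (D f))"
  by (simp_all add: linear_op_def)

lemma sum_fun_apply: "(\<Sum>k\<in>A. f k) b = (\<Sum>k\<in>A. f k b :: complex)"
  by (induction A rule: infinite_finite_induct) simp_all

lemma linear_op_fold: "(\<And>g. linear_op (op g)) \<Longrightarrow> linear_op (fold op w)"
  by (induction w) (simp_all add: linear_op_def)

text \<open>\<open>fold\<close> lets the leftmost letter of a word act first; this is what makes the
  action a right action, so that a product \<open>p * q\<close> acts by \<open>p\<close> and then by
  \<open>q\<close>.\<close>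

definition act :: "('g \<Rightarrow> ('b \<Rightarrow> complex) \<Rightarrow> ('b \<Rightarrow> complex)) \<Rightarrow> ('g list \<Rightarrow>\<^sub>0 complex)
    \<Rightarrow> ('b \<Rightarrow> complex) \<Rightarrow> ('b \<Rightarrow> complex)"
  where "act op p f = (\<lambda>b. \<Sum>w\<in>Poly_Mapping.keys p. Poly_Mapping.lookup p w * fold op w f b)"

lemma act_superset:
  assumes "finite A" "Poly_Mapping.keys p \<subseteq> A"
  shows "act op p f b = (\<Sum>w\<in>A. Poly_Mapping.lookup p w * fold op w f b)"
  unfolding act_def using assms by (intro sum.mono_neutral_left) (auto simp: in_keys_iff)

lemma act_single: "act op (Poly_Mapping.single w c) f = scale c (fold op w f)"
  by (rule ext, subst act_superset[where A = "{w}"]) (auto split: if_splits)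

lemma act_zero: "act op 0 f = 0"
  by (simp add: act_def fun_eq_iff)

lemma act_add: "act op (p + q) f = act op p f + act op q f"
proof
  fix b
  let ?A = "Poly_Mapping.keys p \<union> Poly_Mapping.keys q"
  note s = act_superset[where A = ?A and op = op and f = f and b = b]
  show "act op (p + q) f b = (act op p f + act op q f) b"
    using s[of "p + q"] s[of p] s[of q] Poly_Mapping.keys_add[of p q]
    by (simp add: lookup_add algebra_simps sum.distrib)
qed

lemma act_uminus: "act op (- p) f = - act op p f"
  using act_add[of op p "- p" f] by (simp add: act_zero eq_neg_iff_add_eq_0 add.commute)

lemma act_diff: "act op (p - q) f = act op p f - act op q f"
  using act_add[of op p "- q" f] by (simp add: act_uminus)

lemma act_sum: "act op (\<Sum>k\<in>A. p k) f = (\<Sum>k\<in>A. act op (p k) f)"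
  by (induction A rule: infinite_finite_induct) (simp_all add: act_zero act_add)

lemma act_one: "act op 1 f = f"
  using act_single[of op "[]" 1 f] by (simp add: zero_list_def scale_one flip: Poly_Mapping.single_one)

lemma linear_op_act:
  assumes "\<And>g. linear_op (op g)"
  shows "linear_op (act op p)"
  by (rule linear_opI)
     (simp_all add: act_def linear_op_add[OF linear_op_fold[of op, OF assms]]
        linear_op_scale[OF linear_op_fold[of op, OF assms]] algebra_simps sum.distrib sum_distrib_left)

lemma act_mult:
  assumes "\<And>g. linear_op (op g)"
  shows "act op (p * q) f = act op q (act op p f)"
proof (induction p rule: poly_mapping_induct_single)
  case (single a c)
  show ?case
  proof (induction q rule: poly_mapping_induct_single)
    case (single b d)
    have "act op (Poly_Mapping.single b d) (act op (Poly_Mapping.single a c) f)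
        = scale d (scale c (fold op b (fold op a f)))"
      by (simp only: act_single linear_op_scale[OF linear_op_fold[of op, OF assms]])
    also have "\<dots> = act op (Poly_Mapping.single a c * Poly_Mapping.single b d) f"
      by (simp only: Poly_Mapping.mult_single act_single plus_list_def scale_scale mult.commute[of d c]
          fold_append o_apply)
    finally show ?case by (rule sym)
  next
    case (sum q r)
    then show ?case by (simp add: act_add distrib_left)
  qed
next
  case (sum p r)
  then show ?case
    by (simp only: act_add distrib_right linear_op_add[OF linear_op_act[of op, OF assms]])
qed

lemma act_cong:
  assumes "\<And>w g. w \<in> Poly_Mapping.keys p \<Longrightarrow> g \<in> set w \<Longrightarrow> op g = op' g"
  shows "act op p f = act op' p f"
proof -
  have "fold op w f = fold op' w f" if "w \<in> Poly_Mapping.keys p" for w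
    by (rule List.fold_cong) (simp_all add: assms[OF that])
  then show ?thesis by (simp add: act_def)
qed

lemma act_closed:
  assumes zero: "0 \<in> U" and add: "\<And>f g. f \<in> U \<Longrightarrow> g \<in> U \<Longrightarrow> f + g \<in> U"
    and scale: "\<And>c f. f \<in> U \<Longrightarrow> scale c f \<in> U"
    and op: "\<And>w g f. w \<in> Poly_Mapping.keys p \<Longrightarrow> g \<in> set w \<Longrightarrow> f \<in> U \<Longrightarrow> op g f \<in> U"
    and f: "f \<in> U"
  shows "act op p f \<in> U"
proof -
  have fold: "fold op w f \<in> U" if "\<And>g f. g \<in> set w \<Longrightarrow> f \<in> U \<Longrightarrow> op g f \<in> U" "f \<in> U" for w f
    using that by (induction w arbitrary: f) simp_all
  have sum: "(\<Sum>w\<in>A. h w) \<in> U" if "\<And>w. w \<in> A \<Longrightarrow> h w \<in> U" for A :: "'b list set" and h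
    using that by (induction A rule: infinite_finite_induct) (simp_all add: zero add)
  have "act op p f = (\<Sum>w\<in>Poly_Mapping.keys p. scale (Poly_Mapping.lookup p w) (fold op w f))"
    by (rule ext) (simp add: act_def sum_fun_apply)
  also have "\<dots> \<in> U"
    by (intro sum scale fold f op)
  finally show ?thesis .
qed

section \<open>Orbits of reflections under signed conjugation\<close>

text \<open>Here \<open>c k\<close> stands for the signed conjugation \<open>a \<mapsto> - t\<^sub>k a t\<^sub>k\<close> in the spin Weyl group algebra:
  all signs of the spin presentation cancel, so these maps satisfy the ordinary Coxeter relations.\<close>

locale conjugation_A =
  fixes n :: nat and c :: "nat \<Rightarrow> 'o \<Rightarrow> 'o" and neg :: "'o \<Rightarrow> 'o" and t :: "nat \<Rightarrow> 'o"
    and br :: "nat \<Rightarrow> nat \<Rightarrow> 'o"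
  assumes invol: "1 \<le> k \<Longrightarrow> k < n \<Longrightarrow> c k (c k x) = x"
    and comm: "1 \<le> j \<Longrightarrow> j + 1 < k \<Longrightarrow> k < n \<Longrightarrow> c k (c j x) = c j (c k x)"
    and braid: "1 \<le> k \<Longrightarrow> Suc k < n \<Longrightarrow> c k (c (Suc k) (c k x)) = c (Suc k) (c k (c (Suc k) x))"
    and t_self: "1 \<le> k \<Longrightarrow> k < n \<Longrightarrow> c k (t k) = neg (t k)"
    and t_far: "1 \<le> j \<Longrightarrow> j < n \<Longrightarrow> 1 \<le> k \<Longrightarrow> k < n \<Longrightarrow> j + 1 < k \<or> k + 1 < j \<Longrightarrow> c k (t j) = t j"
    and t_next: "1 \<le> k \<Longrightarrow> Suc k < n \<Longrightarrow> c k (t (Suc k)) = c (Suc k) (t k)"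
    and br_start: "1 \<le> k \<Longrightarrow> k < n \<Longrightarrow> br k (Suc k) = t k"
    and br_step: "1 \<le> i \<Longrightarrow> i < j \<Longrightarrow> j < n \<Longrightarrow> br i (Suc j) = c j (br i j)"
begin

abbreviation s :: "nat \<Rightarrow> nat \<Rightarrow> nat" where "s k \<equiv> Transposition.transpose k (Suc k)"

text \<open>The elements move like the roots e_i - e_j under s_k. The exceptional case is the one
  where the root is negated; it is split off because the axioms constrain \<open>br i j\<close> for
  i < j only.\<close>

lemma br_conj:
  assumes "1 \<le> i" "i < j" "j \<le> n" "1 \<le> k" "k < n"
  shows "c k (br i j) = (if k = i \<and> j = Suc i then neg (br i j) else br (s k i) (s k j))"
  using assms
proof (induction j arbitrary: k rule: less_induct)
  case (less j)
  note IH = less.IH and pr = less.prems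
  consider "j = Suc i" | j' where "j = Suc j'" "i < j'"
    using pr by (metis Suc_lessI less_imp_Suc_add not_less_eq)
  then show ?case
  proof cases
    case 1
    have b: "br i j = t i" using 1 pr br_start by simp
    consider "k = i" | "k = Suc i" | "Suc k = i" | "i + 1 < k \<or> k + 1 < i" by linarith
    then show ?thesis
    proof cases
      case 2
      then show ?thesis using 1 b pr br_step[of i j] by (simp add: transpose_def)
    next
      case 3
      have "br k (Suc i) = c i (br k i)" using 3 pr 1 br_step[of k i] by simp
      then show ?thesis using 3 1 b pr br_start[of k] t_next[of k] by (auto simp: transpose_def)
    next
      case 4
      then show ?thesis using 1 b pr t_far[of i k] br_start[of i] by (auto simp: transpose_def)
    qed (use 1 b pr t_self in simp)
  next
    case (2 j')
    have b: "br i j = c j' (br i j')" using 2 pr br_step by simp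
    consider "k = j" | "k = j'" | "Suc k = j'" | "k > j" | "Suc k < j'" using 2 by linarith
    then show ?thesis
    proof cases
      case 1
      then show ?thesis using 2 pr br_step[of i j] by (auto simp: transpose_def)
    next
      case k: 2
      then show ?thesis using 2 b pr invol by (auto simp: transpose_def)
    next
      case k: 3
      show ?thesis
      proof (cases "i = k")
        case True
        have "c k (br i j) = c k (c (Suc k) (t k))" using b True k 2 pr br_start[of i] by simp
        also have "\<dots> = t (Suc k)" using t_next[of k, symmetric] invol[of k "t (Suc k)"] k 2 pr by simp
        finally show ?thesis using True k 2 pr br_start[of "Suc k"] by (auto simp: transpose_def)
      next
        case False
        then have ik: "i < k" using k 2 by simp
        \<comment> \<open>Now [i, j] is c_(k+1) c_k [i, k]. The braid law moves the outer c_k to the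
          inside as c_(k+1), which fixes [i, k] because k + 1 exceeds both indices.\<close>
        have b': "br i j' = c k (br i k)" using br_step[of i k] k ik pr 2 by simp
        have "c k (br i j) = c j' (c k (c j' (br i k)))"
          using b b' braid[of k] k 2 pr ik by simp
        also have "c j' (br i k) = br i k"
          using IH[of k j'] k 2 pr ik by (auto simp: transpose_def)
        also have "c k (br i k) = br i j'" using b' by simp
        finally show ?thesis using b k ik 2 by (auto simp: transpose_def)
      qed
    next
      case k: 4
      have "c k (br i j) = c j' (c k (br i j'))" using b comm[of j' k] k 2 pr by simp
      also have "c k (br i j') = br i j'" using IH[of j' k] k 2 pr by (auto simp: transpose_def)
      finally show ?thesis using b k 2 pr by (auto simp: transpose_def)
    next
      case k: 5
      have e: "c k (br i j) = c j' (c k (br i j'))" using b comm[of k j'] k 2 pr by simp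
      have "c k (br i j') = br (s k i) j'" using IH[of j' k] k 2 pr by (auto simp: transpose_def)
      moreover have "1 \<le> s k i" "s k i < j'" using k 2 pr by (auto simp: transpose_def)
      ultimately show ?thesis using e k 2 pr br_step[of "s k i" j'] by (auto simp: transpose_def)
    qed
  qed
qed

end

text \<open>\<open>bar i j\<close> plays the role of e_i + e_j, whence the symmetry. Contrary to
  \<open>br\<close>, whose recursion starts at simple roots, these recursions run towards the pair
  (n - 1, n). \<open>bar_start\<close> covers exactly the k < n other than n - 2, for which s_k
  preserves {n - 1, n}.\<close>

locale conjugation_bar = conjugation_A +
  fixes bar :: "nat \<Rightarrow> nat \<Rightarrow> 'o"
  assumes n2: "2 \<le> n"
    and bar_step: "1 \<le> i \<Longrightarrow> i < j \<Longrightarrow> j < n \<Longrightarrow> bar i j = c j (bar i (Suc j))"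
    and bar_last: "1 \<le> i \<Longrightarrow> Suc i < n \<Longrightarrow> bar i n = c i (bar (Suc i) n)"
    and bar_sym: "bar i j = bar j i"
    and bar_start: "1 \<le> k \<Longrightarrow> k + 3 \<le> n \<or> k = n - 1 \<Longrightarrow> c k (bar (n - 1) n) = bar (n - 1) n"
begin

text \<open>With k + 1 < n the index n stays fixed, so only i moves and this is an orbit argument
  for one index: c_k is cancelled, absorbed as a recursion step, commuted inwards, or pushed inwards
  by a braid move. \<open>sg_conj\<close> follows the same pattern.\<close>

lemma bar_last_conj:
  assumes "1 \<le> i" "i < n" "1 \<le> k" "k + 1 < n"
  shows "c k (bar i n) = bar (s k i) n"
  using assms
proof (induction "n - i" arbitrary: i k rule: less_induct)
  case less
  note IH = less.hyps and pr = less.prems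
  consider "k = i" | "Suc k = i" | "k + 1 < i" | "k = Suc i" | "k > Suc i" by linarith
  then show ?case
  proof cases
    case 1
    then show ?thesis using bar_last[of i] pr invol by (auto simp: transpose_def)
  next
    case 2
    then show ?thesis using bar_last[of k] pr by (auto simp: transpose_def)
  next
    case 3
    show ?thesis
    proof (cases "i = n - 1")
      case True
      then show ?thesis using bar_start[of k] 3 pr by (auto simp: transpose_def)
    next
      case False
      then have "bar i n = c i (bar (Suc i) n)" "c k (bar (Suc i) n) = bar (Suc i) n"
        using bar_last[of i] IH[of "Suc i" k] 3 pr by (auto simp: transpose_def)
      then show ?thesis using comm[of k i "bar (Suc i) n"] 3 pr by (auto simp: transpose_def)
    qed
  next
    case 4
    have b: "bar i n = c i (bar k n)" "bar k n = c k (bar (Suc k) n)"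
      using bar_last[of i] bar_last[of k] 4 pr by auto
    have "c k (bar i n) = c i (c k (c i (bar (Suc k) n)))"
      using b braid[of i "bar (Suc k) n"] 4 pr by simp
    also have "c i (bar (Suc k) n) = bar (Suc k) n"
      using IH[of "Suc k" i] 4 pr by (auto simp: transpose_def)
    finally show ?thesis using b 4 pr by (auto simp: transpose_def)
  next
    case 5
    then have b: "bar i n = c i (bar (Suc i) n)" "c k (bar (Suc i) n) = bar (s k (Suc i)) n"
      using bar_last[of i] IH[of "Suc i" k] pr by auto
    then show ?thesis using comm[of i k "bar (Suc i) n"] 5 pr by (auto simp: transpose_def)
  qed
qed

text \<open>Induction downwards from j = n. No sign exception as in \<open>br_conj\<close> occurs,
  because e_i + e_j is symmetric in i and j and no s_k with k < n negates it.\<close>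

lemma bar_conj_lt:
  assumes "1 \<le> i" "i < j" "j \<le> n" "1 \<le> k" "k < n"
  shows "c k (bar i j) = bar (s k i) (s k j)"
  using assms
proof (induction "n - j" arbitrary: i j k rule: less_induct)
  case less
  note IH = less.hyps and pr = less.prems
  show ?case
  proof (cases "j = n")
    case True
    show ?thesis
    proof (cases "k + 1 < n")
      case k: True
      then have "s k n = n" by (auto simp: transpose_def)
      then show ?thesis using bar_last_conj[of i k] k True pr by simp
    next
      case False
      then have k: "k = n - 1" "Suc k = n" using pr by auto
      show ?thesis
      proof (cases "i = k")
        case i: True
        then show ?thesis using bar_start[of k] bar_sym[of k n] k True pr by (auto simp: transpose_def)
      next
        case False
        then show ?thesis using bar_step[of i k] k True pr by (auto simp: transpose_def)
      qed
    qed
  next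
    case False
    then have b: "bar i j = c j (bar i (Suc j))" using bar_step pr by simp
    consider "k = j" | "Suc k = j" "i = k" | "Suc k = j" "i < k" | "Suc k < j" | "k = Suc j" | "k > Suc j"
      using pr by linarith
    then show ?thesis
    proof cases
      case 1
      then show ?thesis using b invol[of j] pr by (auto simp: transpose_def)
    next
      case 2
      \<comment> \<open>Here s_k swaps the two indices k and j = k + 1. Raising both gives c_j c_k
        applied to the element of (j, j + 1), which c_j fixes; by the braid law a further c_k on the
        outside then changes nothing.\<close>
      have "bar i (Suc j) = c k (bar j (Suc j))"
        using IH[of "Suc j" i k] bar_sym invol[of k "bar i (Suc j)"] 2 False pr by (auto simp: transpose_def)
      moreover have "c j (bar j (Suc j)) = bar j (Suc j)"
        using IH[of "Suc j" j j] bar_sym 2 False pr by (auto simp: transpose_def)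
      ultimately have "c k (bar i j) = bar i j"
        using b braid[of k "bar j (Suc j)"] 2 False pr by simp
      then show ?thesis using 2 bar_sym by (auto simp: transpose_def)
    next
      case 3
      then have "bar i k = c k (bar i j)" using bar_step[of i k] pr by simp
      then show ?thesis using 3 by (auto simp: transpose_def)
    next
      case 4
      have "c k (bar i (Suc j)) = bar (s k i) (Suc j)"
        using IH[of "Suc j" i k] 4 False pr by (auto simp: transpose_def)
      moreover have "s k i < j" "1 \<le> s k i" using 4 pr by (auto simp: transpose_def)
      ultimately show ?thesis
        using b comm[of k j "bar i (Suc j)"] bar_step[of "s k i" j] 4 False pr by (auto simp: transpose_def)
    next
      case 5
      have b': "bar i (Suc j) = c k (bar i (Suc k))" using bar_step[of i k] 5 False pr by auto
      have "c k (bar i j) = c j (c k (c j (bar i (Suc k))))"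
        using b b' braid[of j "bar i (Suc k)"] 5 False pr by simp
      also have "c j (bar i (Suc k)) = bar i (Suc k)"
        using IH[of "Suc k" i j] 5 False pr by (auto simp: transpose_def)
      finally show ?thesis using b b' 5 pr by (auto simp: transpose_def)
    next
      case 6
      have "c k (bar i (Suc j)) = bar i (Suc j)"
        using IH[of "Suc j" i k] 6 False pr by (auto simp: transpose_def)
      then show ?thesis using b comm[of j k "bar i (Suc j)"] 6 False pr by (auto simp: transpose_def)
    qed
  qed
qed

end

text \<open>s_n is the reflection in e_(n-1) + e_n: it sends e_(n-1) to -e_n. So c_n exchanges
  [i, n - 1] with the barred [i, n] and [i, n] with the barred [i, n - 1]. In the diagram, node n is
  joined to n - 2 only; in particular n - 1 is among the k of \<open>comm_n\<close>.\<close>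

locale conjugation_D = conjugation_bar +
  assumes n4: "4 \<le> n"
    and invol_n: "c n (c n x) = x"
    and comm_n: "1 \<le> k \<Longrightarrow> k < n \<Longrightarrow> k \<noteq> n - 2 \<Longrightarrow> c n (c k x) = c k (c n x)"
    and braid_n: "c (n - 2) (c n (c (n - 2) x)) = c n (c (n - 2) (c n x))"
    and t_n_self: "c n (t n) = neg (t n)"
    and t_n_far: "1 \<le> k \<Longrightarrow> k < n \<Longrightarrow> k \<noteq> n - 2 \<Longrightarrow> c n (t k) = t k"
    and t_n_next: "c n (t (n - 2)) = c (n - 2) (t n)"
    and bar_start_D: "bar (n - 1) n = t n"
begin

lemma br_conj_n_small: "1 \<le> i \<Longrightarrow> i < j \<Longrightarrow> j + 1 < n \<Longrightarrow> c n (br i j) = br i j"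
proof (induction j)
  case (Suc j)
  show ?case
  proof (cases "j = i")
    case True
    then show ?thesis using Suc br_start[of i] t_n_far[of i] by simp
  next
    case False
    then show ?thesis using Suc br_step[of i j] comm_n[of j "br i j"] by simp
  qed
qed simp

lemma br_conj_n_both: "c n (br (n - 1) n) = br (n - 1) n"
  using br_start[of "n - 1"] t_n_far[of "n - 1"] n4 by simp

lemma br_conj_n_left: "1 \<le> i \<Longrightarrow> i + 1 < n \<Longrightarrow> c n (br i (n - 1)) = bar i n"
proof (induction "n - i" arbitrary: i rule: less_induct)
  case less
  show ?case
  proof (cases "i = n - 2")
    case True
    then have "Suc i = n - 1" using n4 by simp
    then show ?thesis using True br_start[of i] bar_last[of i] t_n_next bar_start_D less n4 by simp
  next
    case False
    have "br i (n - 1) = c i (br (Suc i) (n - 1))"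
      using br_conj[of "Suc i" "n - 1" i] False less by (auto simp: transpose_def split: if_splits)
    then have "c n (br i (n - 1)) = c i (bar (Suc i) n)"
      using comm_n[of i "br (Suc i) (n - 1)"] less False by simp
    then show ?thesis using bar_last[of i] less by simp
  qed
qed

lemma br_conj_n_right: "1 \<le> i \<Longrightarrow> i + 1 < n \<Longrightarrow> c n (br i n) = bar i (n - 1)"
proof -
  assume i: "1 \<le> i" "i + 1 < n"
  then have "br i n = c (n - 1) (br i (n - 1))" using br_step[of i "n - 1"] by simp
  then have "c n (br i n) = c (n - 1) (bar i n)" using br_conj_n_left i comm_n[of "n - 1" "br i (n - 1)"] n4 by simp
  then show ?thesis using bar_step[of i "n - 1"] i by simp
qed

lemma bar_conj_n_left: "1 \<le> i \<Longrightarrow> i + 1 < n \<Longrightarrow> c n (bar i n) = br i (n - 1)"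
  and bar_conj_n_right: "1 \<le> i \<Longrightarrow> i + 1 < n \<Longrightarrow> c n (bar i (n - 1)) = br i n"
  using br_conj_n_left br_conj_n_right invol_n by metis+

lemma bar_conj_n_both: "c n (bar (n - 1) n) = neg (bar (n - 1) n)"
  using bar_start_D t_n_self by simp

lemma bar_conj_n_small: "1 \<le> i \<Longrightarrow> i < j \<Longrightarrow> j + 1 < n \<Longrightarrow> c n (bar i j) = bar i j"
proof (induction "n - j" arbitrary: j rule: less_induct)
  case less
  have b: "bar i j = c j (bar i (Suc j))" using bar_step[of i j] less by simp
  show ?case
  proof (cases "j = n - 2")
    case True
    then have Sj: "Suc j = n - 1" using n4 by simp
    \<comment> \<open>For j = n - 2 the element is c_j c_n [i, n], and c_j fixes [i, n]; the braid
      law of the nodes n - 2 and n turns an additional c_n into that c_j.\<close>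
    have *: "bar i (n - 1) = c n (br i n)" using br_conj_n_right less by simp
    have "c j (br i n) = br i n" using br_conj[of i n j] less True by (auto simp: transpose_def)
    then show ?thesis using b * Sj True braid_n[of "br i n"] by simp
  next
    case False
    then show ?thesis using less b comm_n[of j "bar i (Suc j)"] by simp
  qed
qed

end

text \<open>s_n changes the sign of e_n alone, so c_n exchanges [i, n] with the barred [i, n] and
  fixes all pairs below n. \<open>sg i\<close> plays the role of e_i; \<open>t_n_next\<close> says
  that s_n fixes e_(n-1).\<close>

locale conjugation_B = conjugation_bar +
  fixes sg :: "nat \<Rightarrow> 'o"
  assumes invol_n: "c n (c n x) = x"
    and comm_n: "1 \<le> k \<Longrightarrow> k + 1 < n \<Longrightarrow> c n (c k x) = c k (c n x)"
    and braid_n: "c n (c (n - 1) (c n (c (n - 1) x))) = c (n - 1) (c n (c (n - 1) (c n x)))"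
    and t_n_self: "c n (t n) = neg (t n)"
    and t_n_far: "1 \<le> k \<Longrightarrow> k + 1 < n \<Longrightarrow> c n (t k) = t k"
    and t_far_n: "1 \<le> k \<Longrightarrow> k + 1 < n \<Longrightarrow> c k (t n) = t n"
    and t_n_next: "c n (c (n - 1) (t n)) = c (n - 1) (t n)"
    and bar_start_B: "bar (n - 1) n = c n (t (n - 1))"
    and sg_start: "sg n = t n"
    and sg_step: "1 \<le> i \<Longrightarrow> i < n \<Longrightarrow> sg i = c i (sg (Suc i))"
begin

lemma br_conj_n_small: "1 \<le> i \<Longrightarrow> i < j \<Longrightarrow> j < n \<Longrightarrow> c n (br i j) = br i j"
proof (induction j)
  case (Suc j)
  show ?case
  proof (cases "j = i")
    case True
    then show ?thesis using Suc br_start[of i] t_n_far[of i] by simp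
  next
    case False
    then show ?thesis using Suc br_step[of i j] comm_n[of j "br i j"] by simp
  qed
qed simp

lemma br_conj_n_last: "1 \<le> i \<Longrightarrow> i < n \<Longrightarrow> c n (br i n) = bar i n"
proof (induction "n - i" arbitrary: i rule: less_induct)
  case less
  show ?case
  proof (cases "i = n - 1")
    case True
    then show ?thesis using br_start[of i] bar_start_B less by simp
  next
    case False
    have "br i n = c i (br (Suc i) n)"
      using br_conj[of "Suc i" n i] False less by (auto simp: transpose_def split: if_splits)
    then have "c n (br i n) = c i (bar (Suc i) n)"
      using comm_n[of i "br (Suc i) n"] less False by simp
    then show ?thesis using bar_last[of i] less False by simp
  qed
qed

lemma bar_conj_n_last: "1 \<le> i \<Longrightarrow> i < n \<Longrightarrow> c n (bar i n) = br i n"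
  using br_conj_n_last invol_n by metis

lemma bar_conj_n_small: "1 \<le> i \<Longrightarrow> i < j \<Longrightarrow> j < n \<Longrightarrow> c n (bar i j) = bar i j"
proof (induction "n - j" arbitrary: j rule: less_induct)
  case less
  have b: "bar i j = c j (bar i (Suc j))" using bar_step[of i j] less by simp
  show ?case
  proof (cases "j = n - 1")
    case True
    then have Sj: "Suc j = n" using less by simp
    \<comment> \<open>For j = n - 1 the element is c_j c_n c_j [i, j]. The relation of length four
      moves an outer c_n to the innermost place, where it fixes [i, j].\<close>
    have *: "bar i n = c n (br i n)" "br i n = c j (br i j)"
      using br_conj_n_last[of i] br_step[of i j] less Sj by simp_all
    have "c n (br i j) = br i j" using br_conj_n_small less by simp
    then have "c n (bar i j) = c j (c n (c j (br i j)))"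
      using b * Sj True braid_n[of "br i j"] by simp
    then show ?thesis using b * Sj by simp
  next
    case False
    then show ?thesis using less b comm_n[of j "bar i (Suc j)"] by simp
  qed
qed

lemma sg_conj:
  assumes "1 \<le> i" "i \<le> n" "1 \<le> k" "k < n"
  shows "c k (sg i) = sg (s k i)"
  using assms
proof (induction "n - i" arbitrary: i k rule: less_induct)
  case less
  note IH = less.hyps and pr = less.prems
  consider "k = i" | "Suc k = i" | "k + 1 < i" | "k = Suc i" | "k > Suc i" by linarith
  then show ?case
  proof cases
    case 1
    then show ?thesis using sg_step[of i] pr invol by (auto simp: transpose_def)
  next
    case 2
    then show ?thesis using sg_step[of k] pr by (auto simp: transpose_def)
  next
    case 3
    show ?thesis
    proof (cases "i = n")
      case True
      then show ?thesis using sg_start t_far_n[of k] 3 pr by (auto simp: transpose_def)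
    next
      case False
      then have "sg i = c i (sg (Suc i))" "c k (sg (Suc i)) = sg (Suc i)"
        using sg_step[of i] IH[of "Suc i" k] 3 pr by (auto simp: transpose_def)
      then show ?thesis using comm[of k i "sg (Suc i)"] 3 False pr by (auto simp: transpose_def)
    qed
  next
    case 4
    have b: "sg i = c i (sg k)" "sg k = c k (sg (Suc k))"
      using sg_step[of i] sg_step[of k] 4 pr by auto
    have "c k (sg i) = c i (c k (c i (sg (Suc k))))"
      using b braid[of i "sg (Suc k)"] 4 pr by simp
    also have "c i (sg (Suc k)) = sg (Suc k)"
      using IH[of "Suc k" i] 4 pr by (auto simp: transpose_def)
    finally show ?thesis using b 4 pr by (auto simp: transpose_def)
  next
    case 5
    then have b: "sg i = c i (sg (Suc i))" "c k (sg (Suc i)) = sg (Suc i)"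
      using sg_step[of i] IH[of "Suc i" k] pr by (auto simp: transpose_def)
    then show ?thesis using comm[of i k "sg (Suc i)"] 5 pr by (auto simp: transpose_def)
  qed
qed

lemma sg_conj_n: "1 \<le> i \<Longrightarrow> i < n \<Longrightarrow> c n (sg i) = sg i"
proof (induction "n - i" arbitrary: i rule: less_induct)
  case less
  have b: "sg i = c i (sg (Suc i))" using sg_step[of i] less by simp
  show ?case
  proof (cases "i = n - 1")
    case True
    then show ?thesis using b sg_start t_n_next less by simp
  next
    case False
    then show ?thesis using b less comm_n[of i "sg (Suc i)"] by simp
  qed
qed

end

section \<open>Recursions for the bracket elements\<close>

lemma neg_one_power_commute: "x * (-1) ^ m = (-1) ^ m * (x :: 'a::ring_1)"
  by (cases "even m") simp_all

lemma t_up_rec: "i \<le> j \<Longrightarrow> t_up i j = tv i * t_up (Suc i) j"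
  and t_up_last: "i \<le> Suc j \<Longrightarrow> t_up i (Suc j) = t_up i j * tv (Suc j)"
  and t_up_empty: "j < i \<Longrightarrow> t_up i j = 1"
  by (auto simp: t_up_def upt_conv_Cons mult.assoc not_less_eq_eq)

lemma t_down_rec: "j \<le> Suc i \<Longrightarrow> t_down (Suc i) j = tv (Suc i) * t_down i j"
  and t_down_last: "j \<le> i \<Longrightarrow> t_down i j = t_down i (Suc j) * tv j"
  and t_down_empty: "i < j \<Longrightarrow> t_down i j = 1"
  by (auto simp: t_down_def upt_conv_Cons mult.assoc not_less_eq_eq)

lemma bracket_start: "bracket i (Suc i) = tv i"
  by (simp add: bracket_def t_up_empty t_down_empty)

text \<open>The prefactor of \<open>bracket\<close> counts the conjugations applied to t_i, so it
  disappears once each conjugation carries its own minus sign. These recursions hold in the free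
  algebra, before any relation is imposed.\<close>

lemma bracket_step:
  assumes "i < j"
  shows "bracket i (Suc j) = - (tv j * bracket i j * tv j)"
proof -
  obtain m where m: "j = Suc m" using assms by (cases j) auto
  have "j - i = Suc (m - i)" "j - i - 1 = m - i" using assms m by auto
  then show ?thesis
    using assms m neg_one_power_commute[of "tv (Suc m)" "m - i"]
    by (simp add: bracket_def t_up_last t_down_rec mult.assoc[symmetric])
qed

lemma bracket_antisym: "i \<noteq> j \<Longrightarrow> bracket j i = - bracket i j"
  by (auto simp: bracket_def)

lemma bracket_bar_sym: "bracket_bar W n i j = bracket_bar W n j i"
  by (simp add: bracket_bar_def min.commute max.commute)

lemma bracket_bar_step:
  assumes "i < j" "j < n"
  shows "bracket_bar W n i j = - (tv j * bracket_bar W n i (Suc j) * tv j)"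
proof -
  have "j \<le> n - 1" "Suc j - i = Suc (j - i)" "Suc j - i - 1 = Suc (j - i - 1)" "max i j = j" "max i (Suc j) = Suc j"
    "min i j = i" "min i (Suc j) = i" using assms by auto
  then show ?thesis
    using neg_one_power_commute[of "tv j" "j - i"] neg_one_power_commute[of "tv j" "j - i - 1"]
    by (cases W) (simp_all add: bracket_bar_def bracket_bar_lt_def t_up_rec[of j] t_down_last[of j] mult.assoc[symmetric])
qed

lemma bracket_bar_last:
  assumes "Suc i < n"
  shows "bracket_bar W n i n = - (tv i * bracket_bar W n (Suc i) n * tv i)"
proof -
  have "i \<le> n - 2" "n - i = Suc (n - Suc i)" "n - i - 1 = Suc (n - Suc i - 1)"
    "max i n = n" "max (Suc i) n = n" "min i n = i" "min (Suc i) n = Suc i" "n - 1 < n" using assms by auto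
  then show ?thesis
    using neg_one_power_commute[of "tv i" "n - Suc i"] neg_one_power_commute[of "tv i" "n - Suc i - 1"]
    by (cases W) (simp_all add: bracket_bar_def bracket_bar_lt_def t_up_empty t_down_empty
        t_up_rec[of i] t_down_last[of i] mult.assoc[symmetric])
qed

text \<open>The starting points of the two types differ: in type B the element at (n - 1, n) is the
  signed conjugate of t_(n-1) by t_n, in type D it is the generator t_n. In type A the value 0 lets
  later formulas treat all three types alike.\<close>

lemma bracket_bar_start:
  assumes "2 \<le> n"
  shows "bracket_bar TypeA n i j = 0"
    "bracket_bar TypeB n (n - 1) n = - (tv n * tv (n - 1) * tv n)"
    "bracket_bar TypeD n (n - 1) n = tv n"
proof -
  have "min (n - 1) n = n - 1" "max (n - 1) n = n" "n - (n - 1) = 1" "n - 2 < n - 1" using assms by auto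
  then show "bracket_bar TypeB n (n - 1) n = - (tv n * tv (n - 1) * tv n)" "bracket_bar TypeD n (n - 1) n = tv n"
    using assms by (simp_all add: bracket_bar_def bracket_bar_lt_def t_up_empty t_down_empty mult.assoc[symmetric])
qed (simp add: bracket_bar_def bracket_bar_lt_def)

lemma bracket_single_start: "1 \<le> n \<Longrightarrow> bracket_single n n = tv n"
  by (simp add: bracket_single_def t_up_rec t_up_empty t_down_empty)

lemma bracket_single_step:
  assumes "i < n"
  shows "bracket_single n i = - (tv i * bracket_single n (Suc i) * tv i)"
proof -
  have "i \<le> n - 1" "n - i = Suc (n - Suc i)" using assms by auto
  then show ?thesis
    using neg_one_power_commute[of "tv i" "n - Suc i"] assms
    by (simp add: bracket_single_def t_up_rec[of i] t_down_last[of i] mult.assoc[symmetric])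
qed

section \<open>The dual of the normally ordered words\<close>

text \<open>A function \<open>f\<close> on triples \<open>(x, w, p)\<close> is thought of as a functional on the span of the words
  \<open>\<xi>\<^bsub>x\<^esub> t\<^bsub>w\<^esub> y\<^bsub>p\<^esub>\<close>; the generators act from the right on these functionals.  The first argument of
  \<open>act\<close> in \<open>C j i\<close> only matters on the generators \<open>t\<^sub>k\<close>.\<close>

type_synonym dual = "nat list \<times> nat list \<times> nat list \<Rightarrow> complex"

locale spin_daha =
  fixes W :: weyl_type and n :: nat and u v :: complex
  assumes adm: "admissible W n"
begin

text \<open>Only the unsigned part of the reflection s_k; signs are kept apart in
  \<open>eta\<close>, since t_k passes every \<xi> with the same sign -1 and only the y see which
  index is negated. In type B, s_n permutes nothing.\<close>

definition prm :: "nat \<Rightarrow> nat \<Rightarrow> nat"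
  where "prm k = (if k < n then Transposition.transpose k (Suc k)
    else if W = TypeD then Transposition.transpose (n - 1) n else id)"

definition flip :: "nat \<Rightarrow> nat \<Rightarrow> bool"
  where "flip k j \<longleftrightarrow> n \<le> k \<and> (W = TypeB \<and> j = n \<or> W = TypeD \<and> (j = n \<or> j = n - 1))"

definition eta :: "nat \<Rightarrow> nat \<Rightarrow> complex"
  where "eta k j = (if flip k j then -1 else 1)"

text \<open>The transpose of left multiplication by t_k on normally ordered words: t_k passes each
  letter of \<xi>_x at the cost of a sign and then joins the t-word on its left.\<close>

definition op_T :: "nat \<Rightarrow> dual \<Rightarrow> dual"
  where "op_T k f = (\<lambda>(x, w, p). (-1) ^ length x * f (map (prm k) x, k # w, p))"

definition op_X :: "nat \<Rightarrow> dual \<Rightarrow> dual"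
  where "op_X i f = (\<lambda>(x, w, p). f (i # x, w, p))"

definition op_t :: "generator \<Rightarrow> dual \<Rightarrow> dual"
  where "op_t g = (case g of Gen_t k \<Rightarrow> op_T k | _ \<Rightarrow> (\<lambda>f. f))"

text \<open>The words contain arbitrary natural numbers. A letter \<xi>_i with i outside
  \<open>{1..n}\<close> is made to commute with every y_j, which keeps all compatibility statements
  true without a range condition on words.\<close>

definition C :: "nat \<Rightarrow> nat \<Rightarrow> dual \<Rightarrow> dual"
  where "C j i f = (if i \<in> {1..n} then act op_t (commutator_value W n u v j i) f else 0)"

text \<open>Together with \<open>eps\<close> this encodes y_j t_w = \<open>eps w j\<close> t_w
  y_(\<open>idx w j\<close>): y_j meets the leftmost letter of w first. In \<open>wprm\<close>, on
  the contrary, the leftmost letter is applied last, because there t_w moves to the right across the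
  \<xi>.\<close>

primrec idx :: "nat list \<Rightarrow> nat \<Rightarrow> nat" where
  "idx [] j = j"
| "idx (k # w) j = idx w (prm k j)"

primrec eps :: "nat list \<Rightarrow> nat \<Rightarrow> complex" where
  "eps [] j = 1"
| "eps (k # w) j = eta k j * eps w (prm k j)"

primrec yrec :: "nat list \<Rightarrow> nat \<Rightarrow> dual \<Rightarrow> nat list \<Rightarrow> nat list \<Rightarrow> complex" where
  "yrec [] j f w p = eps w j * f ([], w, idx w j # p)"
| "yrec (i # x) j f w p = yrec x j (op_X i f) w p + C j i f (x, w, p)"

definition op_Y :: "nat \<Rightarrow> dual \<Rightarrow> dual"
  where "op_Y j f = (\<lambda>(x, w, p). yrec x j f w p)"

lemma op_T_apply: "op_T k f (x, w, p) = (-1) ^ length x * f (map (prm k) x, k # w, p)"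
  and op_X_apply: "op_X i f (x, w, p) = f (i # x, w, p)"
  and op_Y_Nil: "op_Y j f ([], w, p) = eps w j * f ([], w, idx w j # p)"
  and op_Y_Cons: "op_Y j f (i # x, w, p) = op_Y j (op_X i f) (x, w, p) + C j i f (x, w, p)"
  by (simp_all add: op_T_def op_X_def op_Y_def)

text \<open>A triple \<open>(l, r, s)\<close> stands for the relation t_l = s t_r. All defining
  relations of the spin algebra have a single word on each side, so they can be imposed on functions
  of words.\<close>

definition spin_rules :: "(nat list \<times> nat list \<times> complex) set"
  where "spin_rules =
      {([i, i], [], 1) | i. i \<in> t_indices W n}
    \<union> {([i, i + 1, i], [i + 1, i, i + 1], 1) | i. 1 \<le> i \<and> i + 1 < n}
    \<union> {([i, j, i, j], [], -1) | i j. i \<in> {1..n-1} \<and> j \<in> {1..n-1} \<and> \<bar>int i - int j\<bar> > 1}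
    \<union> (case W of TypeA \<Rightarrow> {}
        | TypeB \<Rightarrow> {([i, n, i, n], [], -1) | i. 1 \<le> i \<and> i + 1 < n}
            \<union> {([n - 1, n, n - 1, n, n - 1, n, n - 1, n], [], -1)}
        | TypeD \<Rightarrow> {([i, n, i, n], [], -1) | i. i \<in> {1..n} - {n - 2, n}}
            \<union> {([n - 2, n, n - 2], [n, n - 2, n], 1)})"

abbreviation tmono :: "nat list \<Rightarrow> free_elem"
  where "tmono w \<equiv> prod_list (map tv w)"

lemma spin_relations_eq:
  "spin_relations W n = (\<lambda>(l, r, s). tmono l - scalar s * tmono r) ` spin_rules"
proof -
  have img: "F ` {(a i, b i, c i) | i. P i} = {F (a i, b i, c i) | i. P i}"
      "F ` {(a' i j, b' i j, c' i j) | i j. Q i j} = {F (a' i j, b' i j, c' i j) | i j. Q i j}"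
    for F :: "nat list \<times> nat list \<times> complex \<Rightarrow> free_elem" and P Q a b c a' b' c'
    by blast+
  have s1: "scalar 1 = 1" "scalar (-1) = - 1"
    by (simp_all add: scalar_def single_uminus single_one zero_list_def[symmetric])
  have A: "spin_relations_A n = (\<lambda>(l, r, s). tmono l - scalar s * tmono r) `
      ({([i, i], [], 1) | i. i \<in> {1..n-1}}
      \<union> {([i, i + 1, i], [i + 1, i, i + 1], 1) | i. 1 \<le> i \<and> i + 1 < n}
      \<union> {([i, j, i, j], [], -1) | i j. i \<in> {1..n-1} \<and> j \<in> {1..n-1} \<and> \<bar>int i - int j\<bar> > 1})"
  proof -
    have "i \<in> {1..n-1} \<and> i + 1 \<in> {1..n-1} \<longleftrightarrow> 1 \<le> i \<and> i + 1 < n" for i by auto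
    then show ?thesis
      unfolding spin_relations_A_def image_Un img by (simp add: power2_eq_square s1 mult.assoc)
  qed
  show ?thesis
  proof (cases W)
    case TypeA
    then show ?thesis using A unfolding spin_rules_def by simp
  next
    case TypeB
    then have n: "n - Suc 0 \<in> {1..n-1}" "n \<noteq> 0" "Suc (n - 1) = n" using adm by auto
    then have "{1..n} = insert n {1..n-1}" by auto
    then have e: "spin_rules = ({([i, i], [], 1) | i. i \<in> {1..n-1}}
      \<union> {([i, i + 1, i], [i + 1, i, i + 1], 1) | i. 1 \<le> i \<and> i + 1 < n}
      \<union> {([i, j, i, j], [], -1) | i j. i \<in> {1..n-1} \<and> j \<in> {1..n-1} \<and> \<bar>int i - int j\<bar> > 1})
      \<union> {([n, n], [], 1)} \<union> {([i, n, i, n], [], -1) | i. i \<in> {1..n} - {n-1, n}}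
      \<union> {([n - 1, n, n - 1, n, n - 1, n, n - 1, n], [], -1)}"
      using TypeB unfolding spin_rules_def by auto
    show ?thesis
      using A unfolding e image_Un img
      by (simp add: TypeB insert_commute Un_ac power2_eq_square power4_eq_xxxx s1 mult.assoc)
  next
    case TypeD
    then have n: "n - Suc 0 \<in> {1..n-1}" "n \<noteq> 0" "Suc (n - 1) = n" using adm by auto
    then have "{1..n} = insert n {1..n-1}" by auto
    then have e: "spin_rules = ({([i, i], [], 1) | i. i \<in> {1..n-1}}
      \<union> {([i, i + 1, i], [i + 1, i, i + 1], 1) | i. 1 \<le> i \<and> i + 1 < n}
      \<union> {([i, j, i, j], [], -1) | i j. i \<in> {1..n-1} \<and> j \<in> {1..n-1} \<and> \<bar>int i - int j\<bar> > 1})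
      \<union> {([n, n], [], 1)} \<union> {([i, n, i, n], [], -1) | i. i \<in> {1..n} - {n-2, n}}
      \<union> {([n - 2, n, n - 2], [n, n - 2, n], 1)}"
      using TypeD unfolding spin_rules_def by auto
    show ?thesis
      using A unfolding e image_Un img
      by (simp add: TypeD insert_commute Un_ac power2_eq_square s1 mult.assoc)
  qed
qed

section \<open>Signed permutations of the indices\<close>

lemma prm_invol [simp]: "prm k (prm k j) = j"
  by (simp add: prm_def)

lemma prm_eq_iff [simp]: "prm k a = prm k b \<longleftrightarrow> a = b"
  by (metis prm_invol)

lemma prm_range: "k \<in> t_indices W n \<Longrightarrow> prm k j \<in> {1..n} \<longleftrightarrow> j \<in> {1..n}"
  using adm unfolding prm_def by (cases W) (auto simp: transpose_def)

lemma n_pos: "1 \<le> n"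
  using adm by (cases W) auto

lemma n_B: "W = TypeB \<Longrightarrow> 2 \<le> n" and n_D: "W = TypeD \<Longrightarrow> 4 \<le> n"
  using adm by simp_all

lemma t_indices_lt: "1 \<le> k \<Longrightarrow> k < n \<Longrightarrow> k \<in> t_indices W n"
  by (cases W) auto

lemma flip_prm [simp]: "flip k (prm k j) \<longleftrightarrow> flip k j"
  by (auto simp: flip_def prm_def transpose_def)

lemma eta_prm [simp]: "eta k (prm k j) = eta k j"
  by (simp add: eta_def)

lemma eta_sq [simp]: "eta k j * eta k j = 1"
  by (simp add: eta_def)

lemma eta_lt [simp]: "k < n \<Longrightarrow> eta k j = 1"
  by (simp add: eta_def flip_def)

definition wprm :: "nat list \<Rightarrow> nat \<Rightarrow> nat"
  where "wprm w = foldr (\<lambda>k g. prm k \<circ> g) w id"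

lemma wprm_simps [simp]: "wprm [] = id" "wprm (k # w) = prm k \<circ> wprm w"
  by (simp_all add: wprm_def)

lemma prm_values:
  "k < n \<Longrightarrow> prm k = Transposition.transpose k (Suc k)"
  "W = TypeD \<Longrightarrow> prm n = Transposition.transpose (n - 1) n"
  "W = TypeB \<Longrightarrow> prm n = id"
  unfolding prm_def by simp_all

lemma flip_values:
  "k < n \<Longrightarrow> flip k j \<longleftrightarrow> False"
  "W = TypeD \<Longrightarrow> flip n j \<longleftrightarrow> j = n \<or> j = n - 1"
  "W = TypeB \<Longrightarrow> flip n j \<longleftrightarrow> j = n"
  unfolding flip_def by auto

lemma spin_rules_cases:
  assumes "(l, r, s) \<in> spin_rules"
  obtains (sq) i where "i \<in> t_indices W n" "l = [i, i]" "r = []" "s = 1"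
  | (braid) i where "1 \<le> i" "i + 1 < n" "l = [i, i + 1, i]" "r = [i + 1, i, i + 1]" "s = 1"
  | (far) i j where "i \<in> {1..n-1}" "j \<in> {1..n-1}" "\<bar>int i - int j\<bar> > 1" "l = [i, j, i, j]" "r = []" "s = - 1"
  | (far_B) i where "W = TypeB" "1 \<le> i" "i + 1 < n" "l = [i, n, i, n]" "r = []" "s = - 1"
  | (braid_B) "W = TypeB" "l = [n - 1, n, n - 1, n, n - 1, n, n - 1, n]" "r = []" "s = - 1"
  | (far_D) i where "W = TypeD" "i \<in> {1..n} - {n - 2, n}" "l = [i, n, i, n]" "r = []" "s = - 1"
  | (braid_D) "W = TypeD" "l = [n - 2, n, n - 2]" "r = [n, n - 2, n]" "s = 1"
  using assms unfolding spin_rules_def by (cases W) auto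

text \<open>Ensures that both sides of a relation pick up the same sign when they are moved across a
  \<xi>-word.\<close>

lemma spin_rules_parity: "(l, r, s) \<in> spin_rules \<Longrightarrow> even (length l) \<longleftrightarrow> even (length r)"
  by (erule spin_rules_cases) simp_all

lemma transpose_disjoint:
  assumes "a \<noteq> c" "a \<noteq> d" "b \<noteq> c" "b \<noteq> d"
  shows "Transposition.transpose a b (Transposition.transpose c d x)
    = Transposition.transpose c d (Transposition.transpose a b x)"
  using assms by (simp add: transpose_def)

lemma prm_comm:
  assumes "i < n" "j < n" "i + 1 < j \<or> j + 1 < i"
  shows "prm i (prm j x) = prm j (prm i x)"
  unfolding prm_values(1)[OF assms(1)] prm_values(1)[OF assms(2)]
  by (rule transpose_disjoint) (use assms in auto)

lemma prm_comm_D: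
  assumes "W = TypeD" "i < n" "i \<noteq> n - 2"
  shows "prm i (prm n x) = prm n (prm i x)" "flip n (prm i x) = flip n x"
proof -
  have i: "i = n - 1 \<and> Suc i = n \<or> Suc i < n - 1" using assms n_D[OF assms(1)] by auto
  then show "prm i (prm n x) = prm n (prm i x)"
  proof (elim disjE)
    assume "Suc i < n - 1"
    then show ?thesis
      unfolding prm_values(1)[OF assms(2)] prm_values(2)[OF assms(1)]
      by (intro transpose_disjoint) auto
  next
    assume "i = n - 1 \<and> Suc i = n"
    then have "prm i = prm n" using prm_values(1)[OF assms(2)] prm_values(2)[OF assms(1)] by simp
    then show ?thesis by simp
  qed
  show "flip n (prm i x) = flip n x"
    using i unfolding prm_values(1)[OF assms(2)] flip_values(2)[OF assms(1)] by (auto simp: transpose_def)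
qed

lemma transpose_braid:
  assumes "a \<noteq> b" "b \<noteq> c" "a \<noteq> c"
  shows "Transposition.transpose a b (Transposition.transpose b c (Transposition.transpose a b x))
    = Transposition.transpose b c (Transposition.transpose a b (Transposition.transpose b c x))"
  using assms by (simp add: transpose_def)

text \<open>The sign half of the D_n braid relation, with a, b, c = n - 2, n - 1, n: one side meets
  t_n once, the other twice, and the numbers of sign changes must agree modulo 2.\<close>

lemma transpose_flip:
  assumes "a \<noteq> b" "b \<noteq> c" "a \<noteq> c"
  shows "(Transposition.transpose a b j = c \<or> Transposition.transpose a b j = b) \<longleftrightarrow> ((j = c \<or> j = b) \<noteq>
    (Transposition.transpose a b (Transposition.transpose b c j) = c
     \<or> Transposition.transpose a b (Transposition.transpose b c j) = b))"
  using assms by (auto simp: transpose_def)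

text \<open>Signed permutations represent the ordinary Weyl group, so the scalar s = -1 of a spin
  relation leaves no trace on indices and signs.\<close>

lemma spin_rules_action:
  assumes "(l, r, s) \<in> spin_rules"
  shows "wprm l = wprm r" "idx l j = idx r j" "eps l j = eps r j"
proof -
  have "wprm l = wprm r \<and> idx l j = idx r j \<and> eps l j = eps r j"
    using assms
  proof (cases rule: spin_rules_cases)
    case (sq i)
    then show ?thesis by (auto simp: fun_eq_iff)
  next
    case (braid i)
    have "prm i (prm (Suc i) (prm i x)) = prm (Suc i) (prm i (prm (Suc i) x))" for x
      using braid(2) transpose_braid[of i "Suc i" "Suc (Suc i)" x] by (simp add: prm_values(1))
    then show ?thesis unfolding braid(3-) using braid(2) by (simp add: fun_eq_iff)
  next
    case (far i j)
    have "prm i (prm j x) = prm j (prm i x)" for x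
      by (rule prm_comm) (use far(1-3) in auto)
    moreover have "i < n" "j < n" using far(1,2) by auto
    ultimately show ?thesis unfolding far(4-) by (simp add: fun_eq_iff)
  next
    case (far_B i)
    note p = prm_values(3)[OF far_B(1)] flip_values(3)[OF far_B(1)]
    have f: "prm i x = n \<longleftrightarrow> x = n" for x
      using far_B(3) prm_values(1)[of i] by (auto simp: transpose_def)
    show ?thesis unfolding far_B(4-)
      using far_B(3) by (simp add: fun_eq_iff p f eta_def flip_values(1))
  next
    case braid_B
    note p = prm_values(3)[OF braid_B(1)] flip_values(3)[OF braid_B(1)]
    show ?thesis unfolding braid_B(2-)
      using n_B[OF braid_B(1)] by (simp add: fun_eq_iff p eta_def flip_values(1))
  next
    case (far_D i)
    note p = prm_values(2)[OF far_D(1)] flip_values(2)[OF far_D(1)]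
    have "prm i (prm n x) = prm n (prm i x)" for x
      using prm_comm_D[OF far_D(1), of i x] far_D(2) by auto
    moreover have "flip n (prm i x) = flip n x" for x
      using prm_comm_D[OF far_D(1), of i x] far_D(2) by auto
    moreover have "flip i x = False" for x
      by (rule flip_values(1)) (use far_D(2) in auto)
    ultimately show ?thesis unfolding far_D(3-)
      by (simp add: fun_eq_iff eta_def)
  next
    case braid_D
    note p = prm_values(2)[OF braid_D(1)] flip_values(2)[OF braid_D(1)]
    have abc: "n - 2 \<noteq> n - 1" "n - 1 \<noteq> n" "n - 2 \<noteq> n" "n - 2 < n" "Suc (n - 2) = n - 1"
      using n_D[OF braid_D(1)] by auto
    have q: "prm (n - 2) = Transposition.transpose (n - 2) (n - 1)"
      using prm_values(1)[of "n - 2"] abc by simp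
    note b = transpose_braid[OF abc(1-3)] and f = transpose_flip[OF abc(1-3), of j]
    have sign: "(if P then -1 else 1) = (if Q then -1 else 1) * (if R then -1 else (1 :: complex))"
      if "P \<longleftrightarrow> Q \<noteq> R" for P Q R
      using that by simp
    have "eps [n - 2, n, n - 2] j = eps [n, n - 2, n] j"
      unfolding eps.simps eta_def flip_values(1)[OF abc(4)] p q if_False mult_1_left mult_1_right
      by (rule sign[OF f])
    moreover have "idx [n - 2, n, n - 2] j = idx [n, n - 2, n] j"
      unfolding idx.simps p q by (rule b)
    moreover have "wprm [n - 2, n, n - 2] = wprm [n, n - 2, n]"
      unfolding wprm_simps p q by (rule ext) (simp only: o_apply id_apply b)
    ultimately show ?thesis unfolding braid_D(2-) by blast
  qed
  then show "wprm l = wprm r" "idx l j = idx r j" "eps l j = eps r j" by auto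
qed

lemma idx_append: "idx (w @ w') j = idx w' (idx w j)"
  by (induction w arbitrary: j) simp_all

lemma eps_append: "eps (w @ w') j = eps w j * eps w' (idx w j)"
  by (induction w arbitrary: j) simp_all

text \<open>Each condition is imposed in every context, which amounts to vanishing on the two-sided
  ideals of relations in the three factors. The skew condition asks a \<noteq> b: the square of a
  \<xi> is not zero in the skew-polynomial algebra.\<close>

definition U :: "dual set"
  where "U = {f. (\<forall>x x' a b w p. a \<noteq> b \<longrightarrow> f (x @ a # b # x', w, p) = - f (x @ b # a # x', w, p))
    \<and> (\<forall>l r s x w w' p. (l, r, s) \<in> spin_rules \<longrightarrow> f (x, w @ l @ w', p) = s * f (x, w @ r @ w', p))
    \<and> (\<forall>x w p p' i j. f (x, w, p @ i # j # p') = f (x, w, p @ j # i # p'))}"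

lemma U_skew:
  assumes "f \<in> U" "a \<noteq> b"
  shows "f (x @ a # b # x', w, p) = - f (x @ b # a # x', w, p)"
  by (rule assms(1)[unfolded U_def mem_Collect_eq, THEN conjunct1, rule_format, OF assms(2)])

lemma U_spin:
  assumes "f \<in> U" "(l, r, s) \<in> spin_rules"
  shows "f (x, w @ l @ w', p) = s * f (x, w @ r @ w', p)"
  by (rule assms(1)[unfolded U_def mem_Collect_eq, THEN conjunct2, THEN conjunct1, rule_format, OF assms(2)])

lemma U_comm:
  assumes "f \<in> U"
  shows "f (x, w, p @ i # j # p') = f (x, w, p @ j # i # p')"
  by (rule assms[unfolded U_def mem_Collect_eq, THEN conjunct2, THEN conjunct2, rule_format])

lemma U_intro:
  assumes "\<And>x x' a b w p. a \<noteq> b \<Longrightarrow> f (x @ a # b # x', w, p) = - f (x @ b # a # x', w, p)"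
    and "\<And>l r s x w w' p. (l, r, s) \<in> spin_rules \<Longrightarrow> f (x, w @ l @ w', p) = s * f (x, w @ r @ w', p)"
    and "\<And>x w p p' i j. f (x, w, p @ i # j # p') = f (x, w, p @ j # i # p')"
  shows "f \<in> U"
  unfolding U_def mem_Collect_eq by (intro conjI allI impI) (rule assms; assumption?)+

lemma U_zero [simp]: "0 \<in> U"
  by (rule U_intro) simp_all

lemma U_add [simp]:
  assumes "f \<in> U" "g \<in> U"
  shows "f + g \<in> U"
proof (rule U_intro)
  show "(f + g) (x @ a # b # x', w, p) = - (f + g) (x @ b # a # x', w, p)" if "a \<noteq> b" for x a b x' w p
    unfolding plus_fun_apply U_skew[OF assms(1) that] U_skew[OF assms(2) that] by simp
  show "(f + g) (x, w @ l @ w', p) = s * (f + g) (x, w @ r @ w', p)"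
    if "(l, r, s) \<in> spin_rules" for l r s x w w' p
    unfolding plus_fun_apply U_spin[OF assms(1) that] U_spin[OF assms(2) that] by (simp add: distrib_left)
  show "(f + g) (x, w, p @ i # j # p') = (f + g) (x, w, p @ j # i # p')" for x w p p' i j
    unfolding plus_fun_apply U_comm[OF assms(1), of x w p i] U_comm[OF assms(2), of x w p i] ..
qed

lemma U_scale [simp]:
  assumes "f \<in> U"
  shows "scale c f \<in> U"
proof (rule U_intro)
  show "scale c f (x @ a # b # x', w, p) = - scale c f (x @ b # a # x', w, p)" if "a \<noteq> b" for x a b x' w p
    unfolding scale_apply U_skew[OF assms that] by simp
  show "scale c f (x, w @ l @ w', p) = s * scale c f (x, w @ r @ w', p)"
    if "(l, r, s) \<in> spin_rules" for l r s x w w' p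
    unfolding scale_apply U_spin[OF assms that] by simp
  show "scale c f (x, w, p @ i # j # p') = scale c f (x, w, p @ j # i # p')" for x w p p' i j
    unfolding scale_apply U_comm[OF assms, of x w p i] ..
qed

lemma U_T [simp]: "f \<in> U \<Longrightarrow> op_T k f \<in> U"
proof (rule U_intro)
  assume f: "f \<in> U"
  show "op_T k f (x @ a # b # x', w, p) = - op_T k f (x @ b # a # x', w, p)" if "a \<noteq> b" for x a b x' w p
    using U_skew[OF f, of "prm k a" "prm k b" "map (prm k) x"] that by (simp add: op_T_apply)
  show "op_T k f (x, w @ l @ w', p) = s * op_T k f (x, w @ r @ w', p)"
    if "(l, r, s) \<in> spin_rules" for l r s x w w' p
    using U_spin[OF f that, of "map (prm k) x" "k # w"] by (simp add: op_T_apply)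
  show "op_T k f (x, w, p @ i # j # p') = op_T k f (x, w, p @ j # i # p')" for x w p p' i j
    unfolding op_T_apply U_comm[OF f, of _ _ p i] ..
qed

lemma U_X [simp]: "f \<in> U \<Longrightarrow> op_X i f \<in> U"
proof (rule U_intro)
  assume f: "f \<in> U"
  show "op_X i f (x @ a # b # x', w, p) = - op_X i f (x @ b # a # x', w, p)" if "a \<noteq> b" for x a b x' w p
    using U_skew[OF f that, of "i # x"] by (simp add: op_X_apply)
  show "op_X i f (x, w @ l @ w', p) = s * op_X i f (x, w @ r @ w', p)"
    if "(l, r, s) \<in> spin_rules" for l r s x w w' p
    unfolding op_X_apply by (rule U_spin[OF f that])
  show "op_X i f (x, w, p @ i' # j # p') = op_X i f (x, w, p @ j # i' # p')" for x w p p' i' j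
    unfolding op_X_apply by (rule U_comm[OF f])
qed

lemma linear_T: "linear_op (op_T k)"
  and linear_X: "linear_op (op_X i)"
  by (auto intro!: linear_opI simp: op_T_def op_X_def algebra_simps split: prod.splits)

lemma linear_t: "linear_op (op_t g)"
  by (cases g) (simp_all add: op_t_def linear_T linear_op_id)

lemmas T_linear = linear_op_rules[OF linear_T] and X_linear = linear_op_rules[OF linear_X]

lemma linear_act_t: "linear_op (act op_t p)"
  by (rule linear_op_act) (rule linear_t)

lemmas act_linear = linear_op_rules[OF linear_act_t]

lemma act_t_mult: "act op_t (p * q) f = act op_t q (act op_t p f)"
  by (rule act_mult) (rule linear_t)

lemma act_t_tv: "act op_t (tv k) f = op_T k f"
  by (simp add: tv_def act_single op_t_def scale_one)

lemma act_t_scalar: "act op (scalar c) f = scale c f"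
  by (simp add: scalar_def act_single)

lemmas act_simps = act_t_mult act_t_tv act_t_scalar act_add act_uminus act_diff act_one act_zero act_sum

lemma U_act_t [simp]: "f \<in> U \<Longrightarrow> act op_t p f \<in> U"
  by (rule act_closed) (auto simp: op_t_def split: generator.splits)

lemma fold_T_apply:
  "fold op_T l f (x, w, p) = (-1) ^ (length l * length x) * f (map (wprm l) x, l @ w, p)"
  by (induction l arbitrary: f x w) (simp_all add: op_T_apply power_add mult.commute)

lemma spin_rule_T:
  assumes "f \<in> U" "(l, r, s) \<in> spin_rules"
  shows "fold op_T l f = scale s (fold op_T r f)"
proof
  fix b :: "nat list \<times> nat list \<times> nat list"
  obtain x w p where b: "b = (x, w, p)" by (cases b)
  have e: "(-1) ^ (length l * length x) = ((-1) ^ (length r * length x) :: complex)"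
    using spin_rules_parity[OF assms(2)] by (cases "even (length r)") (simp_all add: power_mult)
  show "fold op_T l f b = scale s (fold op_T r f) b"
    using U_spin[OF assms, of _ "[]"] by (simp add: b e fold_T_apply spin_rules_action[OF assms(2)])
qed

lemma rule_mem:
  "k \<in> t_indices W n \<Longrightarrow> ([k, k], [], 1) \<in> spin_rules"
  "1 \<le> i \<Longrightarrow> Suc i < n \<Longrightarrow> ([i, Suc i, i], [Suc i, i, Suc i], 1) \<in> spin_rules"
  "1 \<le> i \<Longrightarrow> i < n \<Longrightarrow> 1 \<le> j \<Longrightarrow> j < n \<Longrightarrow> i + 1 < j \<or> j + 1 < i \<Longrightarrow> ([i, j, i, j], [], -1) \<in> spin_rules"
  "W = TypeB \<Longrightarrow> 1 \<le> i \<Longrightarrow> i + 1 < n \<Longrightarrow> ([i, n, i, n], [], -1) \<in> spin_rules"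
  "W = TypeB \<Longrightarrow> ([n - 1, n, n - 1, n, n - 1, n, n - 1, n], [], -1) \<in> spin_rules"
  "W = TypeD \<Longrightarrow> 1 \<le> i \<Longrightarrow> i < n \<Longrightarrow> i \<noteq> n - 2 \<Longrightarrow> ([i, n, i, n], [], -1) \<in> spin_rules"
  "W = TypeD \<Longrightarrow> ([n - 2, n, n - 2], [n, n - 2, n], 1) \<in> spin_rules"
  unfolding spin_rules_def by auto

lemma n_index: "W = TypeB \<or> W = TypeD \<Longrightarrow> n \<in> t_indices W n"
  using n_pos by auto

section \<open>The spin relations for the operators of the t\<close>

lemma T_sq: "f \<in> U \<Longrightarrow> k \<in> t_indices W n \<Longrightarrow> op_T k (op_T k f) = f"
  using spin_rule_T[OF _ rule_mem(1), of f k] by (simp add: scale_one)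

text \<open>Cancelling two of the four factors of (t_i t_j)^2 = -1 by t_i^2 = t_j^2 = 1 leaves t_i
  t_j = -t_j t_i.\<close>

lemma T_anticomm_rule:
  assumes "f \<in> U" "([i, j, i, j], [], -1) \<in> spin_rules" "i \<in> t_indices W n" "j \<in> t_indices W n"
  shows "op_T i (op_T j f) = - op_T j (op_T i f)"
proof -
  have "op_T j (op_T i (op_T j (op_T i f))) = - f"
    using spin_rule_T[OF assms(1,2)] by (simp add: scale_minus_one)
  then have "op_T i (op_T j (op_T j (op_T i (op_T j (op_T i f))))) = - op_T i (op_T j f)"
    by (simp only: T_linear)
  then have "op_T j (op_T i f) = - op_T i (op_T j f)"
    using assms by (simp only: T_sq U_T)
  then show ?thesis by (simp only: minus_minus)
qed

lemma T_far:
  assumes "f \<in> U" "1 \<le> i" "i < n" "1 \<le> j" "j < n" "i + 1 < j \<or> j + 1 < i"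
  shows "op_T i (op_T j f) = - op_T j (op_T i f)"
  by (rule T_anticomm_rule[OF assms(1) rule_mem(3)[OF assms(2-)]]) (rule t_indices_lt; fact)+

lemma T_far_B:
  assumes f: "f \<in> U" and W: "W = TypeB" and i: "1 \<le> i" "i + 1 < n"
  shows "op_T i (op_T n f) = - op_T n (op_T i f)" "op_T n (op_T i f) = - op_T i (op_T n f)"
proof -
  have t: "i \<in> t_indices W n" using t_indices_lt[of i] i by simp
  show *: "op_T i (op_T n f) = - op_T n (op_T i f)"
    by (rule T_anticomm_rule[OF f rule_mem(4)[OF W i] t n_index]) (use W in blast)
  then show "op_T n (op_T i f) = - op_T i (op_T n f)" by (simp only: minus_minus)
qed

lemma T_far_D:
  assumes f: "f \<in> U" and W: "W = TypeD" and i: "1 \<le> i" "i < n" "i \<noteq> n - 2"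
  shows "op_T i (op_T n f) = - op_T n (op_T i f)" "op_T n (op_T i f) = - op_T i (op_T n f)"
proof -
  have t: "i \<in> t_indices W n" using t_indices_lt[of i] i by simp
  show *: "op_T i (op_T n f) = - op_T n (op_T i f)"
    by (rule T_anticomm_rule[OF f rule_mem(6)[OF W i] t n_index]) (use W in blast)
  then show "op_T n (op_T i f) = - op_T i (op_T n f)" by (simp only: minus_minus)
qed

lemma T_braid:
  "f \<in> U \<Longrightarrow> 1 \<le> i \<Longrightarrow> Suc i < n \<Longrightarrow>
    op_T i (op_T (Suc i) (op_T i f)) = op_T (Suc i) (op_T i (op_T (Suc i) f))"
  using spin_rule_T[OF _ rule_mem(2), of f i] by (simp add: scale_one)

lemma T_braid_D:
  "f \<in> U \<Longrightarrow> W = TypeD \<Longrightarrow>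
    op_T (n - 2) (op_T n (op_T (n - 2) f)) = op_T n (op_T (n - 2) (op_T n f))"
  using spin_rule_T[OF _ rule_mem(7), of f] by (simp only: fold_simps scale_one)

lemma T_braid_B:
  assumes f: "f \<in> U" and W: "W = TypeB"
  shows "op_T n (op_T (n - 1) (op_T n (op_T (n - 1) f))) = - op_T (n - 1) (op_T n (op_T (n - 1) (op_T n f)))"
proof -
  let ?a = "op_T (n - 1)" and ?b = "op_T n"
  have t: "n - 1 \<in> t_indices W n" "n \<in> t_indices W n" using adm W by auto
  \<comment> \<open>Applying the rule of length eight to this g is a choice that lets half of the
    word cancel back to f, so that only the two words of length four remain.\<close>
  define g where "g = ?a (?b (?a (?b f)))"
  have g: "g \<in> U" using f by (simp add: g_def)
  have "?b (?a (?b (?a (?b (?a (?b (?a g))))))) = - g"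
    using spin_rule_T[OF g rule_mem(5)[OF W]] by (simp only: fold_simps scale_minus_one)
  moreover have "?b (?a (?b (?a g))) = f"
    unfolding g_def using t f by (simp only: T_sq U_T)
  ultimately show ?thesis by (simp add: g_def)
qed

end

section \<open>Conjugating the bracket elements\<close>

context spin_daha
begin

text \<open>The conjugation locales want their laws for all elements of a type, so both maps are the
  identity away from the operators of interest.\<close>

definition opr :: "free_elem \<Rightarrow> dual \<Rightarrow> dual"
  where "opr p = (\<lambda>f. if f \<in> U then act op_t p f else 0)"

definition cj :: "nat \<Rightarrow> (dual \<Rightarrow> dual) \<Rightarrow> dual \<Rightarrow> dual"
  where "cj k A = (if A \<in> range opr then (\<lambda>f. if f \<in> U then - op_T k (A (op_T k f)) else 0) else A)"

definition ng :: "(dual \<Rightarrow> dual) \<Rightarrow> dual \<Rightarrow> dual"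
  where "ng A = (if A \<in> range opr then (\<lambda>f. - A f) else A)"

lemma opr_eq_iff: "opr p = opr q \<longleftrightarrow> (\<forall>f\<in>U. act op_t p f = act op_t q f)"
  by (auto simp: opr_def fun_eq_iff split: if_splits)

lemma cj_opr: "cj k (opr p) = opr (- (tv k * p * tv k))"
  by (auto simp: cj_def opr_def act_simps)

lemma ng_opr: "ng (opr p) = opr (- p)"
  by (auto simp: ng_def opr_def act_simps fun_eq_iff)

lemma cj_junk: "A \<notin> range opr \<Longrightarrow> cj k A = A"
  by (simp add: cj_def)

lemma opr_cases:
  assumes "\<And>p. P (opr p)" "A \<notin> range opr \<Longrightarrow> P A"
  shows "P A"
  using assms by blast

lemmas opr_simps = cj_opr ng_opr opr_eq_iff act_simps T_linear act_linear minus_minus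

text \<open>In a composition of conjugations every generator occurs on both sides of the argument,
  so the sign of an anticommutation arises twice and cancels. What remains are the relations of the
  operators \<open>op_T\<close> on \<open>U\<close>.\<close>

sublocale A: conjugation_A n cj ng "\<lambda>k. opr (tv k)" "\<lambda>i j. opr (bracket i j)"
proof
  note t = t_indices_lt
  show "cj k (cj k x) = x" if k: "1 \<le> k" "k < n" for k x
    by (rule opr_cases[of _ x]) (simp_all add: cj_junk opr_simps T_sq[OF _ t[OF k]])
  show "cj k (cj j x) = cj j (cj k x)" if jk: "1 \<le> j" "j + 1 < k" "k < n" for j k x
  proof -
    have "op_T k (op_T j f) = - op_T j (op_T k f)" if "f \<in> U" for f
      using T_far[OF that, of k j] jk by simp
    then show ?thesis
      by - (rule opr_cases[of _ x], simp_all add: cj_junk opr_simps)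
  qed
  show "cj k (cj (Suc k) (cj k x)) = cj (Suc k) (cj k (cj (Suc k) x))" if k: "1 \<le> k" "Suc k < n" for k x
    by (rule opr_cases[of _ x]) (simp_all add: cj_junk opr_simps T_braid[OF _ k])
  show "cj k (opr (tv k)) = ng (opr (tv k))" if k: "1 \<le> k" "k < n" for k
    by (simp add: opr_simps T_sq[OF _ t[OF k]])
  show "cj k (opr (tv j)) = opr (tv j)"
    if jk: "1 \<le> j" "j < n" "1 \<le> k" "k < n" "j + 1 < k \<or> k + 1 < j" for j k
  proof -
    have "op_T k (op_T j f) = - op_T j (op_T k f)" if "f \<in> U" for f
      using T_far[OF that, of k j] jk by auto
    then show ?thesis by (simp add: opr_simps T_sq[OF _ t[OF jk(3,4)]])
  qed
  show "cj k (opr (tv (Suc k))) = cj (Suc k) (opr (tv k))" if k: "1 \<le> k" "Suc k < n" for k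
    by (simp add: opr_simps T_braid[OF _ k])
  show "opr (bracket k (Suc k)) = opr (tv k)" for k
    by (simp add: bracket_start)
  show "opr (bracket i (Suc j)) = cj j (opr (bracket i j))" if "i < j" for i j
    by (simp add: bracket_step[OF that] cj_opr)
qed

abbreviation bar :: "nat \<Rightarrow> nat \<Rightarrow> free_elem"
  where "bar \<equiv> bracket_bar W n"

text \<open>Recursions and symmetry hold in the free algebra for every type, so only the behaviour
  of the starting element remains to be checked type by type.\<close>

lemma conjugation_barI:
  assumes "2 \<le> n" "\<And>k. 1 \<le> k \<Longrightarrow> k + 3 \<le> n \<or> k = n - 1 \<Longrightarrow> cj k (opr (bar (n - 1) n)) = opr (bar (n - 1) n)"
  shows "conjugation_bar n cj ng (\<lambda>k. opr (tv k)) (\<lambda>i j. opr (bracket i j)) (\<lambda>i j. opr (bar i j))"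
proof (unfold_locales, goal_cases)
  case (2 i j)
  then show ?case by (simp only: cj_opr bracket_bar_step[of i j])
next
  case (3 i)
  then show ?case by (simp only: cj_opr bracket_bar_last[of i])
next
  case (4 i j)
  show ?case by (simp only: bracket_bar_sym)
qed (use assms in auto)

lemma bar_D: "W = TypeD \<Longrightarrow> bar (n - 1) n = tv n"
  and bar_B: "W = TypeB \<Longrightarrow> bar (n - 1) n = - (tv n * tv (n - 1) * tv n)"
  and bar_A: "W = TypeA \<Longrightarrow> bar i j = 0"
  using bracket_bar_start n_B n_D bracket_bar_lt_def
  by (simp_all add: bracket_bar_def bracket_bar_lt_def)

lemma conjugation_D:
  assumes W: "W = TypeD"
  shows "conjugation_D n cj ng (\<lambda>k. opr (tv k)) (\<lambda>i j. opr (bracket i j)) (\<lambda>i j. opr (bar i j))"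
proof -
  have n4: "4 \<le> n" using n_D W by simp
  have n: "n \<in> t_indices W n" by (rule n_index) (use W in blast)
  note sq = T_sq[OF _ n] and far = T_far_D[OF _ W] and b = bar_D[OF W]
  interpret conjugation_bar n cj ng "\<lambda>k. opr (tv k)" "\<lambda>i j. opr (bracket i j)" "\<lambda>i j. opr (bar i j)"
  proof (rule conjugation_barI)
    fix k :: nat assume k: "1 \<le> k" "k + 3 \<le> n \<or> k = n - 1"
    then have k': "k < n" "k \<noteq> n - 2" using n4 by auto
    show "cj k (opr (bar (n - 1) n)) = opr (bar (n - 1) n)"
      unfolding b using far(1)[OF _ k(1) k'] T_sq[OF _ t_indices_lt[OF k(1) k'(1)]]
      by (simp add: opr_simps)
  qed (use n4 in simp)
  show ?thesis
  proof
    show "cj n (cj n x) = x" for x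
      by (rule opr_cases[of _ x]) (simp_all add: cj_junk opr_simps sq)
    show "cj n (cj k x) = cj k (cj n x)" if k: "1 \<le> k" "k < n" "k \<noteq> n - 2" for k x
      by (rule opr_cases[of _ x]) (simp_all add: cj_junk opr_simps far(2)[OF _ k])
    show "cj (n - 2) (cj n (cj (n - 2) x)) = cj n (cj (n - 2) (cj n x))" for x
      by (rule opr_cases[of _ x]) (simp_all add: cj_junk opr_simps T_braid_D[OF _ W])
    show "cj n (opr (tv n)) = ng (opr (tv n))"
      by (simp add: opr_simps sq)
    show "cj n (opr (tv k)) = opr (tv k)" if k: "1 \<le> k" "k < n" "k \<noteq> n - 2" for k
      by (simp add: opr_simps far(2)[OF _ k] sq)
    show "cj n (opr (tv (n - 2))) = cj (n - 2) (opr (tv n))"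
      by (simp add: opr_simps T_braid_D[OF _ W])
    show "opr (bar (n - 1) n) = opr (tv n)" by (simp only: b)
  qed (use n4 in simp)
qed

lemma conjugation_B:
  assumes W: "W = TypeB"
  shows "conjugation_B n cj ng (\<lambda>k. opr (tv k)) (\<lambda>i j. opr (bracket i j)) (\<lambda>i j. opr (bar i j))
    (\<lambda>i. opr (bracket_single n i))"
proof -
  have n2: "2 \<le> n" using n_B W by simp
  have n: "n \<in> t_indices W n" by (rule n_index) (use W in blast)
  have n1: "n - 1 \<in> t_indices W n" by (rule t_indices_lt) (use n2 in auto)
  note sq = T_sq[OF _ n] and sq1 = T_sq[OF _ n1] and far = T_far_B[OF _ W] and b = bar_B[OF W]
    and braid = T_braid_B[OF _ W]
  interpret conjugation_bar n cj ng "\<lambda>k. opr (tv k)" "\<lambda>i j. opr (bracket i j)" "\<lambda>i j. opr (bar i j)"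
  proof (rule conjugation_barI)
    fix k :: nat assume k: "1 \<le> k" "k + 3 \<le> n \<or> k = n - 1"
    show "cj k (opr (bar (n - 1) n)) = opr (bar (n - 1) n)"
    proof (cases "k = n - 1")
      case True
      \<comment> \<open>The relation of length four with one factor t_(n-1) moved to the other side;
        it expresses that s_(n-1) fixes e_(n-1) + e_n.\<close>
      have "op_T (n - 1) (op_T n (op_T (n - 1) (op_T n (op_T (n - 1) f)))) = - op_T n (op_T (n - 1) (op_T n f))"
        if "f \<in> U" for f
        using braid[of "op_T (n - 1) f"] that by (simp only: sq1 U_T minus_minus)
      then show ?thesis unfolding b True by (simp only: opr_simps) simp
    next
      case False
      then have k': "k + 1 < n" "k < n" "k + 1 < n - 1" "n - 1 < n" "1 \<le> n - 1" using k by auto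
      have "op_T k (op_T (n - 1) f) = - op_T (n - 1) (op_T k f)" if "f \<in> U" for f
        using T_far[OF that k(1) k'(2) k'(5) k'(4)] k'(3) by simp
      then show ?thesis
        unfolding b using far(1)[OF _ k(1) k'(1)] T_sq[OF _ t_indices_lt[OF k(1) k'(2)]]
        by (simp add: opr_simps)
    qed
  qed (use n2 in simp)
  show ?thesis
  proof
    show "cj n (cj n x) = x" for x
      by (rule opr_cases[of _ x]) (simp_all add: cj_junk opr_simps sq)
    show "cj n (cj k x) = cj k (cj n x)" if k: "1 \<le> k" "k + 1 < n" for k x
      by (rule opr_cases[of _ x]) (simp_all add: cj_junk opr_simps far(2)[OF _ k])
    show "cj n (cj (n - 1) (cj n (cj (n - 1) x))) = cj (n - 1) (cj n (cj (n - 1) (cj n x)))" for x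
      by (rule opr_cases[of _ x]) (simp_all add: cj_junk opr_simps braid[unfolded One_nat_def])
    show "cj n (opr (tv n)) = ng (opr (tv n))"
      by (simp add: opr_simps sq)
    show "cj n (opr (tv k)) = opr (tv k)" if k: "1 \<le> k" "k + 1 < n" for k
      by (simp add: opr_simps far(2)[OF _ k] sq)
    show "cj k (opr (tv n)) = opr (tv n)" if k: "1 \<le> k" "k + 1 < n" for k
      using T_sq[OF _ t_indices_lt[of k]] k by (simp add: opr_simps far(1)[OF _ k])
    show "cj n (cj (n - 1) (opr (tv n))) = cj (n - 1) (opr (tv n))"
      by (simp only: opr_simps, intro ballI, simp only: braid U_T sq minus_minus T_linear)
    show "opr (bar (n - 1) n) = cj n (opr (tv (n - 1)))" by (simp only: b cj_opr)
    show "opr (bracket_single n n) = opr (tv n)"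
      using n2 by (simp add: bracket_single_start)
    show "opr (bracket_single n i) = cj i (opr (bracket_single n (Suc i)))" if "i < n" for i
      by (simp only: cj_opr bracket_single_step[OF that])
  qed
qed

text \<open>Turns -t p t = q into t p = -q t by t^2 = 1. In the right action the t on the left of p
  is the operator applied first.\<close>

lemma cj_swap:
  assumes "cj k (opr p) = opr q" "f \<in> U" "k \<in> t_indices W n"
  shows "act op_t p (op_T k f) = - op_T k (act op_t q f)"
proof -
  have "- op_T k (act op_t p (op_T k f)) = act op_t q f"
    using assms(1,2) by (simp add: cj_opr opr_eq_iff act_simps)
  then have "- op_T k (op_T k (act op_t p (op_T k f))) = op_T k (act op_t q f)"
    by (metis T_linear(3))
  then have "- act op_t p (op_T k f) = op_T k (act op_t q f)"
    using assms by (simp only: T_sq U_T U_act_t)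
  then show ?thesis by (simp only: minus_minus flip: \<open>- act op_t p (op_T k f) = _\<close>)
qed

text \<open>\<open>True\<close> selects the analogue of e_i - e_j, \<open>False\<close> that of e_i
  + e_j; a sign change at one of the two indices then just toggles the flag.\<close>

definition zel :: "bool \<Rightarrow> nat \<Rightarrow> nat \<Rightarrow> free_elem"
  where "zel e i j = (if e then bracket i j else bar i j)"

lemma zel_swap: "i \<noteq> j \<Longrightarrow> zel e j i = (if e then - zel e i j else zel e i j)"
  by (simp add: zel_def bracket_antisym[of i j] bracket_bar_sym[of W n j i])

lemma zel_conj_lt:
  assumes "k < n" "1 \<le> k" "i \<in> {1..n}" "j \<in> {1..n}" "i < j"
  shows "cj k (opr (zel e i j)) = opr (zel e (prm k i) (prm k j))"
proof -
  have ij: "1 \<le> i" "j \<le> n" using assms by auto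
  note p = prm_values(1)[OF assms(1)]
  show ?thesis
  proof (cases e)
    case True
    have "ng (opr (bracket k (Suc k))) = opr (bracket (Suc k) k)"
      using bracket_antisym[of k "Suc k"] by (simp add: ng_opr)
    then show ?thesis
      using A.br_conj[OF ij(1) assms(5) ij(2) assms(2,1)] True by (auto simp: zel_def p)
  next
    case False
    consider "W = TypeA" | "W = TypeB" | "W = TypeD" by (cases W)
    then have "cj k (opr (bar i j)) = opr (bar (prm k i) (prm k j))"
    proof cases
      case 1
      show ?thesis unfolding bar_A[OF 1] by (simp add: cj_opr)
    next
      case 2
      interpret conjugation_B n cj ng "\<lambda>k. opr (tv k)" "\<lambda>i j. opr (bracket i j)" "\<lambda>i j. opr (bar i j)"
        "\<lambda>i. opr (bracket_single n i)" by (rule conjugation_B[OF 2])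
      show ?thesis unfolding p by (rule bar_conj_lt) (use assms ij in auto)
    next
      case 3
      interpret conjugation_D n cj ng "\<lambda>k. opr (tv k)" "\<lambda>i j. opr (bracket i j)" "\<lambda>i j. opr (bar i j)"
        by (rule conjugation_D[OF 3])
      show ?thesis unfolding p by (rule bar_conj_lt) (use assms ij in auto)
    qed
    then show ?thesis using False by (simp add: zel_def)
  qed
qed

lemma zel_conj_B:
  assumes W: "W = TypeB" and ij: "i \<in> {1..n}" "j \<in> {1..n}" "i < j"
  shows "cj n (opr (zel e i j)) = opr (zel (if j = n then \<not> e else e) i j)"
proof -
  interpret conjugation_B n cj ng "\<lambda>k. opr (tv k)" "\<lambda>i j. opr (bracket i j)" "\<lambda>i j. opr (bar i j)"
    "\<lambda>i. opr (bracket_single n i)" by (rule conjugation_B[OF W])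
  show ?thesis
    using br_conj_n_small[of i j] br_conj_n_last[of i] bar_conj_n_last[of i] bar_conj_n_small[of i j] ij
    by (cases e; cases "j = n") (simp_all add: zel_def)
qed

lemma zel_conj_D:
  assumes W: "W = TypeD" and ij: "i \<in> {1..n}" "j \<in> {1..n}" "i < j"
  shows "cj n (opr (zel e i j)) = opr (if i = n - 1 then - zel e n (n - 1)
    else zel (if j < n - 1 then e else \<not> e) i (Transposition.transpose (n - 1) n j))"
proof -
  interpret conjugation_D n cj ng "\<lambda>k. opr (tv k)" "\<lambda>i j. opr (bracket i j)" "\<lambda>i j. opr (bar i j)"
    by (rule conjugation_D[OF W])
  have n4: "4 \<le> n" using n_D W by simp
  consider "i = n - 1" "j = n" "i \<noteq> j" | "i + 1 < n" "j = n" | "i + 1 < n" "j = n - 1" | "j + 1 < n" "i < n - 1"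
    using ij by force
  then show ?thesis
  proof cases
    case 1
    then show ?thesis
      using br_conj_n_both bar_conj_n_both zel_swap[of "n - 1" n e] ij by (cases e) (simp_all add: zel_def ng_opr)
  next
    case 2
    then show ?thesis
      using br_conj_n_right[of i] bar_conj_n_left[of i] ij by (cases e) (auto simp: zel_def)
  next
    case 3
    then show ?thesis
      using br_conj_n_left[of i] bar_conj_n_right[of i] ij n4 by (cases e) (auto simp: zel_def)
  next
    case 4
    then show ?thesis
      using br_conj_n_small[of i j] bar_conj_n_small[of i j] ij by (cases e) (auto simp: zel_def transpose_def)
  qed
qed

definition Z :: "bool \<Rightarrow> nat \<Rightarrow> nat \<Rightarrow> dual \<Rightarrow> dual"
  where "Z e i j = act op_t (zel e i j)"

lemma Z_swap: "i \<noteq> j \<Longrightarrow> Z e j i f = scale (if e then -1 else 1) (Z e i j f)"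
  by (simp add: Z_def zel_swap[of i j] act_uminus scale_one scale_minus_one)

text \<open>The formula is that for roots: with signs \<open>eta\<close> and images i', j', the root
  e_i -+ e_j goes to eta_i e_i' -+ eta_j e_j', that is, eta_i times e_i' -+ (eta_i eta_j) e_j'. The
  inner product of signs decides the flag.\<close>

lemma zel_conj:
  assumes k: "k \<in> t_indices W n" and ij: "i \<in> {1..n}" "j \<in> {1..n}" "i < j"
  shows "cj k (opr (zel e i j)) = opr (scalar (eta k i)
    * zel (if flip k i = flip k j then e else \<not> e) (prm k i) (prm k j))"
proof -
  have s: "scalar 1 * x = x" "scalar (-1) * x = - x" for x
    by (simp_all add: scalar_def single_uminus single_one flip: zero_list_def)
  consider "k < n" "1 \<le> k" | "W = TypeB" "k = n" | "W = TypeD" "k = n"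
    using k n_pos by (cases W) force+
  then show ?thesis
  proof cases
    case 1
    then show ?thesis using zel_conj_lt[OF 1 ij] by (simp add: flip_values(1) s)
  next
    case 2
    have "flip n j \<longleftrightarrow> j = n" "\<not> flip n i" using flip_values(3)[OF 2(1)] ij by auto
    then show ?thesis
      using zel_conj_B[OF 2(1) ij] unfolding 2(2) prm_values(3)[OF 2(1)] by (auto simp: eta_def s)
  next
    case 3
    have n: "n - 1 < n" using n_pos by simp
    note f = flip_values(2)[OF 3(1)]
    show ?thesis
    proof (cases "i = n - 1")
      case True
      then have "j = n" using ij by auto
      with True show ?thesis
        using zel_conj_D[OF 3(1) ij] n unfolding 3(2) prm_values(2)[OF 3(1)] by (simp add: eta_def f s)
    next
      case False
      then have "i < n - 1" "\<not> flip n i" "flip n j \<longleftrightarrow> \<not> j < n - 1" using ij n unfolding f by auto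
      then show ?thesis
        using zel_conj_D[OF 3(1) ij] unfolding 3(2) prm_values(2)[OF 3(1)]
        by (auto simp: eta_def s transpose_def)
    qed
  qed
qed

lemma Z_conj:
  assumes k: "k \<in> t_indices W n" and ij: "i \<in> {1..n}" "j \<in> {1..n}" "i \<noteq> j" and f: "f \<in> U"
  shows "Z e i j (op_T k f)
    = scale (- eta k i) (op_T k (Z (if flip k i = flip k j then e else \<not> e) (prm k i) (prm k j) f))"
proof -
  have lt: "Z e i j (op_T k f)
      = scale (- eta k i) (op_T k (Z (if flip k i = flip k j then e else \<not> e) (prm k i) (prm k j) f))"
    if "i \<in> {1..n}" "j \<in> {1..n}" "i < j" for i j
    using cj_swap[OF zel_conj[OF k that, of e] f k]
    by (simp add: Z_def act_simps T_linear scale_scale act_linear fun_eq_iff)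
  show ?thesis
  proof (cases "i < j")
    case True
    then show ?thesis using lt ij by simp
  next
    case False
    then have "j < i" using ij by simp
    note l = lt[OF ij(2,1) this]
    let ?e = "if flip k i = flip k j then e else \<not> e"
    have e: "(if flip k j = flip k i then e else \<not> e) = ?e" by auto
    have "Z e i j (op_T k f) = scale (if e then -1 else 1) (Z e j i (op_T k f))"
      by (rule Z_swap) (use ij in simp)
    also have "\<dots> = scale ((if e then -1 else 1) * - eta k j) (op_T k (Z ?e (prm k j) (prm k i) f))"
      unfolding l e by (simp only: scale_scale)
    also have "Z ?e (prm k j) (prm k i) f = scale (if ?e then -1 else 1) (Z ?e (prm k i) (prm k j) f)"
      by (rule Z_swap) (use ij in simp)
    also have "scale ((if e then -1 else 1) * - eta k j)
          (op_T k (scale (if ?e then -1 else 1) (Z ?e (prm k i) (prm k j) f)))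
        = scale ((if e then -1 else 1) * - eta k j * (if ?e then -1 else 1)) (op_T k (Z ?e (prm k i) (prm k j) f))"
      by (simp only: T_linear scale_scale)
    \<comment> \<open>The two swap signs differ exactly when one of i and j is flipped and the other
      is not, which is also when the two values of \<open>eta\<close> differ.\<close>
    also have "(if e then -1 else 1) * - eta k j * (if ?e then -1 else 1) = - eta k i"
      by (simp add: eta_def)
    finally show ?thesis .
  qed
qed

text \<open>Set to zero outside type B so that the single formula \<open>C_eq\<close> serves all
  types.\<close>

definition sgl :: "nat \<Rightarrow> dual \<Rightarrow> dual"
  where "sgl i = (if W = TypeB then act op_t (bracket_single n i) else (\<lambda>f. 0))"

lemma sgl_conj:
  assumes k: "k \<in> t_indices W n" and i: "i \<in> {1..n}" and f: "f \<in> U"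
  shows "sgl i (op_T k f) = scale (- eta k i) (op_T k (sgl (prm k i) f))"
proof (cases "W = TypeB")
  case False
  then show ?thesis by (simp add: sgl_def T_linear fun_eq_iff)
next
  case W: True
  interpret conjugation_B n cj ng "\<lambda>k. opr (tv k)" "\<lambda>i j. opr (bracket i j)" "\<lambda>i j. opr (bar i j)"
    "\<lambda>i. opr (bracket_single n i)" by (rule conjugation_B[OF W])
  consider "k < n" "1 \<le> k" | "k = n" "i < n" | "k = n" "i = n"
    using k W i by force
  then show ?thesis
  proof cases
    case 1
    have c: "cj k (opr (bracket_single n i)) = opr (bracket_single n (prm k i))"
      unfolding prm_values(1)[OF 1(1)] by (rule sg_conj) (use 1 i in auto)
    show ?thesis unfolding sgl_def if_P[OF W] using cj_swap[OF c f k] 1 by (simp add: scale_minus_one)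
  next
    case 2
    have c: "cj k (opr (bracket_single n i)) = opr (bracket_single n (prm k i))"
      unfolding 2(1) prm_values(3)[OF W] using sg_conj_n[of i] i 2 by simp
    have "eta k i = 1" unfolding eta_def 2(1) flip_values(3)[OF W] using 2 by simp
    then show ?thesis unfolding sgl_def if_P[OF W] using cj_swap[OF c f k] by (simp add: scale_minus_one)
  next
    case 3
    have c: "cj k (opr (bracket_single n i)) = opr (- bracket_single n (prm k i))"
      unfolding 3(1) prm_values(3)[OF W] 3(2) using t_n_self by (simp add: ng_opr bracket_single_start[OF n_pos])
    have "eta k i = -1" unfolding eta_def 3(1) flip_values(3)[OF W] using 3 by simp
    then show ?thesis unfolding sgl_def if_P[OF W] using cj_swap[OF c f k]
      by (simp add: scale_one act_simps T_linear)
  qed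
qed

end

section \<open>The operators of the generators y\<close>

context spin_daha
begin

section \<open>Commutators as operators and their equivariance\<close>

lemma C_in: "i \<in> {1..n} \<Longrightarrow> C j i = act op_t (commutator_value W n u v j i)"
  and C_out: "i \<notin> {1..n} \<Longrightarrow> C j i = (\<lambda>f. 0)"
  by (rule ext, simp only: C_def if_True if_False zero_fun_def)+

lemma linear_C: "linear_op (C j i)"
proof (cases "i \<in> {1..n}")
  case True
  show ?thesis unfolding C_in[OF True] by (rule linear_act_t)
next
  case False
  show ?thesis unfolding C_out[OF False] by (simp add: linear_opI)
qed

lemmas C_rules = linear_op_rules[OF linear_C]

lemma U_C [simp]: "f \<in> U \<Longrightarrow> C j i f \<in> U"
  by (simp add: C_def)

lemma C_neq:
  assumes "i \<in> {1..n}" "i \<noteq> j"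
  shows "C j i f = scale u (Z False i j f - Z True i j f)"
proof (cases W)
  case TypeA
  have 0: "zel False i j = 0" unfolding zel_def bar_A[OF TypeA] by simp
  have "commutator_value W n u v j i = - scalar u * bracket i j" unfolding TypeA using assms by simp
  with assms show ?thesis
    by (simp add: C_def Z_def 0 act_simps act_linear) (simp add: zel_def fun_eq_iff)
next
  case TypeB
  have "commutator_value W n u v j i = - scalar u * bracket i j + scalar u * bar i j"
    unfolding TypeB using assms by simp
  then show ?thesis unfolding C_in[OF assms(1)]
    by (simp only: Z_def zel_def) (simp add: act_simps act_linear zel_def fun_eq_iff algebra_simps)
next
  case TypeD
  have "commutator_value W n u v j i = - scalar u * bracket i j + scalar u * bar i j"
    unfolding TypeD using assms by simp
  then show ?thesis unfolding C_in[OF assms(1)]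
    by (simp only: Z_def zel_def) (simp add: act_simps act_linear zel_def fun_eq_iff algebra_simps)
qed

lemma C_eq:
  assumes "i \<in> {1..n}"
  shows "C i i f = scale u (\<Sum>k\<in>{1..n} - {i}. Z True i k f + Z False i k f) + scale v (sgl i f)"
proof (cases W)
  case TypeA
  have 0: "zel False i k = 0" for k unfolding zel_def bar_A[OF TypeA] by simp
  have "commutator_value W n u v i i = scalar u * (\<Sum>k\<in>{1..n} - {i}. bracket i k)"
    unfolding TypeA by simp
  moreover have "W \<noteq> TypeB" using TypeA by simp
  then have "sgl i f = 0" unfolding sgl_def by (simp add: zero_fun_def)
  ultimately show ?thesis using assms
    by (simp add: C_def Z_def 0 act_simps act_linear) (simp add: zel_def fun_eq_iff sum_fun_apply sum_distrib_left)
next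
  case TypeB
  have "commutator_value W n u v i i = scalar u * (\<Sum>k\<in>{1..n} - {i}. bracket i k + bar i k)
      + scalar v * bracket_single n i"
    unfolding TypeB by simp
  moreover have "sgl i f = act op_t (bracket_single n i) f" unfolding sgl_def if_P[OF TypeB] ..
  ultimately show ?thesis using assms
    by (simp add: C_def Z_def act_simps act_linear zel_def fun_eq_iff sum_fun_apply sum_distrib_left sum.distrib algebra_simps)
next
  case TypeD
  have "commutator_value W n u v i i = scalar u * (\<Sum>k\<in>{1..n} - {i}. bracket i k + bar i k)"
    unfolding TypeD by simp
  moreover have "W \<noteq> TypeB" using TypeD by simp
  then have "sgl i f = 0" unfolding sgl_def by (simp add: zero_fun_def)
  ultimately show ?thesis using assms
    by (simp add: C_def Z_def act_simps act_linear zel_def fun_eq_iff sum_fun_apply sum_distrib_left sum.distrib algebra_simps)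
qed

text \<open>For i \<noteq> j, if exactly one index is flipped, the two summands of
  \<open>C_neq\<close> trade places; the resulting sign turns the \<open>eta k i\<close> of
  \<open>Z_conj\<close> into \<open>eta k j\<close>. For i = j the flags are summed over, and
  \<open>prm k\<close> only permutes the summation index.\<close>

lemma C_conj:
  assumes k: "k \<in> t_indices W n" and ij: "i \<in> {1..n}" "j \<in> {1..n}" and f: "f \<in> U"
  shows "C j i (op_T k f) = scale (- eta k j) (op_T k (C (prm k j) (prm k i) f))"
proof -
  note r = prm_range[OF k]
  show ?thesis
  proof (cases "i = j")
    case False
    note z = Z_conj[OF k ij False f]
    have c: "prm k i \<in> {1..n}" "prm k i \<noteq> prm k j" using ij r False by simp_all
    show ?thesis
      unfolding C_neq[OF ij(1) False] C_neq[OF c] z T_linear eta_def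
      by (cases "flip k i"; cases "flip k j") (simp_all add: fun_eq_iff algebra_simps)
  next
    case True
    let ?s = "prm k" and ?Z = "\<lambda>i k f. Z True i k f + Z False i k f"
    have z: "?Z i l (op_T k f) = scale (- eta k i) (op_T k (?Z (?s i) (?s l) f))"
      if "l \<in> {1..n} - {i}" for l
    proof -
      have l: "l \<in> {1..n}" "i \<noteq> l" using that by auto
      show ?thesis unfolding Z_conj[OF k ij(1) l f]
        by (simp add: T_linear) (auto simp: fun_eq_iff algebra_simps)
    qed
    have bij: "bij_betw ?s ({1..n} - {i}) ({1..n} - {?s i})"
      by (rule bij_betw_byWitness[where f' = ?s]) (simp_all only: image_subset_iff prm_invol r Diff_iff singleton_iff prm_eq_iff, auto)
    have "(\<Sum>l\<in>{1..n} - {i}. ?Z i l (op_T k f))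
        = (\<Sum>l\<in>{1..n} - {i}. scale (- eta k i) (op_T k (?Z (?s i) (?s l) f)))"
      by (rule sum.cong[OF refl z])
    also have "\<dots> = (\<Sum>l\<in>{1..n} - {?s i}. scale (- eta k i) (op_T k (?Z (?s i) l f)))"
      by (rule sum.reindex_bij_betw[OF bij])
    also have "\<dots> = scale (- eta k i) (op_T k (\<Sum>l\<in>{1..n} - {?s i}. ?Z (?s i) l f))"
      unfolding T_linear by (simp add: fun_eq_iff sum_fun_apply sum_distrib_left sum_negf sum.distrib sum_subtractf distrib_left)
    finally have e: "(\<Sum>l\<in>{1..n} - {i}. ?Z i l (op_T k f))
        = scale (- eta k i) (op_T k (\<Sum>l\<in>{1..n} - {?s i}. ?Z (?s i) l f))" .
    have "?s i \<in> {1..n}" using ij r by simp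
    then show ?thesis
      unfolding True[symmetric] C_eq[OF ij(1)] e sgl_conj[OF k ij(1) f]
      by (simp only: C_eq T_linear(2,5)) (simp add: fun_eq_iff algebra_simps)
  qed
qed

section \<open>Moving the bracket elements past the \<xi>\<close>

lemma X_T: "op_X a (op_T k f) = - op_T k (op_X (prm k a) f)"
  by (auto simp: op_X_def op_T_def fun_eq_iff)

lemma prm_transpose:
  assumes "i < j" "j < n"
  shows "prm j (Transposition.transpose i j (prm j a)) = Transposition.transpose i (Suc j) a"
    "prm j (Transposition.transpose i (Suc j) (prm j a)) = Transposition.transpose i j a"
proof -
  show 1: "prm j (Transposition.transpose i j (prm j a)) = Transposition.transpose i (Suc j) a" for a
    unfolding prm_values(1)[OF assms(2)] using assms(1) by (auto simp: transpose_def)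
  show "prm j (Transposition.transpose i (Suc j) (prm j a)) = Transposition.transpose i j a"
    using 1[of "prm j a"] by (metis prm_invol)
qed

lemma prm_transpose_last:
  assumes "Suc i < n"
  shows "prm i (Transposition.transpose (Suc i) n (prm i a)) = Transposition.transpose i n a"
proof -
  have "i < n" using assms by simp
  from prm_values(1)[OF this] show ?thesis using assms by (auto simp: transpose_def)
qed

lemma bracket_induct [consumes 3, case_names start step]:
  assumes "1 \<le> i" "i < j" "j \<le> n"
    and "\<And>k. 1 \<le> k \<Longrightarrow> k < n \<Longrightarrow> P k (Suc k)"
    and "\<And>i j. 1 \<le> i \<Longrightarrow> i < j \<Longrightarrow> j < n \<Longrightarrow> P i j \<Longrightarrow> P i (Suc j)"
  shows "P i j"
  using assms(2,3)
proof (induction j)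
  case (Suc j)
  then show ?case using assms(1,4,5) by (cases "i = j") auto
qed simp

lemma bracket_bar_induct [consumes 3, case_names start last step]:
  assumes "1 \<le> i" "i < j" "j \<le> n"
    and "2 \<le> n \<Longrightarrow> P (n - 1) n"
    and "\<And>i. 1 \<le> i \<Longrightarrow> Suc i < n \<Longrightarrow> P (Suc i) n \<Longrightarrow> P i n"
    and "\<And>i j. 1 \<le> i \<Longrightarrow> i < j \<Longrightarrow> j < n \<Longrightarrow> P i (Suc j) \<Longrightarrow> P i j"
  shows "P i j"
proof -
  have last: "P i n" if "1 \<le> i" "i < n" for i
    using that
  proof (induction "n - i" arbitrary: i rule: less_induct)
    case less
    show ?case
    proof (cases "Suc i = n")
      case True
      then have "n - 1 = i" by simp
      then show ?thesis using assms(4) less True by auto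
    next
      case False
      then show ?thesis using less assms(5)[of i] by simp
    qed
  qed
  show ?thesis using assms(2,3)
  proof (induction "n - j" arbitrary: j rule: less_induct)
    case less
    show ?case
    proof (cases "j = n")
      case True
      then show ?thesis using last[of i] assms(1) less by simp
    next
      case False
      then show ?thesis using less assms(1) assms(6)[of i j] by simp
    qed
  qed
qed

text \<open>Read in the algebra: p \<xi>_a = -\<xi>_(\<pi> a) p. The property survives signed
  conjugation, with \<pi> conjugated by \<open>prm k\<close>, so it spreads from the generators
  along the recursions of the bracket elements.\<close>

definition xrefl :: "free_elem \<Rightarrow> (nat \<Rightarrow> nat) \<Rightarrow> bool"
  where "xrefl p \<pi> \<longleftrightarrow> (\<forall>a f. op_X a (act op_t p f) = - act op_t p (op_X (\<pi> a) f))"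

lemma xrefl_conj: "xrefl p \<pi> \<Longrightarrow> xrefl (- (tv k * p * tv k)) (\<lambda>a. prm k (\<pi> (prm k a)))"
  unfolding xrefl_def by (simp add: act_simps X_linear X_T act_linear T_linear)

lemma xrefl_tv: "xrefl (tv k) (prm k)"
  unfolding xrefl_def by (simp add: act_simps X_T)

lemma xrefl_bracket: "1 \<le> i \<Longrightarrow> i < j \<Longrightarrow> j \<le> n \<Longrightarrow> xrefl (bracket i j) (Transposition.transpose i j)"
proof (induction rule: bracket_induct)
  case (start k)
  then show ?case using xrefl_tv[of k] by (simp add: bracket_start prm_values(1))
next
  case (step i j)
  from xrefl_conj[OF step(4), of j] show ?case
    unfolding prm_transpose(1)[OF step(2,3)] bracket_step[OF step(2)] .
qed

lemma xrefl_bar: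
  assumes W: "W \<noteq> TypeA"
  shows "1 \<le> i \<Longrightarrow> i < j \<Longrightarrow> j \<le> n \<Longrightarrow> xrefl (bar i j) (Transposition.transpose i j)"
proof (induction rule: bracket_bar_induct)
  case start
  show ?case
  proof (cases "W = TypeB")
    case True
    have n: "n - 1 < n" "Suc (n - 1) = n" using start by auto
    have t: "Transposition.transpose (n - 1) n = (\<lambda>a. prm n (prm (n - 1) (prm n a)))"
      unfolding prm_values(3)[OF True] prm_values(1)[OF n(1)] n(2) by (simp add: fun_eq_iff)
    show ?thesis unfolding t bar_B[OF True] by (rule xrefl_conj) (rule xrefl_tv)
  next
    case False
    then have D: "W = TypeD" using W by (cases W) auto
    show ?thesis using xrefl_tv[of n] unfolding bar_D[OF D] prm_values(2)[OF D] .
  qed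
next
  case (last i)
  from xrefl_conj[OF last(3), of i] show ?case
    unfolding prm_transpose_last[OF last(2)] bracket_bar_last[OF last(2)] .
next
  case (step i j)
  from xrefl_conj[OF step(4), of j] show ?case
    unfolding prm_transpose(2)[OF step(2,3)] bracket_bar_step[OF step(2,3)] .
qed

lemma X_Z:
  assumes ij: "i \<in> {1..n}" "j \<in> {1..n}" "i \<noteq> j"
  shows "op_X a (Z e i j f) = - Z e i j (op_X (Transposition.transpose i j a) f)"
proof -
  have lt: "op_X a (Z e i j f) = - Z e i j (op_X (Transposition.transpose i j a) f)"
    if "1 \<le> i" "i < j" "j \<le> n" for i j
  proof (cases "\<not> e \<and> W = TypeA")
    case True
    then have "zel e i j = 0" using bar_A[of i j] unfolding zel_def by simp
    then show ?thesis by (simp add: Z_def act_zero X_linear)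
  next
    case False
    then have "xrefl (zel e i j) (Transposition.transpose i j)"
      using xrefl_bracket[OF that] xrefl_bar[OF _ that] unfolding zel_def by (cases e) auto
    then show ?thesis unfolding xrefl_def Z_def by blast
  qed
  show ?thesis
  proof (cases "i < j")
    case False
    then have "j < i" using ij by simp
    with lt[of j i] ij Z_swap[of j i e] show ?thesis
      by (simp add: X_linear transpose_commute[of i j]) (simp add: fun_eq_iff)
  qed (use lt ij in simp)
qed

lemma X_sgl:
  assumes i: "i \<in> {1..n}"
  shows "op_X a (sgl i f) = - sgl i (op_X a f)"
proof (cases "W = TypeB")
  case W: True
  have i': "1 \<le> i" "i \<le> n" using i by auto
  from i'(2,1) have "xrefl (bracket_single n i) (\<lambda>a. a)"
  proof (induction rule: inc_induct)
    case base
    show ?case using xrefl_tv[of n] unfolding bracket_single_start[OF n_pos] prm_values(3)[OF W] id_def .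
  next
    case (step i)
    from xrefl_conj[OF step.IH, of i] step show ?case
      unfolding bracket_single_step[OF step(2)] prm_invol by simp
  qed
  then show ?thesis unfolding sgl_def if_P[OF W] xrefl_def by blast
next
  case False
  then show ?thesis by (simp add: sgl_def fun_eq_iff op_X_def)
qed

text \<open>Reflections fixing \<open>b\<close> anticommute with \<open>\<xi>\<^sub>b\<close>, so only those moving \<open>b\<close> contribute.\<close>

lemma X_C:
  assumes ij: "i \<in> {1..n}" "j \<in> {1..n}" and bi: "b \<noteq> i"
  shows "op_X b (C j i f) + C j i (op_X b f) =
    (if i \<noteq> j then
       if b = j then scale u (Z False i j (op_X j f) - Z False i j (op_X i f) - Z True i j (op_X j f) + Z True i j (op_X i f))
       else 0
     else
       if b \<in> {1..n} then scale u (Z True i b (op_X b f) + Z False i b (op_X b f) - Z True i b (op_X i f) - Z False i b (op_X i f))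
       else 0)"
proof (cases "i = j")
  case False
  have t: "b \<noteq> j \<Longrightarrow> Transposition.transpose i j b = b" using bi by (simp add: transpose_def)
  show ?thesis
    unfolding C_neq[OF ij(1) False] X_linear X_Z[OF ij False]
    using False t by (auto simp: fun_eq_iff algebra_simps)
next
  case True
  let ?A = "{1..n} - {i}" and ?Z = "\<lambda>k f. Z True i k f + Z False i k f"
  let ?g = "\<lambda>k. ?Z k (op_X b f) - ?Z k (op_X (Transposition.transpose i k b) f)"
  have s: "op_X b (\<Sum>k\<in>?A. ?Z k f) = - (\<Sum>k\<in>?A. ?Z k (op_X (Transposition.transpose i k b) f))"
    unfolding X_linear sum_negf[symmetric]
  proof (rule sum.cong[OF refl])
    fix k assume "k \<in> ?A"
    then have k: "k \<in> {1..n}" "i \<noteq> k" by auto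
    show "op_X b (Z True i k f) + op_X b (Z False i k f) = - ?Z k (op_X (Transposition.transpose i k b) f)"
      unfolding X_Z[OF ij(1) k] by simp
  qed
  have "op_X b (C j i f) + C j i (op_X b f) = scale u (\<Sum>k\<in>?A. ?g k)"
    unfolding True[symmetric] C_eq[OF ij(1)] X_linear(2,5) s X_sgl[OF ij(1)] sum_subtractf
    by (simp add: fun_eq_iff algebra_simps)
  moreover have "(\<Sum>k\<in>?A. ?g k) = (\<Sum>k\<in>?A. if k = b then ?g b else 0)"
    by (rule sum.cong[OF refl]) (use bi in \<open>auto simp: transpose_def\<close>)
  moreover have "(\<Sum>k\<in>?A. if k = b then ?g b else 0) = (if b \<in> {1..n} then ?g b else 0)"
    using bi by (subst sum.delta) auto
  ultimately show ?thesis using True bi by (simp add: fun_eq_iff algebra_simps)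
qed

text \<open>This is [y_j, \<xi>_a \<xi>_b + \<xi>_b \<xi>_a] = 0 written for the right action. If
  neither letter is j, each half vanishes by \<open>X_C\<close>. If one of them is j, what survives
  comes from the reflections exchanging j with the other letter, and the diagonal and the
  off-diagonal commutator contribute opposite terms.\<close>

lemma X_C_skew:
  assumes j: "j \<in> {1..n}" and ab: "a \<noteq> b"
  shows "op_X b (C j a f) + C j a (op_X b f) + (op_X a (C j b f) + C j b (op_X a f)) = 0"
proof -
  have out: "C j i g = 0" if "i \<notin> {1..n}" for i g using that unfolding C_def by (rule if_not_P)
  have zero: "op_X b (C j a f) + C j a (op_X b f) = 0" if "a \<noteq> j" "b \<noteq> j" "a \<noteq> b" for a b
  proof (cases "a \<in> {1..n}")
    case True
    show ?thesis unfolding X_C[OF True j that(3)[symmetric]] using that by simp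
  qed (simp add: out X_linear)
  have main: "op_X b (C j j f) + C j j (op_X b f) + (op_X j (C j b f) + C j b (op_X j f)) = 0" if "b \<noteq> j" for b
  proof (cases "b \<in> {1..n}")
    case True
    show ?thesis unfolding X_C[OF j j that] X_C[OF True j that[symmetric]]
      using that True Z_swap[of j b True] Z_swap[of j b False] by (simp add: fun_eq_iff algebra_simps)
  next
    case False
    then show ?thesis unfolding X_C[OF j j that] out[OF False] if_not_P[OF False] by (simp add: X_linear)
  qed
  consider "a = j" | "b = j" | "a \<noteq> j" "b \<noteq> j" by blast
  then show ?thesis
  proof cases
    case 1
    then show ?thesis using main[of b] ab by simp
  next
    case 2
    then show ?thesis using main[of a] ab by (simp add: add.commute)
  next
    case 3
    then show ?thesis using zero[of a b] zero[of b a] ab by simp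
  qed
qed

section \<open>The operators of the y preserve the relations\<close>

lemma linear_Y: "linear_op (op_Y j)"
proof (rule linear_opI)
  fix f g :: dual and b :: "nat list \<times> nat list \<times> nat list"
  obtain x w p where b: "b = (x, w, p)" by (cases b)
  show "op_Y j (f + g) b = op_Y j f b + op_Y j g b"
    unfolding b by (induction x arbitrary: f g) (simp_all add: op_Y_Nil op_Y_Cons X_linear(2) C_rules(2) algebra_simps)
next
  fix f :: dual and c and b :: "nat list \<times> nat list \<times> nat list"
  obtain x w p where b: "b = (x, w, p)" by (cases b)
  show "op_Y j (scale c f) b = c * op_Y j f b"
    unfolding b by (induction x arbitrary: f) (simp_all add: op_Y_Nil op_Y_Cons X_linear(5) C_rules(5) algebra_simps)
qed

lemmas Y_linear = linear_op_rules[OF linear_Y]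

lemma U_Y [simp]:
  assumes f: "f \<in> U" and j: "j \<in> {1..n}"
  shows "op_Y j f \<in> U"
proof (rule U_intro)
  show "op_Y j f (x @ a # b # x', w, p) = - op_Y j f (x @ b # a # x', w, p)" if ab: "a \<noteq> b" for x a b x' w p
    using f
  proof (induction x arbitrary: f)
    case Nil
    have X: "op_X b (op_X a f) = - op_X a (op_X b f)"
      using U_skew[OF Nil ab, of "[]"] by (auto simp: op_X_def fun_eq_iff)
    \<comment> \<open>Unfolding the recursion twice in both orders leaves y_j acting behind the
      pair, on an anticommutator that vanishes, and the four commutator terms of
      \<open>X_C_skew\<close>.\<close>
    have "op_Y j f (a # b # x', w, p) + op_Y j f (b # a # x', w, p)
        = op_Y j (op_X b (op_X a f) + op_X a (op_X b f)) (x', w, p)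
          + (op_X b (C j a f) + C j a (op_X b f) + (op_X a (C j b f) + C j b (op_X a f))) (x', w, p)"
      by (simp add: op_Y_Cons Y_linear op_X_apply)
    also have "\<dots> = 0"
      unfolding X_C_skew[OF j ab] X by (simp add: Y_linear)
    finally show ?case by (simp add: eq_neg_iff_add_eq_0)
  next
    case (Cons c x)
    show ?case
      using Cons.IH[OF U_X[OF Cons.prems], of c] U_skew[OF U_C[OF Cons.prems] ab] by (simp add: op_Y_Cons)
  qed
  show "op_Y j f (x, w @ l @ w', p) = s * op_Y j f (x, w @ r @ w', p)"
    if lr: "(l, r, s) \<in> spin_rules" for l r s x w w' p
    using f
  proof (induction x arbitrary: f)
    case Nil
    show ?case unfolding op_Y_Nil U_spin[OF Nil lr]
      by (simp add: idx_append eps_append spin_rules_action(2,3)[OF lr])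
  next
    case (Cons c x)
    show ?case unfolding op_Y_Cons Cons.IH[OF U_X[OF Cons.prems]] U_spin[OF U_C[OF Cons.prems] lr]
      by (simp add: distrib_left)
  qed
  show "op_Y j f (x, w, p @ a # b # p') = op_Y j f (x, w, p @ b # a # p')" for x w p p' a b
    using f
  proof (induction x arbitrary: f)
    case Nil
    show ?case unfolding op_Y_Nil using U_comm[OF Nil, of "[]" w "_ # p" a b p'] by simp
  next
    case (Cons c x)
    show ?case unfolding op_Y_Cons Cons.IH[OF U_X[OF Cons.prems]]
      using U_comm[OF U_C[OF Cons.prems, of j c], of x w p a b p'] by simp
  qed
qed

text \<open>Induction on the \<xi>-word: passing a letter gives -1 by \<open>X_T\<close>, while
  \<open>C_conj\<close> gives -\<open>eta k j\<close> on the commutator, so both terms of the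
  recursion acquire the same factor. Letters out of range stay out of range under
  \<open>prm k\<close>, where both commutators vanish.\<close>

lemma Y_T:
  assumes k: "k \<in> t_indices W n" and j: "j \<in> {1..n}" and f: "f \<in> U"
  shows "op_Y j (op_T k f) = scale (eta k j) (op_T k (op_Y (prm k j) f))"
proof
  fix b :: "nat list \<times> nat list \<times> nat list"
  obtain x w p where b: "b = (x, w, p)" by (cases b)
  show "op_Y j (op_T k f) b = scale (eta k j) (op_T k (op_Y (prm k j) f)) b"
    unfolding b using f
  proof (induction x arbitrary: f)
    case Nil
    show ?case by (simp add: op_Y_Nil op_T_apply mult.assoc[symmetric])
  next
    case (Cons i x)
    let ?i = "prm k i" and ?j = "prm k j"
    have C: "C j i (op_T k f) = scale (- eta k j) (op_T k (C ?j ?i f))"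
    proof (cases "i \<in> {1..n}")
      case True
      show ?thesis by (rule C_conj[OF k True j Cons.prems])
    next
      case False
      then have i': "?i \<notin> {1..n}" using prm_range[OF k] by simp
      show ?thesis unfolding C_out[OF False] C_out[OF i'] by (simp add: op_T_def fun_eq_iff)
    qed
    have "op_Y j (op_T k f) (i # x, w, p)
        = op_Y j (- op_T k (op_X ?i f)) (x, w, p) + C j i (op_T k f) (x, w, p)"
      by (simp add: op_Y_Cons X_T)
    also have "\<dots> = - eta k j * (op_T k (op_Y ?j (op_X ?i f)) (x, w, p) + op_T k (C ?j ?i f) (x, w, p))"
      unfolding Y_linear C using Cons.IH[OF U_X[OF Cons.prems], of ?i] by (simp add: algebra_simps)
    also have "\<dots> = scale (eta k j) (op_T k (op_Y ?j f)) (i # x, w, p)"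
      by (simp add: op_T_apply op_Y_Cons algebra_simps)
    finally show ?case .
  qed
qed

text \<open>Read in the algebra: p y_a = y_(\<pi> a) p, with a minus sign for a in A. The set A is
  empty for e_i - e_j, {i, j} for e_i + e_j and {i} for e_i. Restricting to \<open>U\<close> and
  requiring \<pi> to preserve the index range is what allows \<open>Y_T\<close> to be applied
  repeatedly.\<close>

definition yrefl :: "free_elem \<Rightarrow> (nat \<Rightarrow> nat) \<Rightarrow> nat set \<Rightarrow> bool"
  where "yrefl p \<pi> A \<longleftrightarrow> (\<forall>a\<in>{1..n}. \<pi> a \<in> {1..n} \<and> (\<forall>f\<in>U. op_Y a (act op_t p f)
    = scale (if a \<in> A then -1 else 1) (act op_t p (op_Y (\<pi> a) f))))"

lemma yrefl_conj:
  assumes k: "k < n" "1 \<le> k" and p: "yrefl p \<pi> A"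
  shows "yrefl (- (tv k * p * tv k)) (\<lambda>a. prm k (\<pi> (prm k a))) (prm k ` A)"
  unfolding yrefl_def
proof (intro ballI conjI)
  fix a assume a: "a \<in> {1..n}"
  note t = t_indices_lt[OF k(2,1)]
  have a': "prm k a \<in> {1..n}" using a prm_range[OF t] by simp
  then have pa: "\<pi> (prm k a) \<in> {1..n}" using p unfolding yrefl_def by blast
  then show "prm k (\<pi> (prm k a)) \<in> {1..n}" using prm_range[OF t] by simp
  have A: "prm k a \<in> A \<longleftrightarrow> a \<in> prm k ` A" by (metis image_iff prm_invol)
  fix f assume f: "f \<in> U"
  have "op_Y (prm k a) (act op_t p (op_T k f))
      = scale (if a \<in> prm k ` A then -1 else 1) (act op_t p (op_Y (\<pi> (prm k a)) (op_T k f)))"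
    using p a' U_T[OF f] unfolding yrefl_def A[symmetric] by blast
  then show "op_Y a (act op_t (- (tv k * p * tv k)) f)
      = scale (if a \<in> prm k ` A then -1 else 1)
          (act op_t (- (tv k * p * tv k)) (op_Y (prm k (\<pi> (prm k a))) f))"
    using k(1) by (simp add: act_simps Y_linear Y_T[OF t a] Y_T[OF t pa] f scale_one T_linear) (auto simp: fun_eq_iff)
qed

lemma yrefl_bracket: "1 \<le> i \<Longrightarrow> i < j \<Longrightarrow> j \<le> n \<Longrightarrow> yrefl (bracket i j) (Transposition.transpose i j) {}"
proof (induction rule: bracket_induct)
  case (start k)
  show ?case
    unfolding yrefl_def bracket_start prm_values(1)[OF start(2), symmetric]
    using prm_range[OF t_indices_lt[OF start]] Y_T[OF t_indices_lt[OF start]] start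
    by (simp add: act_simps del: atLeastAtMost_iff)
next
  case (step i j)
  have "1 \<le> j" using step by simp
  from yrefl_conj[OF step(3) this step(4)] show ?case
    unfolding prm_transpose(1)[OF step(2,3)] bracket_step[OF step(2)] image_empty .
qed

lemma yrefl_bar:
  assumes W: "W \<noteq> TypeA"
  shows "1 \<le> i \<Longrightarrow> i < j \<Longrightarrow> j \<le> n \<Longrightarrow> yrefl (bar i j) (Transposition.transpose i j) {i, j}"
proof (induction rule: bracket_bar_induct)
  case start
  have n: "n - 1 < n" "Suc (n - 1) = n" "1 \<le> n - 1" using start by auto
  have tn: "n \<in> t_indices W n" by (rule n_index) (use W in \<open>cases W; simp\<close>)
  note t1 = t_indices_lt[OF n(3,1)]
  show ?case
  proof (cases "W = TypeB")
    case True
    have p: "prm (n - 1) = Transposition.transpose (n - 1) n" using prm_values(1)[OF n(1)] n(2) by simp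
    have e: "eta n a = (if a = n then -1 else 1)" for a unfolding eta_def flip_values(3)[OF True] ..
    show ?thesis
      unfolding yrefl_def bar_B[OF True] p[symmetric]
    proof (intro ballI conjI)
      fix a assume a: "a \<in> {1..n}"
      then show a': "prm (n - 1) a \<in> {1..n}" using prm_range[OF t1] by simp
      fix f assume f: "f \<in> U"
      have "op_Y a (act op_t (- (tv n * tv (n - 1) * tv n)) f)
          = scale (eta n a * eta n (prm (n - 1) a)) (act op_t (- (tv n * tv (n - 1) * tv n)) (op_Y (prm (n - 1) a) f))"
        using Y_T[OF tn a, of "op_T (n - 1) (op_T n f)"] Y_T[OF t1 a, of "op_T n f"] Y_T[OF tn a', of f] f n(1)
        unfolding prm_values(3)[OF True] id_apply
        by (simp add: act_simps Y_linear T_linear scale_scale scale_one) (simp add: fun_eq_iff)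
      also have "eta n a * eta n (prm (n - 1) a) = (if a \<in> {n - 1, n} then - 1 else 1)"
        unfolding e p using n(1) by (auto simp: transpose_def)
      finally show "op_Y a (act op_t (- (tv n * tv (n - 1) * tv n)) f) = scale (if a \<in> {n - 1, n} then - 1 else 1)
          (act op_t (- (tv n * tv (n - 1) * tv n)) (op_Y (prm (n - 1) a) f))" .
    qed
  next
    case False
    then have D: "W = TypeD" using W by (cases W) auto
    have e: "eta n a = (if a \<in> {n - 1, n} then -1 else 1)" for a
      unfolding eta_def flip_values(2)[OF D] by auto
    show ?thesis
      unfolding yrefl_def bar_D[OF D] prm_values(2)[OF D, symmetric] act_t_tv e[symmetric]
      using prm_range[OF tn] Y_T[OF tn] by blast
  qed
next
  case (last i)
  have i: "i < n" "prm i ` {Suc i, n} = {i, n}"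
    using last(2) prm_values(1)[of i] by (auto simp: transpose_def)
  from yrefl_conj[OF i(1) last(1) last(3)] show ?case
    unfolding prm_transpose_last[OF last(2)] bracket_bar_last[OF last(2)] i(2) .
next
  case (step i j)
  have j: "1 \<le> j" "prm j ` {i, Suc j} = {i, j}"
    using step(1-3) prm_values(1)[of j] by (auto simp: transpose_def)
  from yrefl_conj[OF step(3) j(1) step(4)] show ?case
    unfolding prm_transpose(2)[OF step(2,3)] bracket_bar_step[OF step(2,3)] j(2) .
qed

lemma Y_Z:
  assumes ij: "i \<in> {1..n}" "j \<in> {1..n}" "i \<noteq> j" and a: "a \<in> {1..n}" and f: "f \<in> U"
  shows "op_Y a (Z e i j f)
    = scale (if \<not> e \<and> a \<in> {i, j} then -1 else 1) (Z e i j (op_Y (Transposition.transpose i j a) f))"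
proof -
  have lt: "op_Y a (Z e i j f)
      = scale (if \<not> e \<and> a \<in> {i, j} then -1 else 1) (Z e i j (op_Y (Transposition.transpose i j a) f))"
    if "1 \<le> i" "i < j" "j \<le> n" for i j
  proof (cases "\<not> e \<and> W = TypeA")
    case True
    then have "zel e i j = 0" using bar_A[of i j] unfolding zel_def by simp
    then show ?thesis by (simp add: Z_def act_zero Y_linear fun_eq_iff)
  next
    case False
    then have "yrefl (zel e i j) (Transposition.transpose i j) (if e then {} else {i, j})"
      using yrefl_bracket[OF that] yrefl_bar[OF _ that] unfolding zel_def by (cases e) auto
    then show ?thesis using a f unfolding yrefl_def Z_def by (cases e) auto
  qed
  show ?thesis
  proof (cases "i < j")
    case False
    then have "j < i" using ij by simp
    with lt[of j i] ij Z_swap[of j i e] show ?thesis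
      by (simp add: Y_linear transpose_commute[of i j]) (auto simp: fun_eq_iff)
  qed (use lt ij in simp)
qed

lemma Y_sgl:
  assumes i: "i \<in> {1..n}" and a: "a \<in> {1..n}" "a \<noteq> i" and f: "f \<in> U"
  shows "op_Y a (sgl i f) = sgl i (op_Y a f)"
proof (cases "W = TypeB")
  case W: True
  have tn: "n \<in> t_indices W n" by (rule n_index) (use W in blast)
  have i': "1 \<le> i" "i \<le> n" using i by auto
  from i'(2,1) have "yrefl (bracket_single n i) (\<lambda>a. a) {i}"
  proof (induction rule: inc_induct)
    case base
    have "eta n a = (if a \<in> {n} then -1 else 1)" for a unfolding eta_def flip_values(3)[OF W] by simp
    then show ?case
      using Y_T[OF tn] unfolding yrefl_def bracket_single_start[OF n_pos] act_t_tv prm_values(3)[OF W] id_def by simp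
  next
    case (step i)
    have i: "1 \<le> i" "prm i ` {Suc i} = {i}" using step prm_values(1)[of i] by auto
    from yrefl_conj[OF step(2) i(1) step.IH] step show ?case
      unfolding bracket_single_step[OF step(2)] prm_invol i(2) by simp
  qed
  then show ?thesis unfolding sgl_def if_P[OF W] yrefl_def using a f by (simp add: scale_one)
next
  case False
  then have "sgl i = (\<lambda>f. 0)" by (simp add: sgl_def zero_fun_def)
  then show ?thesis by (simp add: Y_linear)
qed

lemma Y_C_far:
  assumes ij: "i \<in> {1..n}" "j \<in> {1..n}" "i \<noteq> j" and a: "a \<in> {1..n}" "a \<noteq> i" "a \<noteq> j" and f: "f \<in> U"
  shows "op_Y a (C j i f) = C j i (op_Y a f)"
proof -
  have "Transposition.transpose i j a = a" using a by (simp add: transpose_def)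
  then show ?thesis
    unfolding C_neq[OF ij(1,3)] Y_linear Y_Z[OF ij a(1) f] using a by (simp add: scale_one)
qed

text \<open>In the sum defining the diagonal commutator, y_a commutes with every summand except the
  one for k = a. The defect of that summand is also the defect of [y_a, \<xi>_i] with respect to
  y_i.\<close>

lemma Y_C_near:
  assumes ia: "i \<in> {1..n}" "a \<in> {1..n}" "a \<noteq> i" and f: "f \<in> U"
  shows "op_Y a (C i i f) - C i i (op_Y a f) = op_Y i (C a i f) - C a i (op_Y i f)"
proof -
  let ?A = "{1..n} - {i}" and ?Z = "\<lambda>k f. Z True i k f + Z False i k f"
  let ?h = "Z True i a (op_Y i f) - Z False i a (op_Y i f) - ?Z a (op_Y a f)"
  have "op_Y a (\<Sum>k\<in>?A. ?Z k f) - (\<Sum>k\<in>?A. ?Z k (op_Y a f))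
      = (\<Sum>k\<in>?A. op_Y a (?Z k f) - ?Z k (op_Y a f))"
    by (simp only: Y_linear sum_subtractf)
  also have "\<dots> = (\<Sum>k\<in>?A. if k = a then ?h else 0)"
  proof (rule sum.cong[OF refl])
    fix k assume "k \<in> ?A"
    then have k: "k \<in> {1..n}" "i \<noteq> k" by auto
    show "op_Y a (?Z k f) - ?Z k (op_Y a f) = (if k = a then ?h else 0)"
      unfolding Y_linear Y_Z[OF ia(1) k ia(2) f]
      using ia(3) by (auto simp: transpose_def scale_one scale_minus_one)
  qed
  also have "\<dots> = ?h" using ia by (subst sum.delta) auto
  finally have s: "op_Y a (\<Sum>k\<in>?A. ?Z k f) = (\<Sum>k\<in>?A. ?Z k (op_Y a f)) + ?h"
    by (simp only: diff_eq_eq add.commute)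
  have "op_Y a (C i i f) - C i i (op_Y a f) = scale u ?h"
    unfolding C_eq[OF ia(1)] Y_linear(2,5) s Y_sgl[OF ia(1,2,3) f] by (simp add: fun_eq_iff algebra_simps)
  also have "\<dots> = op_Y i (C a i f) - C a i (op_Y i f)"
    unfolding C_neq[OF ia(1) ia(3)[symmetric]] Y_linear Y_Z[OF ia(1,2) ia(3)[symmetric] ia(1) f]
    by (simp add: fun_eq_iff algebra_simps)
  finally show ?thesis .
qed

text \<open>The Jacobi identity for y_j, y_k and \<xi>_i under commuting y, rearranged so that no
  subtraction occurs. It is the inductive step of \<open>Y_Y\<close>.\<close>

lemma Y_C_comm:
  assumes jk: "j \<in> {1..n}" "k \<in> {1..n}" and f: "f \<in> U"
  shows "op_Y k (C j i f) + C k i (op_Y j f) = op_Y j (C k i f) + C j i (op_Y k f)"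
proof (cases "i \<in> {1..n}")
  case i: True
  consider "j = k" | "i = j" "k \<noteq> i" | "i = k" "j \<noteq> i" | "i \<noteq> j" "i \<noteq> k" "j \<noteq> k" by metis
  then show ?thesis
  proof cases
    case 2
    with Y_C_near[OF i jk(2) 2(2) f] show ?thesis by (simp add: fun_eq_iff algebra_simps)
  next
    case 3
    with Y_C_near[OF i jk(1) 3(2) f] show ?thesis by (simp add: fun_eq_iff algebra_simps)
  next
    case 4
    have "op_Y k (C j i f) = C j i (op_Y k f)" "op_Y j (C k i f) = C k i (op_Y j f)"
      using Y_C_far[of i j k] Y_C_far[of i k j] i jk f 4 by auto
    then show ?thesis by (simp add: add.commute)
  qed simp
next
  case False
  show ?thesis unfolding C_out[OF False] by (simp add: Y_linear)
qed

lemma Y_Y: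
  assumes jk: "j \<in> {1..n}" "k \<in> {1..n}" and f: "f \<in> U"
  shows "op_Y k (op_Y j f) = op_Y j (op_Y k f)"
proof
  fix b :: "nat list \<times> nat list \<times> nat list"
  obtain x w p where b: "b = (x, w, p)" by (cases b)
  show "op_Y k (op_Y j f) b = op_Y j (op_Y k f) b"
    unfolding b using f
  proof (induction x arbitrary: f)
    case Nil
    show ?case unfolding op_Y_Nil using U_comm[OF Nil, of "[]" w "[]"] by (simp add: mult.left_commute)
  next
    case (Cons i x)
    have X: "op_X i (op_Y j f) = op_Y j (op_X i f) + C j i f" for j
      by (auto simp: fun_eq_iff op_X_apply op_Y_Cons)
    have "op_Y k (op_Y j f) (i # x, w, p)
        = op_Y k (op_Y j (op_X i f)) (x, w, p) + (op_Y k (C j i f) + C k i (op_Y j f)) (x, w, p)" for j k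
      by (simp add: op_Y_Cons X Y_linear)
    then show ?case using Cons.IH[OF U_X[OF Cons.prems], of i]
      fun_cong[OF Y_C_comm[OF jk Cons.prems, of i], of "(x, w, p)"] by simp
  qed
qed

end

section \<open>Linear independence of the normally ordered monomials\<close>

definition "flin" :: "('k \<Rightarrow> complex) \<Rightarrow> ('k \<Rightarrow>\<^sub>0 complex) \<Rightarrow> complex"
  where "flin g p = (\<Sum>k\<in>Poly_Mapping.keys p. Poly_Mapping.lookup p k * g k)"

lemma flin_superset:
  assumes "finite A" "Poly_Mapping.keys p \<subseteq> A"
  shows "flin g p = (\<Sum>k\<in>A. Poly_Mapping.lookup p k * g k)"
  unfolding flin_def using assms by (intro sum.mono_neutral_left) (auto simp: in_keys_iff)

lemma flin_add: "flin g (p + q) = flin g p + flin g q"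
proof -
  let ?A = "Poly_Mapping.keys p \<union> Poly_Mapping.keys q"
  note s = flin_superset[where A = ?A and g = g]
  show ?thesis
    using s[of "p + q"] s[of p] s[of q] Poly_Mapping.keys_add[of p q]
    by (simp add: lookup_add algebra_simps sum.distrib)
qed

lemma flin_zero: "flin g 0 = 0"
  by (simp add: flin_def)

lemma flin_sum: "flin g (\<Sum>e\<in>E. p e) = (\<Sum>e\<in>E. flin g (p e))"
  by (induction E rule: infinite_finite_induct) (simp_all add: flin_zero flin_add)

text \<open>A basis B of N stays independent after adjoining p, so a linear map with value 0 on B
  and 1 at p extends to the whole space. It is returned through its values on single basis vectors,
  as \<open>flin\<close> expects.\<close>

lemma separating_functional:
  fixes N :: "('k \<Rightarrow>\<^sub>0 complex) set"
  assumes N: "0 \<in> N" "\<And>p q. p \<in> N \<Longrightarrow> q \<in> N \<Longrightarrow> p + q \<in> N"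
      "\<And>c p. p \<in> N \<Longrightarrow> Poly_Mapping.map ((*) c) p \<in> N"
    and p: "p \<notin> N"
  obtains g where "\<forall>q\<in>N. flin g q = 0" "flin g p \<noteq> 0"
proof -
  let ?sc = "\<lambda>c. Poly_Mapping.map ((*) c) :: ('k \<Rightarrow>\<^sub>0 complex) \<Rightarrow> ('k \<Rightarrow>\<^sub>0 complex)"
  interpret V: vector_space ?sc
    by unfold_locales (auto intro!: poly_mapping_eqI simp: lookup_map_times lookup_add algebra_simps)
  interpret VC: vector_space_pair ?sc "(*) :: complex \<Rightarrow> complex \<Rightarrow> complex"
    by unfold_locales (auto simp: algebra_simps)
  have sub: "V.subspace N" using N by (simp add: V.subspace_def)
  obtain B where B: "B \<subseteq> N" "V.independent B" "N \<subseteq> V.span B"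
    by (rule V.basis_exists[of N])
  have span: "V.span B = N" by (rule equalityI[OF V.span_minimal[OF B(1) sub] B(3)])
  have ind: "V.independent (insert p B)"
    by (rule V.independent_insertI) (simp_all only: span p B not_False_eq_True)
  obtain L where L: "Vector_Spaces.linear ?sc (*) L" "\<forall>x\<in>insert p B. L x = (if x = p then 1 else 0)"
    using VC.linear_independent_extend[OF ind, of "\<lambda>x. if x = p then 1 else 0"] by auto
  have "p \<notin> B" using p B(1) by auto
  then have LB: "L x = 0" if "x \<in> B" for x
    using L(2)[rule_format, of x] that by (metis insertCI)
  have LN: "L q = 0" if "q \<in> N" for q
    by (rule VC.linear_eq_0_on_span[OF L(1) LB]) (use that span in auto)
  define g where "g k = L (Poly_Mapping.single k 1)" for k
  have fl: "flin g q = L q" for q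
  proof -
    have "L q = L (\<Sum>k\<in>Poly_Mapping.keys q. ?sc (Poly_Mapping.lookup q k) (Poly_Mapping.single k 1))"
      using poly_mapping_sum_single[of q] by (simp add: map_single)
    also have "\<dots> = flin g q"
      unfolding flin_def g_def VC.linear_sum[OF L(1)] VC.linear_scale[OF L(1)] ..
    finally show ?thesis by simp
  qed
  show thesis
  proof (rule that[of g])
    show "\<forall>q\<in>N. flin g q = 0" using LN fl by simp
    have "L p = 1" using L(2) by simp
    then show "flin g p \<noteq> 0" using fl[of p] by simp
  qed
qed

text \<open>Only strict inversions count, so swapping two distinct neighbours changes the parity
  while repeated letters contribute nothing. The parity is the sign of sorting a word in the
  \<xi>.\<close>

primrec inversions :: "nat list \<Rightarrow> nat" where
  "inversions [] = 0"
| "inversions (a # x) = length (filter (\<lambda>b. b < a) x) + inversions x"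

lemma inversions_swap:
  "a \<noteq> b \<Longrightarrow> (-1 :: complex) ^ inversions (x @ a # b # x') = - ((-1) ^ inversions (x @ b # a # x'))"
proof (induction x)
  case Nil
  then show ?case by (cases "a < b") (auto simp: power_add)
qed (simp add: power_add)

lemma inversions_sorted: "sorted x \<Longrightarrow> inversions x = 0"
  by (induction x) (auto simp: filter_empty_conv)

definition sorted_word :: "nat \<Rightarrow> (nat \<Rightarrow>\<^sub>0 nat) \<Rightarrow> nat list"
  where "sorted_word n \<alpha> = concat (map (\<lambda>i. replicate (Poly_Mapping.lookup \<alpha> i) i) [1..<Suc n])"

lemma count_sorted_word:
  assumes "\<alpha> \<in> exponents n"
  shows "count_list (sorted_word n \<alpha>) i = Poly_Mapping.lookup \<alpha> i"
proof -
  have r: "count_list (replicate k a) i = (if a = i then k else 0)" for k a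
    by (induction k) auto
  have c: "count_list (concat (map (\<lambda>i. replicate (Poly_Mapping.lookup \<alpha> i) i) ks)) i
      = (if i \<in> set ks then Poly_Mapping.lookup \<alpha> i else 0)" if "distinct ks" for ks
    using that by (induction ks) (auto simp: count_list_append r)
  have "i \<notin> {1..n} \<Longrightarrow> Poly_Mapping.lookup \<alpha> i = 0"
    using assms by (auto simp: exponents_def in_keys_iff)
  then show ?thesis unfolding sorted_word_def by (subst c) auto
qed

lemma sorted_sorted_word: "sorted (sorted_word n \<alpha>)"
proof -
  have "sorted (concat (map (\<lambda>i. replicate (h i) i) ks))" if "sorted ks" for h :: "nat \<Rightarrow> nat" and ks
    using that by (induction ks) (auto simp: sorted_append sorted_replicate)
  then show ?thesis unfolding sorted_word_def by (metis sorted_upt)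
qed

lemma prod_list_sorted_word:
  "prod_list (map (\<lambda>i. g i ^ Poly_Mapping.lookup \<alpha> i) [1..<Suc n]) = prod_list (map g (sorted_word n \<alpha>))"
    for g :: "nat \<Rightarrow> 'a::monoid_mult"
proof -
  have r: "prod_list (replicate k x) = x ^ k" for k and x :: 'a by (induction k) simp_all
  have "prod_list (map (\<lambda>i. g i ^ Poly_Mapping.lookup \<alpha> i) ks)
      = prod_list (map g (concat (map (\<lambda>i. replicate (Poly_Mapping.lookup \<alpha> i) i) ks)))" for ks
    by (induction ks) (simp_all add: r)
  then show ?thesis unfolding sorted_word_def .
qed

lemma xi_power_eq: "xi_power n \<alpha> = prod_list (map xi (sorted_word n \<alpha>))"
  and y_power_eq: "y_power n \<gamma> = prod_list (map yv (sorted_word n \<gamma>))"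
  unfolding xi_power_def y_power_def by (rule prod_list_sorted_word)+

lemma exponents_eqI:
  assumes "\<And>i. count_list (sorted_word n \<alpha>) i = count_list (sorted_word n \<beta>) i" "\<alpha> \<in> exponents n" "\<beta> \<in> exponents n"
  shows "\<alpha> = \<beta>"
  by (rule poly_mapping_eqI) (metis assms count_sorted_word)

context spin_daha
begin

abbreviation GT :: "generator set" where "GT \<equiv> Gen_t ` t_indices W n"
abbreviation FT where "FT \<equiv> free_algebra GT"
abbreviation IS :: "free_elem set" where "IS \<equiv> Idl\<^bsub>FT\<^esub> (spin_relations W n)"
abbreviation FH where "FH \<equiv> free_algebra (daha_generators W n)"
abbreviation JH :: "free_elem set" where "JH \<equiv> Idl\<^bsub>FH\<^esub> (daha_relations W n u v)"

section \<open>The action of the full free algebra and its kernel\<close>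

definition op :: "generator \<Rightarrow> dual \<Rightarrow> dual"
  where "op g = (case g of Gen_xi i \<Rightarrow> op_X i | Gen_y j \<Rightarrow> op_Y j | Gen_t k \<Rightarrow> op_T k)"

lemma linear_op_gen: "linear_op (op g)"
  by (cases g) (simp_all add: op_def linear_X linear_Y linear_T)

lemma act_op_mult: "act op (p * q) f = act op q (act op p f)"
  by (rule act_mult) (rule linear_op_gen)

lemmas act_op_linear = linear_op_rules[OF linear_op_act[of op, OF linear_op_gen]]

lemma act_op_gens:
  "act op (xi i) f = op_X i f" "act op (yv i) f = op_Y i f" "act op (tv i) f = op_T i f"
  by (simp_all add: xi_def yv_def tv_def act_single op_def scale_one)

lemmas act_op_simps = act_op_mult act_op_gens act_t_scalar act_add act_uminus act_diff act_one act_zero act_sum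

lemma U_act_op:
  assumes "p \<in> carrier FH" "f \<in> U"
  shows "act op p f \<in> U"
proof (rule act_closed[OF U_zero U_add U_scale _ assms(2)])
  fix w g and f :: dual assume "w \<in> Poly_Mapping.keys p" "g \<in> set w" "f \<in> U"
  moreover from this have "g \<in> daha_generators W n" using assms(1) by (auto simp: free_algebra_simps)
  ultimately show "op g f \<in> U" by (auto simp: op_def daha_generators_def)
qed

lemma act_op_t_elem:
  assumes "p \<in> carrier (free_algebra (range Gen_t))"
  shows "act op p f = act op_t p f"
proof (rule act_cong)
  fix w g assume "w \<in> Poly_Mapping.keys p" "g \<in> set w"
  then have "g \<in> range Gen_t" using assms by (auto simp: free_algebra_simps)
  then show "op g = op_t g" by (auto simp: op_def op_t_def)
qed

lemma commutator_value_closed: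
  assumes "i \<in> {1..n}" "j \<in> {1..n}"
  shows "commutator_value W n u v j i \<in> carrier (free_algebra (range Gen_t))"
proof -
  let ?G = "range Gen_t"
  have t: "tv k \<in> carrier (free_algebra ?G)" for k by (simp add: free_algebra_closed_gen)
  have br: "bracket i j \<in> carrier (free_algebra ?G)" if "i \<in> {1..n}" "j \<in> {1..n}" "i \<noteq> j" for i j
    by (rule bracket_closed[of n]) (use that t in auto)
  have bb: "bracket_bar W' n i j \<in> carrier (free_algebra ?G)"
    if "2 \<le> n" "i \<in> {1..n}" "j \<in> {1..n}" for i j W'
    by (rule bracket_bar_closed) (use that t in auto)
  have bs: "bracket_single n i \<in> carrier (free_algebra ?G)" if "i \<in> {1..n}" for i
    by (rule bracket_single_closed) (use that t in auto)
  have s: "scalar c \<in> carrier (free_algebra ?G)" for c by (simp add: free_algebra_closed_gen)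
  show ?thesis using adm assms
    by (cases W) (auto intro!: free_algebra_closed free_algebra_closed_sum br bb bs s)
qed

lemma act_tmono: "act op (tmono l) f = fold op_T l f"
  by (induction l arbitrary: f) (simp_all add: act_op_simps)

lemma relations_act:
  assumes r: "r \<in> daha_relations W n u v" and f: "f \<in> U"
  shows "act op r f = 0"
proof -
  have nT: "n \<in> t_indices W n" if "W \<noteq> TypeA" using that n_pos by (cases W) auto
  have tA: "i \<in> t_indices W n" "i < n" if "i \<in> {1..n-1}" for i using that t_indices_lt[of i] by auto
  have ty: "op_Y j (op_T k f) = scale (eta k j) (op_T k (op_Y (prm k j) f))"
    if "k \<in> t_indices W n" "j \<in> {1..n}" for j k by (rule Y_T[OF that f])
  have tx: "op_X j (op_T k f) = - op_T k (op_X (prm k j) f)" for j k by (rule X_T)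
  \<comment> \<open>The relations between a t and a y or \<xi> are all instances of this law and the
    next two, with \<open>flip\<close> deciding the sign for the y.\<close>
  have y_rel: "act op (tv k * yv j - yv (prm k j) * tv k) f = 0"
    if "k \<in> t_indices W n" "j \<in> {1..n}" "\<not> flip k j" for k j
    using ty[OF that(1,2)] that(3) by (simp add: act_op_simps eta_def scale_one)
  have y_rel': "act op (tv k * yv j + yv (prm k j) * tv k) f = 0"
    if "k \<in> t_indices W n" "j \<in> {1..n}" "flip k j" for k j
    using ty[OF that(1,2)] that(3) by (simp add: act_op_simps eta_def scale_minus_one)
  have x_rel: "act op (tv k * xi j + xi (prm k j) * tv k) f = 0" for k j
    using tx[of j k] by (simp add: act_op_simps)
  have A: "act op r f = 0" if r: "r \<in> action_relations_A n"
  proof -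
    have p: "prm i i = i + 1" "j \<noteq> i \<Longrightarrow> j \<noteq> i + 1 \<Longrightarrow> prm i j = j" "\<not> flip i j" if "i < n" for i j
      using prm_values(1)[OF that] flip_values(1)[OF that] by (simp_all add: transpose_def)
    from r show ?thesis
      unfolding action_relations_A_def
    proof (elim UnE CollectE exE conjE)
      fix i assume i: "r = tv i * yv i - yv (i + 1) * tv i" "i \<in> {1..n-1}"
      then have "i \<in> {1..n}" by auto
      from y_rel[OF tA(1)[OF i(2)] this p(3)[OF tA(2)[OF i(2)]]] show ?thesis
        unfolding i(1) p(1)[OF tA(2)[OF i(2)]] .
    next
      fix i assume i: "r = tv i * xi i + xi (i + 1) * tv i" "i \<in> {1..n-1}"
      from x_rel[of i i] show ?thesis unfolding i(1) p(1)[OF tA(2)[OF i(2)]] .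
    next
      fix i j assume i: "r = tv i * yv j - yv j * tv i" "i \<in> {1..n-1}" "j \<in> {1..n} - {i, i + 1}"
      then have j: "j \<in> {1..n}" "j \<noteq> i" "j \<noteq> i + 1" by auto
      from y_rel[OF tA(1)[OF i(2)] j(1) p(3)[OF tA(2)[OF i(2)]]] show ?thesis
        unfolding i(1) p(2)[OF tA(2)[OF i(2)] j(2,3)] .
    next
      fix i j assume i: "r = tv i * xi j + xi j * tv i" "i \<in> {1..n-1}" "j \<in> {1..n} - {i, i + 1}"
      then have j: "j \<noteq> i" "j \<noteq> i + 1" by auto
      from x_rel[of i j] show ?thesis
        unfolding i(1) p(2)[OF tA(2)[OF i(2)] j] .
    qed
  qed
  have action: "act op r f = 0" if r: "r \<in> action_relations W n"
  proof -
    consider "W = TypeA" | "W = TypeB" | "W = TypeD" by (cases W)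
    then show ?thesis
    proof cases
      case 1
      then show ?thesis using A r unfolding 1 by simp
    next
      case 2
      have "W \<noteq> TypeA" using 2 by simp
      note nT = nT[OF this]
      have p: "prm n j = j" "flip n j \<longleftrightarrow> j = n" for j
        using prm_values(3)[OF 2] flip_values(3)[OF 2] by simp_all
      have n: "n \<in> {1..n}" using n_pos by simp
      from r have "r \<in> action_relations_A n \<or> r = tv n * yv n + yv n * tv n \<or> r = tv n * xi n + xi n * tv n
          \<or> (\<exists>j\<in>{1..n} - {n}. r = tv n * yv j - yv j * tv n) \<or> (\<exists>j\<in>{1..n} - {n}. r = tv n * xi j + xi j * tv n)"
        unfolding 2 by auto
      then show ?thesis
        using A y_rel'[OF nT n] x_rel[of n n] x_rel[of n] y_rel[OF nT] unfolding p by blast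
    next
      case 3
      have "W \<noteq> TypeA" using 3 by simp
      note nT = nT[OF this]
      have p: "prm n n = n - 1" "j \<noteq> n \<Longrightarrow> j \<noteq> n - 1 \<Longrightarrow> prm n j = j" "flip n j \<longleftrightarrow> j = n \<or> j = n - 1" for j
        using prm_values(2)[OF 3] flip_values(2)[OF 3] by (simp_all add: transpose_def)
      have n: "n \<in> {1..n}" using n_pos by simp
      from r have "r \<in> action_relations_A n \<or> r = tv n * yv n + yv (n - 1) * tv n \<or> r = tv n * xi n + xi (n - 1) * tv n
          \<or> (\<exists>j\<in>{1..n} - {n - 1, n}. r = tv n * yv j - yv j * tv n)
          \<or> (\<exists>j\<in>{1..n} - {n - 1, n}. r = tv n * xi j + xi j * tv n)"
        unfolding 3 by auto
      moreover have "act op (tv n * yv j - yv j * tv n) f = 0" "act op (tv n * xi j + xi j * tv n) f = 0"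
        if "j \<in> {1..n} - {n - 1, n}" for j
      proof -
        have j: "j \<in> {1..n}" "j \<noteq> n" "j \<noteq> n - 1" using that by auto
        then have "\<not> flip n j" unfolding p(3) by blast
        from y_rel[OF nT j(1) this] x_rel[of n j]
        show "act op (tv n * yv j - yv j * tv n) f = 0" "act op (tv n * xi j + xi j * tv n) f = 0"
          unfolding p(2)[OF j(2,3)] .
      qed
      ultimately show ?thesis
        using A y_rel'[OF nT n] x_rel[of n n] unfolding p(1,3) by blast
    qed
  qed
  from r show ?thesis
    unfolding daha_relations_def
  proof (elim UnE)
    assume "r \<in> spin_relations W n"
    then obtain l r' s where lr: "(l, r', s) \<in> spin_rules" and r: "r = tmono l - scalar s * tmono r'"
      unfolding spin_relations_eq by auto
    show ?thesis
      unfolding r act_diff act_op_mult act_t_scalar act_op_linear(5) act_tmono spin_rule_T[OF f lr] by simp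
  next
    assume "r \<in> {yv i * yv j - yv j * yv i |i j. i \<in> {1..n} \<and> j \<in> {1..n}}"
    then obtain i j where ij: "i \<in> {1..n}" "j \<in> {1..n}" and r: "r = yv i * yv j - yv j * yv i" by blast
    show ?thesis unfolding r act_diff act_op_mult act_op_gens Y_Y[OF ij f] by simp
  next
    assume "r \<in> skew_relations n"
    then obtain i j where "i \<noteq> j" "r = xi i * xi j + xi j * xi i" unfolding skew_relations_def by auto
    moreover have "op_X j (op_X i f) + op_X i (op_X j f) = 0" if "i \<noteq> j" for i j
      using U_skew[OF f that, of "[]"] by (auto simp: op_X_def fun_eq_iff)
    ultimately show ?thesis by (simp add: act_op_simps)
  next
    assume "r \<in> action_relations W n" then show ?thesis by (rule action)
  next
    assume "r \<in> {(yv j * xi i - xi i * yv j) - commutator_value W n u v j i | i j. i \<in> {1..n} \<and> j \<in> {1..n}}"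
    then obtain i j where ij: "i \<in> {1..n}" "j \<in> {1..n}"
      and r: "r = (yv j * xi i - xi i * yv j) - commutator_value W n u v j i" by auto
    have "op_X i (op_Y j f) - op_Y j (op_X i f) = C j i f"
      by (auto simp: fun_eq_iff op_X_apply op_Y_Cons)
    then show ?thesis
      unfolding r using act_op_t_elem[OF commutator_value_closed[OF ij], of f] C_in[OF ij(1)]
      by (simp add: act_op_simps)
  qed
qed

text \<open>The elements that annihilate \<open>U\<close> form a two-sided ideal, so it suffices
  that the relations do. In a product x a the factor x acts first, and there it matters that
  \<open>U\<close> is stable.\<close>

lemma ideal_acts_zero:
  assumes p: "p \<in> JH" and f: "f \<in> U"
  shows "act op p f = 0"
proof -
  interpret F: ring FH by (rule ring_free_algebra)
  let ?A = "{p \<in> carrier FH. \<forall>f\<in>U. act op p f = 0}"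
  have "ideal ?A FH"
  proof (rule idealI[OF F.ring_axioms])
    show "subgroup ?A (add_monoid FH)"
    proof (rule group.subgroupI)
      show "group (add_monoid FH)" by (rule F.a_group)
    next
      fix a assume a: "a \<in> ?A"
      have "\<ominus>\<^bsub>FH\<^esub> a = - a"
        using a by (intro F.minus_equality) (auto simp: free_algebra_simps)
      then show "inv\<^bsub>add_monoid FH\<^esub> a \<in> ?A"
        using a free_algebra_closed(5)[of a] by (simp add: a_inv_def act_uminus)
    next
      show "?A \<noteq> {}" using free_algebra_closed(1) act_zero by blast
    qed (auto simp: free_algebra_simps(3) free_algebra_closed act_add)
  next
    fix a x assume a: "a \<in> ?A" and x: "x \<in> carrier FH"
    show "x \<otimes>\<^bsub>FH\<^esub> a \<in> ?A" "a \<otimes>\<^bsub>FH\<^esub> x \<in> ?A"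
      using a x U_act_op[OF x]
      by (auto simp: free_algebra_simps(2) free_algebra_closed act_op_mult act_op_linear(1))
  qed
  moreover have "daha_relations W n u v \<subseteq> ?A"
    using daha_relations_subset[OF adm] relations_act by blast
  ultimately have "JH \<subseteq> ?A" by (rule F.genideal_minimal)
  then show ?thesis using p f by blast
qed

text \<open>Applied only to words in the \<open>Gen_t\<close>; the other values are
  placeholders.\<close>

primrec t_index :: "generator \<Rightarrow> nat" where
  "t_index (Gen_t k) = k"
| "t_index (Gen_xi k) = 0"
| "t_index (Gen_y k) = 0"

text \<open>Evaluated at empty \<xi>- and t-words, a y_j has nothing to pass, so it produces neither
  commutators nor signs and merely adds its letter; likewise the t act where the \<xi>-word is
  empty.\<close>

lemma act_monomial:
  assumes "s \<in> carrier FT"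
  shows "act op (prod_list (map xi x) * s * prod_list (map yv p)) f ([], [], [])
    = flin (\<lambda>w. f (x, map t_index w, p)) s"
proof -
  have X: "act op (prod_list (map xi x)) f (x', w, p) = f (x @ x', w, p)" for x x' w p f
    by (induction x arbitrary: f) (simp_all add: act_op_simps op_X_apply)
  have Y: "act op (prod_list (map yv p)) f ([], [], p') = f ([], [], p @ p')" for p p' f
    by (induction p arbitrary: f) (simp_all add: act_op_simps op_Y_Nil)
  have T: "act op s f ([], [], p) = flin (\<lambda>w. f ([], map t_index w, p)) s" for f
    unfolding act_def flin_def
  proof (rule sum.cong[OF refl])
    fix w assume "w \<in> Poly_Mapping.keys s"
    then have "w \<in> lists GT" using assms by (auto simp: free_algebra_simps)
    then obtain w' where w: "w = map Gen_t w'" unfolding lists_image by auto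
    have "map t_index w = w'" unfolding w by (simp add: o_def)
    moreover have "fold op w f ([], [], p) = f ([], w', p)"
      unfolding w fold_map using fold_T_apply[of w' f "[]" "[]" p] by (simp add: op_def o_def)
    ultimately show "Poly_Mapping.lookup s w * fold op w f ([], [], p)
        = Poly_Mapping.lookup s w * f ([], map t_index w, p)" by simp
  qed
  show ?thesis by (simp add: act_op_mult Y T X)
qed

lemma ideal_IS: "ideal IS FT"
  by (rule ring.genideal_ideal[OF ring_free_algebra spin_relations_subset[OF adm order.refl]])

lemma spin_rules_letters: "(l, r, s) \<in> spin_rules \<Longrightarrow> set l \<subseteq> t_indices W n \<and> set r \<subseteq> t_indices W n"
proof (erule spin_rules_cases)
  fix i assume "1 \<le> i" "i + 1 < n" "l = [i, i + 1, i]" "r = [i + 1, i, i + 1]"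
  then show ?thesis using t_indices_lt[of i] t_indices_lt[of "i + 1"] by auto
next
  fix i j assume "i \<in> {1..n-1}" "j \<in> {1..n-1}" "l = [i, j, i, j]" "r = []"
  then show ?thesis using t_indices_lt[of i] t_indices_lt[of j] by auto
qed (use adm in auto)

lemma spin_rule_in_IS:
  assumes "(l, r, s) \<in> spin_rules" "set w \<subseteq> t_indices W n" "set w' \<subseteq> t_indices W n"
  shows "tmono (w @ l @ w') - scalar s * tmono (w @ r @ w') \<in> IS"
proof -
  interpret ideal IS FT by (rule ideal_IS)
  have c: "tmono w \<in> carrier FT" if "set w \<subseteq> t_indices W n" for w
    using that by (intro free_algebra_closed_prod_list) (auto simp: free_algebra_closed_gen)
  have "tmono l - scalar s * tmono r \<in> IS"
    using ring.genideal_self[OF ring_free_algebra spin_relations_subset[OF adm order.refl]] assms(1)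
    unfolding spin_relations_eq by force
  from I_r_closed[OF I_l_closed[OF this c[OF assms(2)]] c[OF assms(3)]]
  have "tmono w * (tmono l - scalar s * tmono r) * tmono w' \<in> IS" by (simp add: free_algebra_simps(2))
  moreover have "tmono w * scalar s = scalar s * tmono w"
    by (rule poly_mapping_induct_single[of _ "tmono w"])
       (simp_all add: scalar_def Poly_Mapping.mult_single plus_list_def mult.commute distrib_left distrib_right)
  ultimately show ?thesis by (simp add: algebra_simps) (simp add: mult.assoc[symmetric])
qed

lemma tmono_single: "tmono w = Poly_Mapping.single (map Gen_t w) 1"
proof (induction w)
  case Nil
  show ?case using single_one[where 'a = "generator list" and 'b = complex] by (simp add: zero_list_def)
next
  case (Cons a w)
  then show ?case by (simp add: tv_def Poly_Mapping.mult_single plus_list_def)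
qed

text \<open>The coefficient of each \<xi>^\<alpha> y^\<gamma>, an element of the spin algebra, must
  vanish there. Several indices in E may share their exponents; this lets one statement serve for
  the kernel of the multiplication map, for injectivity of the family of monomials and for their
  independence.\<close>

lemma pbw_independent:
  assumes E: "finite E"
    and \<alpha>: "\<And>e. e \<in> E \<Longrightarrow> \<alpha> e \<in> exponents n" and \<gamma>: "\<And>e. e \<in> E \<Longrightarrow> \<gamma> e \<in> exponents n"
    and s: "\<And>e. e \<in> E \<Longrightarrow> s e \<in> carrier FT"
    and J: "(\<Sum>e\<in>E. xi_power n (\<alpha> e) * s e * y_power n (\<gamma> e)) \<in> JH"
    and \<alpha>0: "\<alpha>0 \<in> exponents n" and \<gamma>0: "\<gamma>0 \<in> exponents n"
  shows "(\<Sum>e\<in>{e \<in> E. \<alpha> e = \<alpha>0 \<and> \<gamma> e = \<gamma>0}. s e) \<in> IS"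
proof (rule ccontr)
  let ?E = "{e \<in> E. \<alpha> e = \<alpha>0 \<and> \<gamma> e = \<gamma>0}"
  interpret ideal IS FT by (rule ideal_IS)
  interpret M: submodule CC IS FT by (rule submodule_ideal_free_algebra[OF ideal_IS])
  assume neg: "(\<Sum>e\<in>?E. s e) \<notin> IS"
  have "0 \<in> IS"
    using additive_subgroup.zero_closed[OF additive_subgroup_axioms] by (simp add: free_algebra_simps(5))
  moreover have "p + q \<in> IS" if "p \<in> IS" "q \<in> IS" for p q
    using additive_subgroup.a_closed[OF additive_subgroup_axioms that] by (simp add: free_algebra_simps(3))
  moreover have "Poly_Mapping.map ((*) c) p \<in> IS" if "p \<in> IS" for p c
    using M.smult_closed[OF _ that, of c] by (simp add: free_algebra_def monoid_algebra_def free_module_def)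
  ultimately obtain g where g: "\<forall>q\<in>IS. flin g q = 0" "flin g (\<Sum>e\<in>?E. s e) \<noteq> 0"
    by (rule separating_functional[OF _ _ _ neg])
  \<comment> \<open>Since g is only controlled on words in the admissible letters, all other words
    get 0. No spin rule introduces or removes a foreign letter, so its two sides are sent to 0
    together.\<close>
  define lam where "lam w = (if set w \<subseteq> t_indices W n then g (map Gen_t w) else 0)" for w
  let ?ct = "\<lambda>x \<alpha>. \<forall>i. count_list x i = count_list (sorted_word n \<alpha>) i"
  \<comment> \<open>The functional dual to \<xi>^\<alpha>0 and y^\<gamma>0, with g in the middle: on
    rearrangements of the sorted \<xi>-word it takes the sorting sign, and on y-words it sees letter
    counts only.\<close>
  define f :: dual where "f = (\<lambda>(x, w, p). if ?ct x \<alpha>0 \<and> ?ct p \<gamma>0 then (-1) ^ inversions x * lam w else 0)"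
  have ct: "count_list (y @ a # b # y') i = count_list (y @ b # a # y') i" for y a b y' and i :: nat
    by (simp add: count_list_append)
  have fU: "f \<in> U"
  proof (rule U_intro)
    show "f (x @ a # b # x', w, p) = - f (x @ b # a # x', w, p)" if "a \<noteq> b" for x a b x' w p
      unfolding f_def prod.case ct[of x a b x'] inversions_swap[OF that] by simp
    show "f (x, w, p @ i # j # p') = f (x, w, p @ j # i # p')" for x w p i j p'
      unfolding f_def prod.case ct[of p i j p'] ..
    show "f (x, w @ l @ w', p) = s * f (x, w @ r @ w', p)" if lr: "(l, r, s) \<in> spin_rules" for l r s x w w' p
    proof -
      have "lam (w @ l @ w') = s * lam (w @ r @ w')"
      proof (cases "set w \<subseteq> t_indices W n \<and> set w' \<subseteq> t_indices W n")
        case True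
        let ?l = "map Gen_t (w @ l @ w')" and ?r = "map Gen_t (w @ r @ w')"
        have "0 = flin g (Poly_Mapping.single ?l 1 - scalar s * Poly_Mapping.single ?r 1)"
          using g(1) spin_rule_in_IS[OF lr, of w w'] True unfolding tmono_single by simp
        also have "\<dots> = flin g (Poly_Mapping.single ?l 1 + Poly_Mapping.single ?r (- s))"
          by (simp add: scalar_def Poly_Mapping.mult_single plus_list_def single_uminus)
        also have "\<dots> = g ?l - s * g ?r"
          unfolding flin_add by (simp add: flin_def)
        finally show ?thesis using True spin_rules_letters[OF lr] by (simp add: lam_def)
      qed (auto simp: lam_def)
      then show ?thesis by (simp add: f_def)
    qed
  qed
  have val: "act op (xi_power n (\<alpha> e) * s e * y_power n (\<gamma> e)) f ([], [], [])
      = (if \<alpha> e = \<alpha>0 \<and> \<gamma> e = \<gamma>0 then flin g (s e) else 0)" if e: "e \<in> E" for e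
  proof -
    have ct: "?ct (sorted_word n (\<alpha> e)) \<alpha>0 \<longleftrightarrow> \<alpha> e = \<alpha>0" "?ct (sorted_word n (\<gamma> e)) \<gamma>0 \<longleftrightarrow> \<gamma> e = \<gamma>0"
      using exponents_eqI \<alpha>[OF e] \<gamma>[OF e] \<alpha>0 \<gamma>0 by blast+
    have l: "lam (map t_index w) = g w" if "w \<in> Poly_Mapping.keys (s e)" for w
    proof -
      have "w \<in> lists GT" using that s[OF e] by (auto simp: free_algebra_simps)
      then obtain w' where w: "w = map Gen_t w'" "set w' \<subseteq> t_indices W n"
        unfolding lists_image by auto
      have "map t_index w = w'" unfolding w by (simp add: o_def)
      then show ?thesis using w by (simp add: lam_def)
    qed
    have "act op (xi_power n (\<alpha> e) * s e * y_power n (\<gamma> e)) f ([], [], [])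
        = flin (\<lambda>w. if \<alpha> e = \<alpha>0 \<and> \<gamma> e = \<gamma>0 then lam (map t_index w) else 0) (s e)"
      unfolding xi_power_eq y_power_eq act_monomial[OF s[OF e]]
      by (simp only: f_def prod.case ct inversions_sorted[OF sorted_sorted_word] power_0 mult_1_left)
    also have "\<dots> = (if \<alpha> e = \<alpha>0 \<and> \<gamma> e = \<gamma>0 then flin g (s e) else 0)"
      by (auto simp: flin_def l intro!: sum.cong)
    finally show ?thesis .
  qed
  have "0 = act op (\<Sum>e\<in>E. xi_power n (\<alpha> e) * s e * y_power n (\<gamma> e)) f ([], [], [])"
    using ideal_acts_zero[OF J fU] by simp
  also have "\<dots> = (\<Sum>e\<in>E. if \<alpha> e = \<alpha>0 \<and> \<gamma> e = \<gamma>0 then flin g (s e) else 0)"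
    by (simp add: act_sum sum_fun_apply val)
  also have "\<dots> = flin g (\<Sum>e\<in>?E. s e)"
    unfolding flin_sum by (rule sum.inter_filter[OF E, symmetric])
  finally show False using g(2) by simp
qed

end

section \<open>Normally ordered monomials span\<close>

lemma scalar_commute: "p * scalar c = scalar c * p"
  by (induction p rule: poly_mapping_induct_single)
     (simp_all add: scalar_def Poly_Mapping.mult_single plus_list_def mult.commute distrib_left distrib_right)

lemma scalar_values: "scalar 1 = 1" "scalar 0 = 0" "scalar (-1) = - 1" "scalar (- c) = - scalar c"
    "scalar c * scalar d = scalar (c * d)" "scalar (c + d) = scalar c + scalar d"
proof -
  show 1: "scalar 1 = 1" by (simp add: scalar_def single_one flip: zero_list_def)
  show m: "scalar (- c) = - scalar c" for c by (simp add: scalar_def single_uminus)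
  show "scalar (-1) = - 1" using m[of 1] 1 by simp
qed (simp_all add: scalar_def Poly_Mapping.mult_single plus_list_def single_add)

context
  fixes G :: "generator set" and J :: "free_elem set"
  assumes J: "ideal J (free_algebra G)"
begin

lemma ideal_add: "p \<in> J \<Longrightarrow> q \<in> J \<Longrightarrow> p + q \<in> J"
  using additive_subgroup.a_closed[OF ideal.axioms(1)[OF J], of p q] by (simp add: free_algebra_simps(3))

lemma ideal_zero: "0 \<in> J"
  using additive_subgroup.zero_closed[OF ideal.axioms(1)[OF J]] by (simp add: free_algebra_simps(5))

lemma ideal_l: "p \<in> J \<Longrightarrow> a \<in> carrier (free_algebra G) \<Longrightarrow> a * p \<in> J"
  using ideal.I_l_closed[OF J, of p a] by (simp add: free_algebra_simps(2))

lemma ideal_r: "p \<in> J \<Longrightarrow> a \<in> carrier (free_algebra G) \<Longrightarrow> p * a \<in> J"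
  using ideal.I_r_closed[OF J, of p a] by (simp add: free_algebra_simps(2))

lemma ideal_scalar: "p \<in> J \<Longrightarrow> scalar c * p \<in> J"
  by (rule ideal_l) (simp_all add: free_algebra_closed_gen)

lemma ideal_uminus: "p \<in> J \<Longrightarrow> - p \<in> J"
  using ideal_scalar[of p "-1"] by (simp add: scalar_values)

lemma ideal_diff: "p \<in> J \<Longrightarrow> q \<in> J \<Longrightarrow> p - q \<in> J"
  using ideal_add[of p "- q"] ideal_uminus[of q] by simp

lemma ideal_subset: "p \<in> J \<Longrightarrow> p \<in> carrier (free_algebra G)"
  using additive_subgroup.a_Hcarr[OF ideal.axioms(1)[OF J]] .

lemma ideal_trans: "p - q \<in> J \<Longrightarrow> q - r \<in> J \<Longrightarrow> p - r \<in> J"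
  using ideal_add[of "p - q" "q - r"] by simp

text \<open>The constant c is -1 for the \<xi> and 1 for the y, so both kinds of words are sorted at
  once. For spanning, the value of the resulting scalar d is irrelevant.\<close>

lemma insort_monomial:
  fixes g :: "nat \<Rightarrow> free_elem"
  assumes g: "\<And>i. i \<in> A \<Longrightarrow> g i \<in> carrier (free_algebra G)"
    and sw: "\<And>i j. i \<in> A \<Longrightarrow> j \<in> A \<Longrightarrow> i \<noteq> j \<Longrightarrow> g i * g j - scalar c * (g j * g i) \<in> J"
    and i: "i \<in> A" and x: "set x \<subseteq> A"
  shows "\<exists>d. prod_list (map g (i # x)) - scalar d * prod_list (map g (insort i x)) \<in> J"
  using x
proof (induction x)
  case Nil
  show ?case by (rule exI[of _ 1]) (simp add: scalar_values ideal_zero)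
next
  case (Cons a x)
  let ?m = "\<lambda>x. prod_list (map g x)"
  have c: "?m x \<in> carrier (free_algebra G)"
    using Cons.prems by (intro free_algebra_closed_prod_list) (auto intro: g)
  show ?case
  proof (cases "i \<le> a")
    case True
    then show ?thesis by (intro exI[of _ 1]) (simp add: scalar_values ideal_zero)
  next
    case False
    obtain d where d: "?m (i # x) - scalar d * ?m (insort i x) \<in> J" using Cons by auto
    have a: "a \<in> A" "i \<noteq> a" using Cons.prems False by auto
    have 1: "(g i * g a - scalar c * (g a * g i)) * ?m x \<in> J" by (rule ideal_r[OF sw[OF i a] c])
    have 2: "scalar c * (g a * (?m (i # x) - scalar d * ?m (insort i x))) \<in> J"
      by (rule ideal_scalar[OF ideal_l[OF d g[OF a(1)]]])
    have "scalar c * (g a * (scalar d * y)) = scalar (c * d) * (g a * y)" for y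
      by (metis (no_types) mult.assoc scalar_commute scalar_values(5))
    then have "?m (i # a # x) - scalar (c * d) * ?m (insort i (a # x)) \<in> J"
      using ideal_add[OF 1 2] False by (simp add: algebra_simps)
    then show ?thesis by blast
  qed
qed

lemma sort_monomial:
  fixes g :: "nat \<Rightarrow> free_elem"
  assumes g: "\<And>i. i \<in> A \<Longrightarrow> g i \<in> carrier (free_algebra G)"
    and sw: "\<And>i j. i \<in> A \<Longrightarrow> j \<in> A \<Longrightarrow> i \<noteq> j \<Longrightarrow> g i * g j - scalar c * (g j * g i) \<in> J"
    and x: "set x \<subseteq> A"
  shows "\<exists>d. prod_list (map g x) - scalar d * prod_list (map g (sort x)) \<in> J"
  using x
proof (induction x)
  case Nil
  show ?case by (rule exI[of _ 1]) (simp add: scalar_values ideal_zero)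
next
  case (Cons i x)
  let ?m = "\<lambda>x. prod_list (map g x)"
  obtain d where d: "?m x - scalar d * ?m (sort x) \<in> J" using Cons by auto
  have i: "i \<in> A" "set (sort x) \<subseteq> A" using Cons.prems by auto
  obtain e where e: "?m (i # sort x) - scalar e * ?m (insort i (sort x)) \<in> J"
    using insort_monomial[of A g c i "sort x", OF g sw i] by blast
  have 1: "g i * (?m x - scalar d * ?m (sort x)) \<in> J" by (rule ideal_l[OF d g[OF i(1)]])
  have 2: "scalar d * (?m (i # sort x) - scalar e * ?m (insort i (sort x))) \<in> J" by (rule ideal_scalar[OF e])
  have "g i * (scalar d * y) = scalar d * (g i * y)" "scalar d * (scalar e * y) = scalar (d * e) * y" for y
    by (metis (no_types) mult.assoc scalar_commute scalar_values(5))+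
  then have "?m (i # x) - scalar (d * e) * ?m (sort (i # x)) \<in> J"
    using ideal_add[OF 1 2] by (simp add: algebra_simps)
  then show ?case by blast
qed

text \<open>The presentation says how t_i passes \<xi>_i and y_i, but not \<xi>_(i+1) and y_(i+1);
  multiplying by the involution t on both sides supplies the missing direction.\<close>

lemma t_relation_inverse:
  assumes t: "t \<in> carrier (free_algebra G)" "t * t - 1 \<in> J" and e: "e * e = 1"
    and ab: "a \<in> carrier (free_algebra G)" "b \<in> carrier (free_algebra G)"
    and r: "t * a - scalar e * (b * t) \<in> J"
  shows "t * b - scalar e * (a * t) \<in> J"
proof -
  have 1: "t * (t * a - scalar e * (b * t)) * t \<in> J" by (rule ideal_r[OF ideal_l[OF r t(1)] t(1)])
  have 2: "(t * t - 1) * (a * t) \<in> J" by (rule ideal_r[OF t(2)]) (intro free_algebra_closed ab t)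
  have 3: "scalar e * (t * b * (t * t - 1)) \<in> J"
    by (rule ideal_scalar, rule ideal_l[OF t(2)]) (intro free_algebra_closed ab t)
  have s: "t * (scalar e * y) = scalar e * (t * y)" "scalar e * (scalar e * y) = y" for y
    by (metis (no_types) mult.assoc scalar_commute, metis mult.assoc scalar_values(1,5) e mult_1_left)
  have "scalar e * (t * (t * a - scalar e * (b * t)) * t - (t * t - 1) * (a * t) + scalar e * (t * b * (t * t - 1))) \<in> J"
    by (intro ideal_scalar ideal_add ideal_diff 1 2 3)
  also have "scalar e * (t * (t * a - scalar e * (b * t)) * t - (t * t - 1) * (a * t) + scalar e * (t * b * (t * t - 1)))
      = - (t * b - scalar e * (a * t))"
    by (simp add: algebra_simps s)
  finally show ?thesis using ideal_uminus by fastforce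
qed

end

lemma sort_eq_sorted_word:
  assumes "set x \<subseteq> {1..n}"
  shows "\<exists>\<alpha>\<in>exponents n. sort x = sorted_word n \<alpha>"
proof -
  define \<alpha> :: "nat \<Rightarrow>\<^sub>0 nat" where "\<alpha> = sum_list (map (\<lambda>i. Poly_Mapping.single i 1) x)"
  have c: "Poly_Mapping.lookup (sum_list (map (\<lambda>i. Poly_Mapping.single i 1) y)) i = count_list y i" for y i
    by (induction y) (auto simp: lookup_add lookup_single when_def)
  have a: "\<alpha> \<in> exponents n"
    using assms by (auto simp: exponents_def \<alpha>_def in_keys_iff c[unfolded One_nat_def] count_list_0_iff)
  have "mset (sorted_word n \<alpha>) = mset x"
    by (rule multiset_eqI) (metis count_mset count_sorted_word[OF a] c \<alpha>_def)
  then have "sort x = sorted_word n \<alpha>"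
    by (rule properties_for_sort) (rule sorted_sorted_word)
  then show ?thesis using a by blast
qed

context spin_daha
begin

section \<open>Reordering products modulo the ideal of relations\<close>

abbreviation xmono :: "nat list \<Rightarrow> free_elem" where "xmono x \<equiv> prod_list (map xi x)"
abbreviation ymono :: "nat list \<Rightarrow> free_elem" where "ymono p \<equiv> prod_list (map yv p)"

lemma ideal_JH: "ideal JH FH"
  by (rule ring.genideal_ideal[OF ring_free_algebra daha_relations_subset[OF adm]])

lemmas JH_rules = ideal_add[OF ideal_JH] ideal_zero[OF ideal_JH] ideal_scalar[OF ideal_JH]
  ideal_uminus[OF ideal_JH] ideal_diff[OF ideal_JH]
lemmas JH_l = ideal_l[OF ideal_JH] and JH_r = ideal_r[OF ideal_JH] and JH_trans = ideal_trans[OF ideal_JH]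

lemma JH_relation: "r \<in> daha_relations W n u v \<Longrightarrow> r \<in> JH"
  using ring.genideal_self[OF ring_free_algebra daha_relations_subset[OF adm]] by blast

lemma FH_gens [simp]:
  "k \<in> t_indices W n \<Longrightarrow> tv k \<in> carrier FH" "i \<in> {1..n} \<Longrightarrow> xi i \<in> carrier FH"
  "i \<in> {1..n} \<Longrightarrow> yv i \<in> carrier FH" "scalar c \<in> carrier FH"
  by (auto simp: free_algebra_closed_gen daha_generators_def)

lemma FT_FH: "s \<in> carrier FT \<Longrightarrow> s \<in> carrier FH"
  by (auto simp: free_algebra_simps daha_generators_def)

lemma xmono_FH: "set x \<subseteq> {1..n} \<Longrightarrow> xmono x \<in> carrier FH"
  and ymono_FH: "set x \<subseteq> {1..n} \<Longrightarrow> ymono x \<in> carrier FH"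
  by (rule free_algebra_closed_prod_list, auto intro!: FH_gens)+

lemma tmono_FT: "set w \<subseteq> t_indices W n \<Longrightarrow> tmono w \<in> carrier FT"
  by (rule free_algebra_closed_prod_list) (auto simp: free_algebra_closed_gen)

lemma JH_tsq: "k \<in> t_indices W n \<Longrightarrow> tv k * tv k - 1 \<in> JH"
proof -
  assume k: "k \<in> t_indices W n"
  have "tv k * tv k - 1 \<in> spin_relations W n"
    unfolding spin_relations_eq by (rule image_eqI[OF _ rule_mem(1)[OF k]]) (simp add: scalar_values)
  then have "tv k * tv k - 1 \<in> daha_relations W n u v"
    unfolding daha_relations_def by (intro UnI1)
  then show ?thesis by (rule JH_relation)
qed

lemma JH_t_relations:
  assumes k: "k \<in> t_indices W n" and j: "j \<in> {1..n}"
  shows "tv k * xi j - scalar (-1) * (xi (prm k j) * tv k) \<in> JH"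
    "tv k * yv j - scalar (eta k j) * (yv (prm k j) * tv k) \<in> JH"
proof -
  have act: "r \<in> JH" if "r \<in> action_relations W n" for r
    using that by (intro JH_relation) (simp add: daha_relations_def)
  have A: "r \<in> action_relations W n" if "r \<in> action_relations_A n" for r
    using that by (cases W) auto
  have inv: "tv k * xi j - scalar (-1) * (xi i * tv k) \<in> JH" "tv k * yv j - scalar e * (yv i * tv k) \<in> JH"
    if "i \<in> {1..n}" "tv k * xi i - scalar (-1) * (xi j * tv k) \<in> JH"
      "tv k * yv i - scalar e * (yv j * tv k) \<in> JH" "e * e = 1" for i e
    using t_relation_inverse[OF ideal_JH FH_gens(1)[OF k] JH_tsq[OF k], of "-1" "xi i" "xi j"]
      t_relation_inverse[OF ideal_JH FH_gens(1)[OF k] JH_tsq[OF k], of e "yv i" "yv j"] that j by auto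
  have "tv k * xi j - scalar (-1) * (xi (prm k j) * tv k) \<in> JH
      \<and> tv k * yv j - scalar (eta k j) * (yv (prm k j) * tv k) \<in> JH"
  proof (cases "k < n")
    case True
    have k1: "k \<in> {1..n-1}" using k True by (cases W) auto
    note p = prm_values(1)[OF True]
    have base: "tv k * xi k - scalar (-1) * (xi (k + 1) * tv k) \<in> JH"
      "tv k * yv k - scalar 1 * (yv (k + 1) * tv k) \<in> JH"
      unfolding scalar_values
      by (auto intro!: act A simp: action_relations_A_def) (use k1 in auto)
    consider "j = k" | "j = k + 1" | "j \<noteq> k" "j \<noteq> k + 1" by blast
    then show ?thesis
    proof cases
      case 1
      then show ?thesis using base True p by simp
    next
      case 2
      have "k \<in> {1..n}" using k1 by auto
      from inv[OF this, of 1] show ?thesis using base 2 True p by simp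
    next
      case 3
      have "tv k * xi j + xi j * tv k \<in> action_relations_A n" "tv k * yv j - yv j * tv k \<in> action_relations_A n"
        unfolding action_relations_A_def using k1 j 3 by auto
      then show ?thesis using act A 3 True p by (simp add: scalar_values)
    qed
  next
    case False
    then have kn: "k = n" using k by (cases W) auto
    have "W \<noteq> TypeA" using k False n_pos by auto
    then consider "W = TypeB" | "W = TypeD" by (cases W) auto
    then show ?thesis
    proof cases
      case 1
      note p = prm_values(3)[OF 1] flip_values(3)[OF 1]
      show ?thesis
      proof (cases "j = n")
        case True
        have "tv n * xi n + xi n * tv n \<in> JH" "tv n * yv n + yv n * tv n \<in> JH"
          by (rule act, simp add: 1)+
        then show ?thesis unfolding kn eta_def p id_apply using True by (simp add: scalar_values)
      next
        case False
        have "tv n * xi j + xi j * tv n \<in> JH" "tv n * yv j - yv j * tv n \<in> JH"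
          by (rule act; use 1 False j in auto)+
        then show ?thesis unfolding kn eta_def p id_apply using False by (simp add: scalar_values)
      qed
    next
      case 2
      note p = prm_values(2)[OF 2] flip_values(2)[OF 2]
      have base: "tv n * xi n - scalar (-1) * (xi (n - 1) * tv n) \<in> JH"
          "tv n * yv n - scalar (-1) * (yv (n - 1) * tv n) \<in> JH"
        unfolding scalar_values by (rule act, simp add: 2)+
      consider "j = n" | "j = n - 1" | "j \<noteq> n" "j \<noteq> n - 1" by blast
      then show ?thesis
      proof cases
        case 1
        then show ?thesis unfolding kn eta_def p using base by simp
      next
        case 2
        have "n \<in> {1..n}" using n_pos by simp
        from inv[OF this, of "-1"] show ?thesis unfolding kn eta_def p using base 2 kn by simp
      next
        case 3
        have "tv n * xi j + xi j * tv n \<in> JH" "tv n * yv j - yv j * tv n \<in> JH"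
          by (rule act; use 2 3 j in auto)+
        then show ?thesis unfolding kn eta_def p using 3 by (simp add: scalar_values transpose_def)
      qed
    qed
  qed
  then show "tv k * xi j - scalar (-1) * (xi (prm k j) * tv k) \<in> JH"
    "tv k * yv j - scalar (eta k j) * (yv (prm k j) * tv k) \<in> JH" by auto
qed

lemma JH_y_t:
  assumes k: "k \<in> t_indices W n" and j: "j \<in> {1..n}"
  shows "yv j * tv k - scalar (eta k j) * (tv k * yv (prm k j)) \<in> JH"
proof -
  have "scalar (- eta k j) * (tv k * yv (prm k j) - scalar (eta k (prm k j)) * (yv (prm k (prm k j)) * tv k)) \<in> JH"
    by (rule JH_rules(3), rule JH_t_relations(2)[OF k]) (use prm_range[OF k] j in blast)
  also have "scalar (- eta k j) * (tv k * yv (prm k j) - scalar (eta k (prm k j)) * (yv (prm k (prm k j)) * tv k))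
      = - (scalar (eta k j) * (tv k * yv (prm k j))) + scalar (eta k j * eta k j) * (yv j * tv k)"
    by (simp only: prm_invol eta_prm right_diff_distrib mult.assoc[symmetric] scalar_values(5)) (simp add: scalar_values(4))
  finally show ?thesis by (simp add: scalar_values)
qed

text \<open>The counterpart inside the algebra of the base case of \<open>yrec\<close>, with the
  same \<open>eps\<close> and \<open>idx\<close>.\<close>

lemma JH_y_tmono:
  assumes "set w \<subseteq> t_indices W n" "j \<in> {1..n}"
  shows "yv j * tmono w - scalar (eps w j) * (tmono w * yv (idx w j)) \<in> JH"
  using assms
proof (induction w arbitrary: j)
  case Nil
  show ?case by (simp add: scalar_values JH_rules)
next
  case (Cons k w)
  have k: "k \<in> t_indices W n" "set w \<subseteq> t_indices W n" using Cons.prems by auto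
  have pj: "prm k j \<in> {1..n}" using prm_range[OF k(1)] Cons.prems by blast
  have 1: "(yv j * tv k - scalar (eta k j) * (tv k * yv (prm k j))) * tmono w \<in> JH"
    by (rule JH_r[OF JH_y_t[OF k(1) Cons.prems(2)] FT_FH[OF tmono_FT[OF k(2)]]])
  have 2: "scalar (eta k j) * (tv k * (yv (prm k j) * tmono w - scalar (eps w (prm k j)) * (tmono w * yv (idx w (prm k j))))) \<in> JH"
    by (rule JH_rules(3), rule JH_l[OF Cons.IH[OF k(2) pj] FH_gens(1)[OF k(1)]])
  have s: "scalar c * (tv k * (scalar d * y)) = scalar (c * d) * (tv k * y)" for c d y
    by (metis (no_types) mult.assoc scalar_commute scalar_values(5))
  show ?case using JH_rules(1)[OF 1 2] by (simp add: algebra_simps s)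
qed

lemma JH_t_xmono:
  assumes k: "k \<in> t_indices W n" and x: "set x \<subseteq> {1..n}"
  shows "tv k * xmono x - scalar ((-1) ^ length x) * (xmono (map (prm k) x) * tv k) \<in> JH"
  using x
proof (induction x)
  case Nil
  show ?case by (simp add: scalar_values JH_rules)
next
  case (Cons i x)
  have i: "i \<in> {1..n}" "set x \<subseteq> {1..n}" using Cons.prems by auto
  have pi: "prm k i \<in> {1..n}" using prm_range[OF k] i by blast
  have 1: "(tv k * xi i - scalar (-1) * (xi (prm k i) * tv k)) * xmono x \<in> JH"
    by (rule JH_r[OF JH_t_relations(1)[OF k i(1)] xmono_FH[OF i(2)]])
  have 2: "scalar (-1) * (xi (prm k i) * (tv k * xmono x - scalar ((-1) ^ length x) * (xmono (map (prm k) x) * tv k))) \<in> JH"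
    by (rule JH_rules(3), rule JH_l[OF Cons.IH[OF i(2)] FH_gens(2)[OF pi]])
  have s: "y * (scalar d * z) = scalar d * (y * z)" for d y z
    by (metis (no_types) mult.assoc scalar_commute)
  show ?case using JH_rules(1)[OF 1 2] by (simp add: algebra_simps s scalar_values)
qed

text \<open>The ideal is built in, so membership is stable under congruence. The outer words are
  unsorted and the middle factor is arbitrary, which defers sorting until all products have been
  reordered.\<close>

inductive_set NF :: "free_elem set" where
  NF_ideal: "p \<in> JH \<Longrightarrow> p \<in> NF"
| NF_step: "set x \<subseteq> {1..n} \<Longrightarrow> s \<in> carrier FT \<Longrightarrow> set p \<subseteq> {1..n} \<Longrightarrow> z \<in> NF \<Longrightarrow> xmono x * s * ymono p + z \<in> NF"

lemma NF_FH: "z \<in> NF \<Longrightarrow> z \<in> carrier FH"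
proof (induction rule: NF.induct)
  case (NF_step x s p z)
  have "s \<in> carrier FH" by (rule FT_FH[OF NF_step(2)])
  then show ?case by (intro free_algebra_closed xmono_FH ymono_FH NF_step)
qed (rule ideal_subset[OF ideal_JH])

lemma NF_add: "y \<in> NF \<Longrightarrow> z \<in> NF \<Longrightarrow> y + z \<in> NF"
proof (induction rule: NF.induct)
  case (NF_ideal p)
  from this(2,1) show ?case
  proof (induction rule: NF.induct)
    case (NF_ideal q)
    then show ?case by (intro NF.NF_ideal JH_rules)
  next
    case (NF_step x s q z)
    then show ?case using NF.NF_step[of x s q "p + z"] by (simp add: add.left_commute)
  qed
next
  case (NF_step x s p z')
  then show ?case using NF.NF_step[of x s p "z' + z"] by (simp add: add.assoc)
qed

lemma NF_word: "set x \<subseteq> {1..n} \<Longrightarrow> s \<in> carrier FT \<Longrightarrow> set p \<subseteq> {1..n} \<Longrightarrow> xmono x * s * ymono p \<in> NF"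
  using NF_step[OF _ _ _ NF_ideal[OF JH_rules(2)], of x s p] by simp

lemma NF_cong: "q - z \<in> JH \<Longrightarrow> z \<in> NF \<Longrightarrow> q \<in> NF"
  using NF_add[OF NF_ideal, of "q - z" z] by simp

lemma NF_linear:
  assumes "z \<in> NF" "a \<in> carrier FH"
    and "\<And>x s p. set x \<subseteq> {1..n} \<Longrightarrow> s \<in> carrier FT \<Longrightarrow> set p \<subseteq> {1..n} \<Longrightarrow> a * (xmono x * s * ymono p) \<in> NF"
  shows "a * z \<in> NF"
  using assms(1)
proof (induction rule: NF.induct)
  case (NF_ideal p)
  then show ?case by (intro NF.NF_ideal JH_l assms(2))
next
  case (NF_step x s p z)
  then show ?case unfolding distrib_left by (intro NF_add assms(3))
qed

lemma NF_sum: "(\<And>k. k \<in> A \<Longrightarrow> f k \<in> NF) \<Longrightarrow> sum f A \<in> NF"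
  by (induction A rule: infinite_finite_induct) (auto intro: NF_add NF_ideal JH_rules)

lemma NF_scalar: "z \<in> NF \<Longrightarrow> scalar c * z \<in> NF"
proof (rule NF_linear)
  fix x s p assume *: "set x \<subseteq> {1..n}" "s \<in> carrier FT" "set p \<subseteq> {1..n}"
  have "scalar c * s \<in> carrier FT" by (intro free_algebra_closed *) (simp add: free_algebra_closed_gen)
  moreover have "scalar c * (xmono x * s * ymono p) = xmono x * (scalar c * s) * ymono p"
    by (metis (no_types) mult.assoc scalar_commute)
  ultimately show "scalar c * (xmono x * s * ymono p) \<in> NF" using NF_word * by simp
qed simp_all

lemma NF_xi: "z \<in> NF \<Longrightarrow> i \<in> {1..n} \<Longrightarrow> xi i * z \<in> NF"
proof (rule NF_linear)
  fix x s p assume *: "set x \<subseteq> {1..n}" "s \<in> carrier FT" "set p \<subseteq> {1..n}" and i: "i \<in> {1..n}"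
  then show "xi i * (xmono x * s * ymono p) \<in> NF" using NF_word[of "i # x" s p] by (simp add: mult.assoc)
qed simp_all

lemma NF_tv: "z \<in> NF \<Longrightarrow> k \<in> t_indices W n \<Longrightarrow> tv k * z \<in> NF"
proof (rule NF_linear)
  fix x s p assume *: "set x \<subseteq> {1..n}" "s \<in> carrier FT" "set p \<subseteq> {1..n}" and k: "k \<in> t_indices W n"
  have sp: "s * ymono p \<in> carrier FH" by (intro free_algebra_closed FT_FH ymono_FH *)
  have "set (map (prm k) x) \<subseteq> {1..n}" using * prm_range[OF k] by auto
  moreover have "tv k * s \<in> carrier FT" by (intro free_algebra_closed *) (simp add: free_algebra_closed_gen k)
  ultimately have "scalar ((-1) ^ length x) * (xmono (map (prm k) x) * (tv k * s) * ymono p) \<in> NF"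
    using * by (intro NF_scalar NF_word)
  then show "tv k * (xmono x * s * ymono p) \<in> NF"
    by (rule NF_cong[rotated]) (use JH_r[OF JH_t_xmono[OF k *(1)] sp] in \<open>simp add: algebra_simps\<close>)
qed simp_all

lemma FT_expand:
  assumes "s \<in> carrier FT"
  shows "s = (\<Sum>w\<in>Poly_Mapping.keys s. scalar (Poly_Mapping.lookup s w) * tmono (map t_index w))"
    "w \<in> Poly_Mapping.keys s \<Longrightarrow> set (map t_index w) \<subseteq> t_indices W n"
proof -
  have w: "map Gen_t (map t_index w) = w" "set (map t_index w) \<subseteq> t_indices W n" if "w \<in> Poly_Mapping.keys s" for w
  proof -
    have "set w \<subseteq> GT" using that assms by (auto simp: free_algebra_simps)
    then show "map Gen_t (map t_index w) = w" "set (map t_index w) \<subseteq> t_indices W n"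
      by (auto intro!: map_idI simp: o_def)
  qed
  have "s = (\<Sum>w\<in>Poly_Mapping.keys s. Poly_Mapping.single w (Poly_Mapping.lookup s w))"
    by (rule poly_mapping_sum_single)
  also have "\<dots> = (\<Sum>w\<in>Poly_Mapping.keys s. scalar (Poly_Mapping.lookup s w) * tmono (map t_index w))"
  proof (rule sum.cong[OF refl])
    fix w assume "w \<in> Poly_Mapping.keys s"
    from w(1)[OF this] show "Poly_Mapping.single w (Poly_Mapping.lookup s w)
        = scalar (Poly_Mapping.lookup s w) * tmono (map t_index w)"
      unfolding tmono_single by (simp only: scalar_def Poly_Mapping.mult_single plus_list_def append_Nil mult_1_right)
  qed
  finally show "s = (\<Sum>w\<in>Poly_Mapping.keys s. scalar (Poly_Mapping.lookup s w) * tmono (map t_index w))" .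
  show "w \<in> Poly_Mapping.keys s \<Longrightarrow> set (map t_index w) \<subseteq> t_indices W n" by (rule w(2))
qed

lemma NF_FT:
  assumes "s \<in> carrier FT" "z \<in> NF"
  shows "s * z \<in> NF"
proof -
  have w: "tmono w * z \<in> NF" if "set w \<subseteq> t_indices W n" for w
    using that by (induction w) (simp_all add: assms(2) mult.assoc NF_tv)
  have "s * z = (\<Sum>w\<in>Poly_Mapping.keys s. scalar (Poly_Mapping.lookup s w) * (tmono (map t_index w) * z))"
    by (subst FT_expand(1)[OF assms(1)]) (simp only: sum_distrib_right mult.assoc)
  also have "\<dots> \<in> NF" by (intro NF_sum NF_scalar w FT_expand(2)[OF assms(1)])
  finally show ?thesis .
qed

lemma commutator_value_FT:
  assumes "i \<in> {1..n}" "j \<in> {1..n}"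
  shows "commutator_value W n u v j i \<in> carrier FT"
proof -
  let ?C = "carrier FT"
  have t: "tv i \<in> ?C" if "i \<in> t_indices W n" for i
    using that by (simp add: free_algebra_closed_gen)
  have t': "tv i \<in> ?C" if "1 \<le> i" "i \<le> n - 1" for i
    by (rule t) (use that in \<open>cases W; auto\<close>)
  have tn: "tv i \<in> ?C" if "W \<noteq> TypeA" "1 \<le> i" "i \<le> n" for i
    by (rule t) (use that in \<open>cases W; auto\<close>)
  have n2: "2 \<le> n" if "W \<noteq> TypeA" using that adm by (cases W) auto
  have br: "bracket i j \<in> ?C" if "i \<in> {1..n}" "j \<in> {1..n}" "i \<noteq> j" for i j
    by (rule bracket_closed[of n]) (use that t' in auto)
  have bb: "bracket_bar W' n i j \<in> ?C" if "W \<noteq> TypeA" "i \<in> {1..n}" "j \<in> {1..n}" for i j W'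
    by (rule bracket_bar_closed) (use that tn n2 in auto)
  have bs: "bracket_single n i \<in> ?C" if "W \<noteq> TypeA" "i \<in> {1..n}" for i
    by (rule bracket_single_closed) (use that tn in auto)
  have s: "scalar c \<in> ?C" for c by (simp add: free_algebra_closed_gen)
  consider "W = TypeA" | "W = TypeB" | "W = TypeD" by (cases W)
  then show ?thesis
  proof cases
    case 1
    then have e: "commutator_value W = commutator_value TypeA" by simp
    show ?thesis unfolding e commutator_value.simps using assms
      by (cases "i = j"; simp only: simp_thms if_True if_False; intro free_algebra_closed free_algebra_closed_sum br s; auto)
  next
    case 2
    then have e: "commutator_value W = commutator_value TypeB" "W \<noteq> TypeA" by simp_all
    note bb = bb[OF e(2)] and bs = bs[OF e(2)]
    show ?thesis unfolding e(1) commutator_value.simps using assms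
      by (cases "i = j"; simp only: simp_thms if_True if_False; intro free_algebra_closed free_algebra_closed_sum br bb bs s; auto)
  next
    case 3
    then have e: "commutator_value W = commutator_value TypeD" "W \<noteq> TypeA" by simp_all
    note bb = bb[OF e(2)]
    show ?thesis unfolding e(1) commutator_value.simps using assms
      by (cases "i = j"; simp only: simp_thms if_True if_False; intro free_algebra_closed free_algebra_closed_sum br bb s; auto)
  qed
qed

lemma idx_range: "set w \<subseteq> t_indices W n \<Longrightarrow> j \<in> {1..n} \<Longrightarrow> idx w j \<in> {1..n}"
proof (induction w arbitrary: j)
  case (Cons k w)
  have k: "k \<in> t_indices W n" using Cons.prems by simp
  show ?case unfolding idx.simps
    by (rule Cons.IH) (use Cons.prems prm_range[OF k] in simp_all)
qed simp

text \<open>Induction on the \<xi>-word: moving y_j past one \<xi> costs a commutator lying in the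
  algebra of the t, and \<open>NF_FT\<close> multiplies it onto the shorter word. With no \<xi>
  left, y_j passes the t-words by \<open>JH_y_tmono\<close>.\<close>

lemma NF_yv: "z \<in> NF \<Longrightarrow> j \<in> {1..n} \<Longrightarrow> yv j * z \<in> NF"
proof (rule NF_linear)
  fix x s p assume *: "set x \<subseteq> {1..n}" "s \<in> carrier FT" "set p \<subseteq> {1..n}" and j: "j \<in> {1..n}"
  from *(1) show "yv j * (xmono x * s * ymono p) \<in> NF"
  proof (induction x)
    case Nil
    have w: "yv j * tmono w * ymono p \<in> NF" if w: "set w \<subseteq> t_indices W n" for w
    proof -
      have "scalar (eps w j) * (xmono [] * tmono w * ymono (idx w j # p)) \<in> NF"
        using * idx_range[OF w j] by (intro NF_scalar NF_word tmono_FT w) auto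
      then show ?thesis
        by (rule NF_cong[rotated])
           (use JH_r[OF JH_y_tmono[OF w j] ymono_FH[OF *(3)]] in \<open>simp add: algebra_simps\<close>)
    qed
    have c: "yv j * (scalar d * t) * q = scalar d * (yv j * t * q)" for d t q
      by (metis (no_types) mult.assoc scalar_commute)
    have "yv j * (xmono [] * s * ymono p) = yv j * s * ymono p" by (simp add: mult.assoc)
    also have "\<dots> = (\<Sum>w\<in>Poly_Mapping.keys s. scalar (Poly_Mapping.lookup s w) * (yv j * tmono (map t_index w) * ymono p))"
      by (subst FT_expand(1)[OF *(2)]) (simp only: sum_distrib_right sum_distrib_left c)
    also have "\<dots> \<in> NF" by (intro NF_sum NF_scalar w FT_expand(2)[OF *(2)])
    finally show ?case .
  next
    case (Cons i x)
    let ?z = "xmono x * s * ymono p" and ?c = "commutator_value W n u v j i"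
    have i: "i \<in> {1..n}" and x: "set x \<subseteq> {1..n}" using Cons.prems by auto
    have z: "?z \<in> NF" by (rule NF_word[OF x *(2,3)])
    have "(yv j * xi i - xi i * yv j) - ?c \<in> JH"
      by (rule JH_relation) (use i j in \<open>auto simp: daha_relations_def\<close>)
    from JH_r[OF this NF_FH[OF z]]
    have "yv j * (xi i * ?z) - (xi i * (yv j * ?z) + ?c * ?z) \<in> JH" by (simp add: algebra_simps)
    moreover have "xi i * (yv j * ?z) + ?c * ?z \<in> NF"
      by (intro NF_add NF_xi Cons.IH x i NF_FT commutator_value_FT j z)
    ultimately have "yv j * (xi i * ?z) \<in> NF" by (rule NF_cong)
    then show ?case by (simp add: mult.assoc)
  qed
qed simp_all

lemma NF_all:
  assumes "q \<in> carrier FH"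
  shows "q \<in> NF"
proof -
  have one: "1 \<in> NF" using NF_word[of "[]" 1 "[]"] by (simp add: free_algebra_closed)
  have w: "Poly_Mapping.single w 1 \<in> NF" if "set w \<subseteq> daha_generators W n" for w
    using that
  proof (induction w)
    case Nil
    show ?case using one by (simp add: single_one flip: zero_list_def)
  next
    case (Cons g w)
    have e: "Poly_Mapping.single (g # w) 1 = Poly_Mapping.single [g] 1 * (Poly_Mapping.single w 1 :: free_elem)"
      by (simp add: Poly_Mapping.mult_single plus_list_def)
    have w: "Poly_Mapping.single w 1 \<in> NF" using Cons by simp
    from Cons.prems have "g \<in> daha_generators W n" by simp
    then consider i where "i \<in> {1..n}" "g = Gen_xi i" | i where "i \<in> {1..n}" "g = Gen_y i"
      | k where "k \<in> t_indices W n" "g = Gen_t k" by (auto simp: daha_generators_def)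
    then show ?case
      unfolding e
      by cases (use NF_xi[OF w] NF_yv[OF w] NF_tv[OF w] in \<open>simp_all add: xi_def yv_def tv_def\<close>)
  qed
  have "q = (\<Sum>k\<in>Poly_Mapping.keys q. scalar (Poly_Mapping.lookup q k) * Poly_Mapping.single k 1)"
    using poly_mapping_sum_single[of q] by (simp add: scalar_def Poly_Mapping.mult_single plus_list_def)
  also have "\<dots> \<in> NF"
    by (intro NF_sum NF_scalar w) (use assms in \<open>auto simp: free_algebra_simps\<close>)
  finally show ?thesis .
qed

lemma xmono_sort:
  assumes "ideal J (free_algebra G)" "Gen_xi ` {1..n} \<subseteq> G" "skew_relations n \<subseteq> J" "set x \<subseteq> {1..n}"
  shows "\<exists>d. \<exists>\<alpha>\<in>exponents n. xmono x - scalar d * xi_power n \<alpha> \<in> J"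
proof -
  obtain \<alpha> where \<alpha>: "\<alpha> \<in> exponents n" "sort x = sorted_word n \<alpha>"
    using sort_eq_sorted_word[OF assms(4)] by blast
  have "\<exists>d. xmono x - scalar d * xmono (sort x) \<in> J"
  proof (rule sort_monomial[OF assms(1) _ _ assms(4), where c = "-1"])
    show "xi i \<in> carrier (free_algebra G)" if "i \<in> {1..n}" for i
      using that assms(2) by (auto simp: free_algebra_closed_gen)
    show "xi i * xi j - scalar (-1) * (xi j * xi i) \<in> J" if "i \<in> {1..n}" "j \<in> {1..n}" "i \<noteq> j" for i j
      using that assms(3) unfolding skew_relations_def scalar_values by auto
  qed
  then show ?thesis unfolding \<alpha>(2) xi_power_eq using \<alpha>(1) by blast
qed

lemma ymono_sort:
  assumes "set p \<subseteq> {1..n}"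
  shows "\<exists>d. \<exists>\<gamma>\<in>exponents n. ymono p - scalar d * y_power n \<gamma> \<in> JH"
proof -
  obtain \<gamma> where \<gamma>: "\<gamma> \<in> exponents n" "sort p = sorted_word n \<gamma>"
    using sort_eq_sorted_word[OF assms] by blast
  have "\<exists>d. ymono p - scalar d * ymono (sort p) \<in> JH"
  proof (rule sort_monomial[OF ideal_JH _ _ assms, where c = 1])
    show "yv i * yv j - scalar 1 * (yv j * yv i) \<in> JH" if "i \<in> {1..n}" "j \<in> {1..n}" "i \<noteq> j" for i j
      unfolding scalar_values mult_1_left
      by (rule JH_relation) (use that in \<open>auto simp: daha_relations_def\<close>)
  qed simp
  then show ?thesis unfolding \<gamma>(2) y_power_eq using \<gamma>(1) by blast
qed

lemma pbw_span_induct [consumes 1, case_names ideal step]: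
  assumes q: "q \<in> carrier FH"
    and ideal: "\<And>p. p \<in> JH \<Longrightarrow> P p"
    and step: "\<And>\<alpha> s \<gamma> z. \<alpha> \<in> exponents n \<Longrightarrow> s \<in> carrier FT \<Longrightarrow> \<gamma> \<in> exponents n \<Longrightarrow>
      z \<in> carrier FH \<Longrightarrow> P z \<Longrightarrow> P (xi_power n \<alpha> * s * y_power n \<gamma> + z)"
  shows "P q"
proof -
  \<comment> \<open>The extra summand r collects the errors in the ideal made by sorting the \<xi>-
    and y-words of the peeled-off term; with P alone they could not be passed on to the
    rest.\<close>
  have "P (q + r)" if "q \<in> NF" "r \<in> JH" for q r
    using that
  proof (induction arbitrary: r rule: NF.induct)
    case (NF_ideal p)
    then show ?case by (intro ideal JH_rules)
  next
    case (NF_step x s p z)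
    have sk: "skew_relations n \<subseteq> JH" using JH_relation by (auto simp: daha_relations_def)
    have "Gen_xi ` {1..n} \<subseteq> daha_generators W n" by (auto simp: daha_generators_def)
    from xmono_sort[OF ideal_JH this sk NF_step.hyps(1)]
    obtain d \<alpha> where \<alpha>: "\<alpha> \<in> exponents n" "xmono x - scalar d * xi_power n \<alpha> \<in> JH" by blast
    obtain e \<gamma> where \<gamma>: "\<gamma> \<in> exponents n" "ymono p - scalar e * y_power n \<gamma> \<in> JH"
      using ymono_sort[OF NF_step.hyps(3)] by blast
    let ?s = "scalar (d * e) * s" and ?X = "xi_power n \<alpha>" and ?Y = "y_power n \<gamma>"
    have X: "?X \<in> carrier FH"
      unfolding xi_power_def by (intro free_algebra_closed_prod_list) (auto intro!: free_algebra_closed_power FH_gens)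
    have s: "s \<in> carrier FH" by (rule FT_FH[OF NF_step.hyps(2)])
    have 1: "(xmono x - scalar d * ?X) * (s * ymono p) \<in> JH"
      by (rule JH_r[OF \<alpha>(2)]) (intro free_algebra_closed s ymono_FH NF_step.hyps)
    have 2: "(scalar d * ?X * s) * (ymono p - scalar e * ?Y) \<in> JH"
      by (rule JH_l[OF \<gamma>(2)]) (intro free_algebra_closed s X FH_gens)
    have c: "scalar d * ?X * s * (scalar e * ?Y) = ?X * ?s * ?Y"
      by (metis (no_types) mult.assoc scalar_commute scalar_values(5))
    have J: "xmono x * s * ymono p - ?X * ?s * ?Y \<in> JH"
      using JH_rules(1)[OF 1 2] unfolding right_diff_distrib c by (simp add: algebra_simps)
    define r' where "r' = xmono x * s * ymono p - ?X * ?s * ?Y + r"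
    have r': "r' \<in> JH" unfolding r'_def by (rule JH_rules(1)[OF J NF_step.prems])
    have "P (?X * ?s * ?Y + (z + r'))"
    proof (rule step[OF \<alpha>(1) _ \<gamma>(1) _ NF_step.IH[OF r']])
      show "?s \<in> carrier FT"
        by (intro free_algebra_closed NF_step.hyps) (simp add: free_algebra_closed_gen)
      show "z + r' \<in> carrier FH"
        by (intro free_algebra_closed NF_FH NF_step.hyps ideal_subset[OF ideal_JH r'])
    qed
    also have "?X * ?s * ?Y + (z + r') = xmono x * s * ymono p + z + r" by (simp add: r'_def)
    finally show ?case .
  qed
  from this[OF NF_all[OF q] JH_rules(2)] show ?thesis by simp
qed

end

section \<open>Quotients and tensor products of vector spaces\<close>

abbreviation pscale :: "complex \<Rightarrow> ('x \<Rightarrow>\<^sub>0 complex) \<Rightarrow> ('x \<Rightarrow>\<^sub>0 complex)"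
  where "pscale c \<equiv> Poly_Mapping.map ((*) c)"

lemma pscale_simps: "pscale c (p + q) = pscale c p + pscale c q" "pscale (c + d) p = pscale c p + pscale d p"
    "pscale c (pscale d p) = pscale (c * d) p" "pscale c 0 = 0" "pscale 0 p = 0" "pscale 1 p = p"
    "pscale (-1) p = - p" "pscale c (p - q) = pscale c p - pscale c q"
  by (auto intro!: poly_mapping_eqI simp: lookup_map_times lookup_add lookup_minus algebra_simps)

lemma pscale_sum: "pscale c (\<Sum>k\<in>A. f k) = (\<Sum>k\<in>A. pscale c (f k))"
  by (induction A rule: infinite_finite_induct) (simp_all add: pscale_simps)

text \<open>Multiplication and unit of M are left open, so the locale covers both the free modules
  beneath tensor products and the free algebras modulo ideals.\<close>

locale quotient_space =
  fixes S :: "'x set" and M :: "(complex, 'x \<Rightarrow>\<^sub>0 complex) module" and N m e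
  assumes M: "M = (free_module S)\<lparr>monoid.mult := m, one := e\<rparr>" and N: "submodule CC N M"
begin

abbreviation Q where "Q \<equiv> quotient_module M N"
abbreviation cl where "cl x \<equiv> N +>\<^bsub>M\<^esub> x"

lemma M_simps: "carrier M = {p. Poly_Mapping.keys p \<subseteq> S}" "x \<oplus>\<^bsub>M\<^esub> y = x + y" "\<zero>\<^bsub>M\<^esub> = 0"
    "c \<odot>\<^bsub>M\<^esub> x = pscale c x"
  by (simp_all add: M free_module_def)

sublocale M: vectorspace CC M
  unfolding M by (rule vectorspace_free_module_update)

sublocale Q: vectorspace CC Q
  by (rule vectorspace_quotient[OF M.vectorspace_axioms N])

lemma M_closed: "x \<in> carrier M \<Longrightarrow> y \<in> carrier M \<Longrightarrow> x + y \<in> carrier M"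
    "x \<in> carrier M \<Longrightarrow> pscale c x \<in> carrier M" "0 \<in> carrier M" "x \<in> carrier M \<Longrightarrow> - x \<in> carrier M"
    "x \<in> carrier M \<Longrightarrow> y \<in> carrier M \<Longrightarrow> x - y \<in> carrier M"
proof -
  show *: "x \<in> carrier M \<Longrightarrow> y \<in> carrier M \<Longrightarrow> x + y \<in> carrier M" for x y
    using M.a_closed[of x y] by (simp only: M_simps(2))
  show s: "x \<in> carrier M \<Longrightarrow> pscale c x \<in> carrier M" for c x
    using M.smult_closed[of c x] by (simp add: M_simps(4))
  show "0 \<in> carrier M" using M.M.zero_closed by (simp only: M_simps(3))
  show u: "x \<in> carrier M \<Longrightarrow> - x \<in> carrier M" for x using s[of x "-1"] by (simp only: pscale_simps)
  show "x \<in> carrier M \<Longrightarrow> y \<in> carrier M \<Longrightarrow> x - y \<in> carrier M" using *[of x "- y"] u[of y] by simp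
qed

lemma M_sum: "(\<And>k. k \<in> A \<Longrightarrow> f k \<in> carrier M) \<Longrightarrow> sum f A \<in> carrier M"
  by (induction A rule: infinite_finite_induct) (auto intro: M_closed)

lemma N_closed: "x \<in> N \<Longrightarrow> y \<in> N \<Longrightarrow> x + y \<in> N" "x \<in> N \<Longrightarrow> pscale c x \<in> N" "0 \<in> N"
    "x \<in> N \<Longrightarrow> - x \<in> N" "x \<in> N \<Longrightarrow> y \<in> N \<Longrightarrow> x - y \<in> N" "x \<in> N \<Longrightarrow> x \<in> carrier M"
proof -
  interpret N: submodule CC N M by (rule N)
  show a: "x \<in> N \<Longrightarrow> y \<in> N \<Longrightarrow> x + y \<in> N" for x y using N.m_closed[of x y] by (simp add: M_simps(2))
  show s: "x \<in> N \<Longrightarrow> pscale c x \<in> N" for c x using N.smult_closed[of c x] by (simp add: M_simps(4))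
  show "0 \<in> N" using N.zero_closed by (simp add: M_simps(3))
  show u: "x \<in> N \<Longrightarrow> - x \<in> N" for x using s[of x "-1"] by (simp only: pscale_simps)
  show "x \<in> N \<Longrightarrow> y \<in> N \<Longrightarrow> x - y \<in> N" using a[of x "- y"] u[of y] by simp
  show "x \<in> N \<Longrightarrow> x \<in> carrier M" using N.subset by auto
qed

lemma N_sum: "(\<And>k. k \<in> A \<Longrightarrow> f k \<in> N) \<Longrightarrow> sum f A \<in> N"
  by (induction A rule: infinite_finite_induct) (auto intro: N_closed)

lemma mem_cl: "z \<in> cl x \<longleftrightarrow> z - x \<in> N"
proof
  assume "z \<in> cl x"
  then show "z - x \<in> N" by (auto simp: a_r_coset_def' M_simps)
next
  assume "z - x \<in> N"
  then have "(z - x) + x \<in> cl x" unfolding a_r_coset_def' M_simps(2) by blast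
  then show "z \<in> cl x" by simp
qed

lemma cl_eq: "cl x = cl y \<longleftrightarrow> x - y \<in> N"
proof
  assume "cl x = cl y"
  moreover have "x \<in> cl x" by (simp add: mem_cl N_closed)
  ultimately show "x - y \<in> N" by (simp add: mem_cl)
next
  assume xy: "x - y \<in> N"
  have "z - x \<in> N \<longleftrightarrow> z - y \<in> N" for z
    using N_closed(1)[of "z - x" "x - y"] N_closed(5)[of "z - y" "x - y"] xy by auto
  then show "cl x = cl y" by (auto simp: mem_cl)
qed

lemma cl_carrier: "x \<in> carrier M \<Longrightarrow> cl x \<in> carrier Q"
  and cl_cases: "X \<in> carrier Q \<Longrightarrow> \<exists>x\<in>carrier M. X = cl x"
  by (auto simp: quotient_module_def A_RCOSETS_def')

lemma cl_add: "x \<in> carrier M \<Longrightarrow> y \<in> carrier M \<Longrightarrow> cl x \<oplus>\<^bsub>Q\<^esub> cl y = cl (x + y)"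
  using abelian_subgroup.a_rcos_sum[OF abelian_subgroup_submodule[OF M.vectorspace_axioms N], of x y]
  by (simp add: quotient_module_def M_simps(2))

lemma cl_smult: "x \<in> carrier M \<Longrightarrow> c \<odot>\<^bsub>Q\<^esub> cl x = cl (pscale c x)"
  using smult_quotient[OF M.vectorspace_axioms N, of c x] by (simp add: M_simps(4))

lemma cl_zero: "\<zero>\<^bsub>Q\<^esub> = cl 0"
proof -
  have "cl 0 = N" by (auto simp: mem_cl)
  then show ?thesis by (simp add: quotient_module_def)
qed

text \<open>Chosen representatives are linear modulo N only, and \<open>tensor_lift\<close> asks for
  no more.\<close>

definition rep where "rep X = (SOME x. x \<in> carrier M \<and> X = cl x)"

lemma rep: "X \<in> carrier Q \<Longrightarrow> rep X \<in> carrier M" "X \<in> carrier Q \<Longrightarrow> cl (rep X) = X"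
proof -
  assume "X \<in> carrier Q"
  then have "\<exists>x. x \<in> carrier M \<and> X = cl x" using cl_cases by blast
  then have "rep X \<in> carrier M \<and> X = cl (rep X)" unfolding rep_def by (rule someI_ex)
  then show "rep X \<in> carrier M" "cl (rep X) = X" by simp_all
qed

lemma rep_add: "X \<in> carrier Q \<Longrightarrow> Y \<in> carrier Q \<Longrightarrow> rep (X \<oplus>\<^bsub>Q\<^esub> Y) - rep X - rep Y \<in> N"
  using rep(2)[of "X \<oplus>\<^bsub>Q\<^esub> Y"] cl_add[of "rep X" "rep Y"] rep[of X] rep[of Y]
    cl_eq[of "rep (X \<oplus>\<^bsub>Q\<^esub> Y)" "rep X + rep Y"] Q.a_closed[of X Y] by (simp add: diff_diff_eq)

lemma rep_smult: "X \<in> carrier Q \<Longrightarrow> rep (c \<odot>\<^bsub>Q\<^esub> X) - pscale c (rep X) \<in> N"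
  using rep(2)[of "c \<odot>\<^bsub>Q\<^esub> X"] cl_smult[of "rep X" c] rep[of X]
    cl_eq[of "rep (c \<odot>\<^bsub>Q\<^esub> X)" "pscale c (rep X)"] Q.smult_closed[of c X] by simp

lemma rep_cl: "x \<in> carrier M \<Longrightarrow> rep (cl x) - x \<in> N"
  using rep(2)[OF cl_carrier[of x]] cl_eq by simp

end

lemma free_module_update: "(free_module S)\<lparr>monoid.mult := \<lambda>_ _. 0, one := 0\<rparr> = free_module S"
  by (simp add: free_module_def)

section \<open>Tensor products of vector spaces\<close>

lemma tensor_relations_subset:
  assumes "vectorspace CC V" "vectorspace CC W"
  shows "tensor_relations V W \<subseteq> carrier (free_module (carrier V \<times> carrier W))"
proof -
  interpret V: vectorspace CC V by fact
  interpret W: vectorspace CC W by fact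
  have d: "Poly_Mapping.keys (p - q) \<subseteq> A"
    if "Poly_Mapping.keys p \<subseteq> A" "Poly_Mapping.keys q \<subseteq> A" for p q :: "'a \<times> 'b \<Rightarrow>\<^sub>0 complex" and A
    using that Poly_Mapping.keys_diff[of p q] by blast
  show ?thesis
    unfolding tensor_relations_def Let_def
    by (rule subsetI, elim UnE CollectE exE conjE) (simp_all add: free_module_def d)
qed

locale tensor_space =
  fixes V :: "(complex, 'a) module" and W :: "(complex, 'b) module"
  assumes V: "vectorspace CC V" and W: "vectorspace CC W"
begin

sublocale V: vectorspace CC V by (rule V)
sublocale W: vectorspace CC W by (rule W)

abbreviation F where "F \<equiv> free_module (carrier V \<times> carrier W)"
abbreviation TN where "TN \<equiv> tensor_subspace V W"

sublocale F: vectorspace CC F by (rule vectorspace_free_module)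

sublocale T: quotient_space "carrier V \<times> carrier W" F TN "\<lambda>_ _. 0" 0
proof (rule quotient_space.intro)
  show "F = F\<lparr>monoid.mult := \<lambda>_ _. 0, one := 0\<rparr>" by (simp add: free_module_update)
  show "submodule CC TN F" unfolding tensor_subspace_def
    by (rule F.span_is_submodule[OF tensor_relations_subset[OF V W]])
qed

lemma tensor_eq: "tensor V W = T.Q"
  by (simp add: tensor_def)

lemma pure_eq: "pure_tensor V W v w = T.cl (Poly_Mapping.single (v, w) 1)"
  by (simp add: pure_tensor_def)

lemma single_F: "v \<in> carrier V \<Longrightarrow> w \<in> carrier W \<Longrightarrow> Poly_Mapping.single (v, w) c \<in> carrier F"
  by (simp add: T.M_simps)

lemma TN_relation: "r \<in> tensor_relations V W \<Longrightarrow> r \<in> TN"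
  unfolding tensor_subspace_def using F.in_own_span[OF tensor_relations_subset[OF V W]] by blast

lemma TN_rules:
  assumes "v \<in> carrier V" "w \<in> carrier W"
  shows "v' \<in> carrier V \<Longrightarrow> Poly_Mapping.single (v \<oplus>\<^bsub>V\<^esub> v', w) 1
      - (Poly_Mapping.single (v, w) 1 + Poly_Mapping.single (v', w) 1) \<in> TN"
    "w' \<in> carrier W \<Longrightarrow> Poly_Mapping.single (v, w \<oplus>\<^bsub>W\<^esub> w') 1
      - (Poly_Mapping.single (v, w) 1 + Poly_Mapping.single (v, w') 1) \<in> TN"
    "Poly_Mapping.single (c \<odot>\<^bsub>V\<^esub> v, w) 1 - Poly_Mapping.single (v, w) c \<in> TN"
    "Poly_Mapping.single (v, c \<odot>\<^bsub>W\<^esub> w) 1 - Poly_Mapping.single (v, w) c \<in> TN"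
  unfolding diff_diff_eq[symmetric]
  by (rule TN_relation, unfold tensor_relations_def Let_def, use assms in blast)+

lemma pure_carrier: "v \<in> carrier V \<Longrightarrow> w \<in> carrier W \<Longrightarrow> pure_tensor V W v w \<in> carrier (tensor V W)"
  unfolding pure_eq tensor_eq by (intro T.cl_carrier single_F)

lemma pure_add_left: "v \<in> carrier V \<Longrightarrow> v' \<in> carrier V \<Longrightarrow> w \<in> carrier W \<Longrightarrow>
    pure_tensor V W (v \<oplus>\<^bsub>V\<^esub> v') w = pure_tensor V W v w \<oplus>\<^bsub>tensor V W\<^esub> pure_tensor V W v' w"
  unfolding pure_eq tensor_eq by (simp add: T.cl_add single_F T.cl_eq TN_rules(1))

lemma pure_add_right: "v \<in> carrier V \<Longrightarrow> w \<in> carrier W \<Longrightarrow> w' \<in> carrier W \<Longrightarrow>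
    pure_tensor V W v (w \<oplus>\<^bsub>W\<^esub> w') = pure_tensor V W v w \<oplus>\<^bsub>tensor V W\<^esub> pure_tensor V W v w'"
  unfolding pure_eq tensor_eq by (simp add: T.cl_add single_F T.cl_eq TN_rules(2))

lemma pure_scale_left: "v \<in> carrier V \<Longrightarrow> w \<in> carrier W \<Longrightarrow>
    pure_tensor V W (c \<odot>\<^bsub>V\<^esub> v) w = c \<odot>\<^bsub>tensor V W\<^esub> pure_tensor V W v w"
  unfolding pure_eq tensor_eq by (simp add: T.cl_smult single_F T.cl_eq TN_rules(3) map_single)

lemma pure_scale_right: "v \<in> carrier V \<Longrightarrow> w \<in> carrier W \<Longrightarrow>
    pure_tensor V W v (c \<odot>\<^bsub>W\<^esub> w) = c \<odot>\<^bsub>tensor V W\<^esub> pure_tensor V W v w"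
  unfolding pure_eq tensor_eq by (simp add: T.cl_smult single_F T.cl_eq TN_rules(4) map_single)

lemma pure_zero: "v \<in> carrier V \<Longrightarrow> pure_tensor V W v \<zero>\<^bsub>W\<^esub> = \<zero>\<^bsub>tensor V W\<^esub>"
    "w \<in> carrier W \<Longrightarrow> pure_tensor V W \<zero>\<^bsub>V\<^esub> w = \<zero>\<^bsub>tensor V W\<^esub>"
  using pure_scale_right[of v "\<zero>\<^bsub>W\<^esub>" 0] pure_scale_left[of "\<zero>\<^bsub>V\<^esub>" w 0]
    pure_carrier[of v "\<zero>\<^bsub>W\<^esub>"] pure_carrier[of "\<zero>\<^bsub>V\<^esub>" w]
    T.Q.lmult_0 W.lmult_0[of "\<zero>\<^bsub>W\<^esub>"] V.lmult_0[of "\<zero>\<^bsub>V\<^esub>"]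
  unfolding tensor_eq by auto

lemma tensor_induct [consumes 1, case_names add pure]:
  assumes x: "x \<in> carrier (tensor V W)"
    and add: "\<And>x y. x \<in> carrier (tensor V W) \<Longrightarrow> y \<in> carrier (tensor V W) \<Longrightarrow> P x \<Longrightarrow> P y \<Longrightarrow> P (x \<oplus>\<^bsub>tensor V W\<^esub> y)"
    and pure: "\<And>v w. v \<in> carrier V \<Longrightarrow> w \<in> carrier W \<Longrightarrow> P (pure_tensor V W v w)"
  shows "P x"
proof -
  obtain z where z: "z \<in> carrier F" "x = T.cl z" using T.cl_cases x unfolding tensor_eq by blast
  have one: "P (T.cl (Poly_Mapping.single k c))" if k': "k \<in> carrier V \<times> carrier W" for k c
  proof -
    obtain v w where k: "k = (v, w)" "v \<in> carrier V" "w \<in> carrier W" using k' by auto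
    have "c \<odot>\<^bsub>V\<^esub> v \<in> carrier V" using k V.smult_closed[of c v] by simp
    moreover have "pure_tensor V W (c \<odot>\<^bsub>V\<^esub> v) w = T.cl (Poly_Mapping.single k c)"
      unfolding pure_eq k(1) T.cl_eq by (rule TN_rules(3)[OF k(2,3)])
    ultimately show ?thesis using pure k(3) by metis
  qed
  have zero: "P (T.cl 0)"
    using pure[OF V.M.zero_closed W.M.zero_closed] pure_zero(1)[OF V.M.zero_closed]
    unfolding tensor_eq T.cl_zero by simp
  have "P (T.cl (\<Sum>k\<in>A. Poly_Mapping.single k (c k)))" if "A \<subseteq> carrier V \<times> carrier W" for A c
    using that
  proof (induction A rule: infinite_finite_induct)
    case (insert k A)
    let ?r = "\<Sum>k\<in>A. Poly_Mapping.single k (c k)"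
    have sF: "Poly_Mapping.single k d \<in> carrier F" if "k \<in> carrier V \<times> carrier W" for k d
      using that by (simp add: T.M_simps)
    have r: "?r \<in> carrier F" "Poly_Mapping.single k (c k) \<in> carrier F"
      using insert.prems by (blast intro: T.M_sum sF)+
    have "P (T.cl (Poly_Mapping.single k (c k)) \<oplus>\<^bsub>tensor V W\<^esub> T.cl ?r)"
      using insert by (intro add one) (auto simp: tensor_eq intro!: T.cl_carrier r)
    then show ?case using insert.hyps r by (simp add: tensor_eq T.cl_add)
  qed (simp_all add: zero)
  from this[of "Poly_Mapping.keys z" "Poly_Mapping.lookup z"] show ?thesis
    using z poly_mapping_sum_single[of z] by (simp add: T.M_simps)
qed

end

context quotient_space
begin

text \<open>The universal property of the tensor product, phrased for a map b into the space before
  the quotient, hence with bilinearity required modulo N.\<close>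

lemma tensor_lift:
  assumes V: "vectorspace CC V" and W: "vectorspace CC W"
    and b: "\<And>v w. v \<in> carrier V \<Longrightarrow> w \<in> carrier W \<Longrightarrow> b v w \<in> carrier M"
    and add_left: "\<And>v v' w. v \<in> carrier V \<Longrightarrow> v' \<in> carrier V \<Longrightarrow> w \<in> carrier W \<Longrightarrow> b (v \<oplus>\<^bsub>V\<^esub> v') w - b v w - b v' w \<in> N"
    and add_right: "\<And>v w w'. v \<in> carrier V \<Longrightarrow> w \<in> carrier W \<Longrightarrow> w' \<in> carrier W \<Longrightarrow> b v (w \<oplus>\<^bsub>W\<^esub> w') - b v w - b v w' \<in> N"
    and scale_left: "\<And>c v w. v \<in> carrier V \<Longrightarrow> w \<in> carrier W \<Longrightarrow> b (c \<odot>\<^bsub>V\<^esub> v) w - pscale c (b v w) \<in> N"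
    and scale_right: "\<And>c v w. v \<in> carrier V \<Longrightarrow> w \<in> carrier W \<Longrightarrow> b v (c \<odot>\<^bsub>W\<^esub> w) - pscale c (b v w) \<in> N"
  shows "\<exists>\<phi>. linear_map CC (tensor V W) Q \<phi> \<and>
    (\<forall>v\<in>carrier V. \<forall>w\<in>carrier W. \<phi> (pure_tensor V W v w) = cl (b v w))"
proof -
  interpret t: tensor_space V W by (rule tensor_space.intro) fact+
  define G where "G z = (\<Sum>k\<in>Poly_Mapping.keys z. pscale (Poly_Mapping.lookup z k) (b (fst k) (snd k)))" for z
  have G_superset: "G z = (\<Sum>k\<in>A. pscale (Poly_Mapping.lookup z k) (b (fst k) (snd k)))"
    if "finite A" "Poly_Mapping.keys z \<subseteq> A" for z A
    unfolding G_def using that by (intro sum.mono_neutral_left) (auto simp: in_keys_iff pscale_simps)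
  have G_add: "G (z + z') = G z + G z'" for z z'
  proof -
    let ?A = "Poly_Mapping.keys z \<union> Poly_Mapping.keys z'"
    show ?thesis
      using G_superset[of ?A "z + z'"] G_superset[of ?A z] G_superset[of ?A z'] Poly_Mapping.keys_add[of z z']
      by (simp add: lookup_add pscale_simps sum.distrib)
  qed
  have G_scale: "G (pscale c z) = pscale c (G z)" for c z
  proof -
    have "Poly_Mapping.keys (pscale c z) \<subseteq> Poly_Mapping.keys z" by (auto simp: in_keys_iff lookup_map_times)
    from G_superset[OF finite_keys this] show ?thesis
      by (simp add: G_def[of z] pscale_sum pscale_simps lookup_map_times)
  qed
  have G_minus: "G (- z) = - G z" for z using G_scale[of "-1" z] by (simp only: pscale_simps)
  have G_diff: "G (z - z') = G z - G z'" for z z' using G_add[of z "- z'"] G_minus by simp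
  have G_single: "G (Poly_Mapping.single (v, w) c) = pscale c (b v w)" for v w c
    by (subst G_superset[of "{(v, w)}"]) (auto split: if_splits)
  have G_M: "G z \<in> carrier M" if "z \<in> carrier t.F" for z
    unfolding G_def using that by (intro M_sum M_closed b) (auto simp: t.T.M_simps)
  \<comment> \<open>The formal sums sent into N form a subspace, so containing the tensor relations
    is enough to contain their span.\<close>
  let ?K = "{z \<in> carrier t.F. G z \<in> N}"
  have K: "submodule CC ?K t.F"
  proof (rule LinearCombinations.submodule.intro)
    show "module CC t.F" using t.F.vectorspace_axioms by (simp add: vectorspace_def)
    have "G 0 = 0" by (simp add: G_def)
    then show "\<zero>\<^bsub>t.F\<^esub> \<in> ?K" using t.T.M_closed(3) N_closed(3) by (simp add: t.T.M_simps(3))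
    show "x \<oplus>\<^bsub>t.F\<^esub> y \<in> ?K" if "x \<in> ?K" "y \<in> ?K" for x y
      using that t.T.M_closed(1)[of x y] N_closed(1)[of "G x" "G y"] unfolding t.T.M_simps(2) by (simp add: G_add)
    show "c \<odot>\<^bsub>t.F\<^esub> x \<in> ?K" if "x \<in> ?K" for c x
      using that t.T.M_closed(2)[of x c] N_closed(2)[of "G x" c] unfolding t.T.M_simps(4) by (simp add: G_scale)
  qed blast
  have "r \<in> ?K" if r: "r \<in> tensor_relations V W" for r
  proof -
    have "G r \<in> N"
      using r unfolding tensor_relations_def Let_def
      by (elim UnE CollectE exE conjE)
        (simp_all add: G_diff G_single pscale_simps add_left add_right scale_left scale_right)
    then show ?thesis using r tensor_relations_subset[OF V W] by blast
  qed
  then have "t.TN \<subseteq> ?K" unfolding tensor_subspace_def by (intro t.F.span_is_subset K subsetI)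
  then have GN: "G z - G z' \<in> N" if "z - z' \<in> t.TN" for z z' using that G_diff by auto
  define \<phi> where "\<phi> X = cl (G (t.T.rep X))" for X
  have \<phi>: "\<phi> (t.T.cl z) = cl (G z)" if "z \<in> carrier t.F" for z
    unfolding \<phi>_def cl_eq by (rule GN[OF t.T.rep_cl[OF that]])
  have "linear_map CC (tensor V W) Q \<phi>"
  proof -
    have "\<phi> \<in> LinearCombinations.module_hom CC (tensor V W) Q"
      unfolding LinearCombinations.module_hom_def t.tensor_eq
    proof (intro CollectI conjI allI impI funcsetI)
      show "\<phi> X \<in> carrier Q" if "X \<in> carrier t.T.Q" for X
        unfolding \<phi>_def by (intro cl_carrier G_M t.T.rep that)
      show "\<phi> (X \<oplus>\<^bsub>t.T.Q\<^esub> Y) = \<phi> X \<oplus>\<^bsub>Q\<^esub> \<phi> Y" if XY: "X \<in> carrier t.T.Q \<and> Y \<in> carrier t.T.Q" for X Y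
      proof -
        obtain x where x: "x \<in> carrier t.F" "X = t.T.cl x"
          by (rule bexE[OF t.T.cl_cases[OF conjunct1[OF XY]]])
        obtain y where y: "y \<in> carrier t.F" "Y = t.T.cl y"
          by (rule bexE[OF t.T.cl_cases[OF conjunct2[OF XY]]])
        show ?thesis unfolding x(2) y(2) t.T.cl_add[OF x(1) y(1)] \<phi>[OF x(1)] \<phi>[OF y(1)]
            \<phi>[OF t.T.M_closed(1)[OF x(1) y(1)]] G_add cl_add[OF G_M[OF x(1)] G_M[OF y(1)]] ..
      qed
      show "\<phi> (c \<odot>\<^bsub>t.T.Q\<^esub> X) = c \<odot>\<^bsub>Q\<^esub> \<phi> X" if X: "c \<in> carrier CC \<and> X \<in> carrier t.T.Q" for c X
      proof -
        obtain x where x: "x \<in> carrier t.F" "X = t.T.cl x" 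
          by (rule bexE[OF t.T.cl_cases[OF conjunct2[OF X]]])
        show ?thesis unfolding x(2) t.T.cl_smult[OF x(1)] \<phi>[OF x(1)] \<phi>[OF t.T.M_closed(2)[OF x(1)]]
            G_scale cl_smult[OF G_M[OF x(1)]] ..
      qed
    qed
    then show ?thesis
      using Q.vectorspace_axioms t.T.Q.vectorspace_axioms unfolding t.tensor_eq
      by (simp add: linear_map_def mod_hom_def mod_hom_axioms_def vectorspace_def)
  qed
  moreover have "\<phi> (pure_tensor V W v w) = cl (b v w)" if "v \<in> carrier V" "w \<in> carrier W" for v w
    unfolding t.pure_eq \<phi>[OF t.single_F[OF that]] G_single pscale_simps ..
  ultimately show ?thesis by blast
qed

end

section \<open>The multiplication map\<close>

lemma pscale_scalar: "pscale c p = scalar c * p"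
  using mult_map_scale_conv_mult[of c p] by (simp add: scalar_def zero_list_def)

lemma quotient_space_free_algebra:
  assumes "ideal J (free_algebra G)"
  shows "quotient_space (lists G) (free_algebra G) J (*) 1"
  by (rule quotient_space.intro[OF _ submodule_ideal_free_algebra[OF assms]])
     (simp add: free_algebra_def monoid_algebra_def)

context quotient_space
begin

lemma finsum_cl:
  assumes "finite E" "\<And>e. e \<in> E \<Longrightarrow> f e \<in> carrier M"
  shows "(\<Oplus>\<^bsub>Q\<^esub>e\<in>E. cl (f e)) = cl (\<Sum>e\<in>E. f e)"
  using assms
proof (induction E)
  case empty
  then show ?case by (simp add: cl_zero)
next
  case (insert k E)
  have "(\<Oplus>\<^bsub>Q\<^esub>e\<in>insert k E. cl (f e)) = cl (f k) \<oplus>\<^bsub>Q\<^esub> (\<Oplus>\<^bsub>Q\<^esub>e\<in>E. cl (f e))"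
    using insert by (intro Q.finsum_insert) (auto intro: cl_carrier)
  then show ?case using insert by (simp add: cl_add M_sum)
qed

end

context spin_daha
begin

definition GX :: "generator set" where "GX = Gen_xi ` {1..n}"
abbreviation FX where "FX \<equiv> free_algebra GX"
abbreviation IX :: "free_elem set" where "IX \<equiv> Idl\<^bsub>FX\<^esub> (skew_relations n)"

lemma skew_FX: "skew_relations n \<subseteq> carrier FX"
  by (rule skew_relations_subset) (simp add: GX_def)

lemma ideal_IX: "ideal IX FX"
  by (rule ring.genideal_ideal[OF ring_free_algebra skew_FX])

sublocale X: quotient_space "lists GX" FX IX "(*)" 1
  by (rule quotient_space_free_algebra[OF ideal_IX])

sublocale S: quotient_space "lists GT" FT IS "(*)" 1
  by (rule quotient_space_free_algebra[OF ideal_IS])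

sublocale H: quotient_space "lists (daha_generators W n)" FH JH "(*)" 1
  by (rule quotient_space_free_algebra[OF ideal_JH])

lemma algebra_eqs: "skew_polynomials n = X.Q" "spin_weyl_algebra W n = S.Q" "rational_spin_daha W n u v = H.Q"
    "daha_class W n u v p = H.cl p"
  by (simp_all add: skew_polynomials_def spin_weyl_algebra_def rational_spin_daha_def presented_algebra_def
      daha_class_def presented_class_def GX_def)

lemma to_daha_cl:
  "x \<in> carrier FX \<Longrightarrow> to_daha W n u v (X.cl x) = H.cl x"
  "s \<in> carrier FT \<Longrightarrow> to_daha W n u v (S.cl s) = H.cl s"
proof -
  note d = daha_relations_subset[OF adm]
  have g: "GX \<subseteq> daha_generators W n" "GT \<subseteq> daha_generators W n"
    and r: "skew_relations n \<subseteq> daha_relations W n u v" "spin_relations W n \<subseteq> daha_relations W n u v"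
    by (auto simp: daha_generators_def daha_relations_def GX_def)
  show "to_daha W n u v (X.cl x) = H.cl x" if "x \<in> carrier FX"
    using induced_map_presented_class[OF g(1) skew_FX d r(1) that]
    unfolding to_daha_def presented_class_def .
  show "to_daha W n u v (S.cl s) = H.cl s" if "s \<in> carrier FT"
    using induced_map_presented_class[OF g(2) spin_relations_subset[OF adm order.refl] d r(2) that]
    unfolding to_daha_def presented_class_def .
qed

lemma IX_JH: "x \<in> IX \<Longrightarrow> x \<in> JH"
proof -
  assume x: "x \<in> IX"
  have "X.cl x = X.cl 0" unfolding X.cl_eq using x by simp
  then have "H.cl x = H.cl 0"
    using to_daha_cl(1)[OF X.N_closed(6)[OF x]] to_daha_cl(1)[OF X.M_closed(3)] by simp
  then show ?thesis unfolding H.cl_eq by simp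
qed

lemma IS_JH: "x \<in> IS \<Longrightarrow> x \<in> JH"
proof -
  assume x: "x \<in> IS"
  have "S.cl x = S.cl 0" unfolding S.cl_eq using x by simp
  then have "H.cl x = H.cl 0"
    using to_daha_cl(2)[OF S.N_closed(6)[OF x]] to_daha_cl(2)[OF S.M_closed(3)] by simp
  then show ?thesis unfolding H.cl_eq by simp
qed

lemma FX_FH: "x \<in> carrier FX \<Longrightarrow> x \<in> carrier FH"
  by (auto simp: free_algebra_simps daha_generators_def GX_def)

lemma to_daha_rep:
  "a \<in> carrier X.Q \<Longrightarrow> to_daha W n u v a = H.cl (X.rep a)"
  "s \<in> carrier S.Q \<Longrightarrow> to_daha W n u v s = H.cl (S.rep s)"
  using to_daha_cl(1)[of "X.rep a"] to_daha_cl(2)[of "S.rep s"] X.rep[of a] S.rep[of s] by simp_all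

lemma H_mult: "p \<in> carrier FH \<Longrightarrow> q \<in> carrier FH \<Longrightarrow> H.cl p \<otimes>\<^bsub>H.Q\<^esub> H.cl q = H.cl (p * q)"
  using ideal.rcoset_mult_add[OF ideal_JH, of p q] by (simp add: quotient_module_def free_algebra_simps(2))

lemma power_closed:
  "xi_power n \<alpha> \<in> carrier FX" "xi_power n \<alpha> \<in> carrier FH" "y_power n \<gamma> \<in> carrier FH"
  unfolding xi_power_def y_power_def
  by (intro free_algebra_closed_prod_list; auto intro!: free_algebra_closed_power simp: free_algebra_closed_gen daha_generators_def GX_def)+

definition ev :: "((nat \<Rightarrow>\<^sub>0 nat) \<Rightarrow>\<^sub>0 complex) \<Rightarrow> free_elem"
  where "ev p = (\<Sum>\<gamma>\<in>Poly_Mapping.keys p. scalar (Poly_Mapping.lookup p \<gamma>) * y_power n \<gamma>)"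

lemma ev_superset:
  assumes "finite A" "Poly_Mapping.keys p \<subseteq> A"
  shows "ev p = (\<Sum>\<gamma>\<in>A. scalar (Poly_Mapping.lookup p \<gamma>) * y_power n \<gamma>)"
  unfolding ev_def using assms by (intro sum.mono_neutral_left) (auto simp: in_keys_iff scalar_values)

lemma ev_add: "ev (p + q) = ev p + ev q"
proof -
  let ?A = "Poly_Mapping.keys p \<union> Poly_Mapping.keys q"
  show ?thesis
    using ev_superset[of ?A "p + q"] ev_superset[of ?A p] ev_superset[of ?A q] Poly_Mapping.keys_add[of p q]
    by (simp add: lookup_add scalar_values sum.distrib distrib_right)
qed

lemma ev_scale: "ev (pscale c p) = pscale c (ev p)"
proof -
  have "Poly_Mapping.keys (pscale c p) \<subseteq> Poly_Mapping.keys p" by (auto simp: in_keys_iff lookup_map_times)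
  note e = ev_superset[OF finite_keys this]
  have "scalar (c * d) * y = scalar c * (scalar d * y)" for d y
    by (simp only: scalar_values(5)[symmetric] mult.assoc)
  then show ?thesis unfolding e ev_def[of p] lookup_map_times pscale_scalar sum_distrib_left by simp
qed

lemma ev_single: "ev (Poly_Mapping.single \<gamma> 1) = y_power n \<gamma>"
  by (simp add: ev_def scalar_values)

lemma ev_closed: "ev p \<in> carrier FH"
  unfolding ev_def by (intro free_algebra_closed_sum free_algebra_closed power_closed FH_gens)

lemma polynomials_simps: "carrier (polynomials n) = {p. Poly_Mapping.keys p \<subseteq> exponents n}"
    "p \<oplus>\<^bsub>polynomials n\<^esub> q = p + q" "\<zero>\<^bsub>polynomials n\<^esub> = 0" "c \<odot>\<^bsub>polynomials n\<^esub> p = pscale c p"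
  by (simp_all add: polynomials_def monoid_algebra_def free_module_def)

abbreviation T1 where "T1 \<equiv> tensor X.Q S.Q"
abbreviation TT where "TT \<equiv> tensor T1 (polynomials n)"

sublocale t1: tensor_space X.Q S.Q
  by (rule tensor_space.intro[OF X.Q.vectorspace_axioms S.Q.vectorspace_axioms])

sublocale t2: tensor_space T1 "polynomials n"
  by (rule tensor_space.intro[OF vectorspace_tensor[OF X.Q.vectorspace_axioms S.Q.vectorspace_axioms]
      vectorspace_polynomials])

lemma pscale_mult: "pscale c (p * q) = pscale c p * q" "p * pscale c q = pscale c (p * (q :: free_elem))"
  unfolding pscale_scalar by (simp_all add: mult.assoc) (metis mult.assoc scalar_commute)

text \<open>Two applications of \<open>tensor_lift\<close>. The first stage yields classes, so the
  second multiplies a chosen representative of the class by \<open>ev p\<close>; on pure tensors the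
  choice is removed modulo the ideal.\<close>

lemma multiplication_map:
  obtains \<phi> where "linear_map CC TT H.Q \<phi>"
    "\<And>a s p. a \<in> carrier X.Q \<Longrightarrow> s \<in> carrier S.Q \<Longrightarrow> p \<in> carrier (polynomials n) \<Longrightarrow>
      \<phi> (pure_tensor T1 (polynomials n) (pure_tensor X.Q S.Q a s) p) = H.cl (X.rep a * S.rep s * ev p)"
proof -
  have rx: "X.rep a \<in> carrier FH" if "a \<in> carrier X.Q" for a using X.rep(1)[OF that] by (rule FX_FH)
  have rs: "S.rep s \<in> carrier FH" if "s \<in> carrier S.Q" for s using S.rep(1)[OF that] by (rule FT_FH)
  have "\<exists>\<phi>. linear_map CC T1 H.Q \<phi> \<and>
      (\<forall>a\<in>carrier X.Q. \<forall>s\<in>carrier S.Q. \<phi> (pure_tensor X.Q S.Q a s) = H.cl (X.rep a * S.rep s))"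
  proof (rule H.tensor_lift[OF X.Q.vectorspace_axioms S.Q.vectorspace_axioms])
    fix a a' s s' c assume a: "a \<in> carrier X.Q" and s: "s \<in> carrier S.Q"
    show "X.rep a * S.rep s \<in> carrier FH" by (intro free_algebra_closed rx rs a s)
    show "X.rep (a \<oplus>\<^bsub>X.Q\<^esub> a') * S.rep s - X.rep a * S.rep s - X.rep a' * S.rep s \<in> JH" if "a' \<in> carrier X.Q"
      using JH_r[OF IX_JH[OF X.rep_add[OF a that]] rs[OF s]] by (simp add: algebra_simps)
    show "X.rep a * S.rep (s \<oplus>\<^bsub>S.Q\<^esub> s') - X.rep a * S.rep s - X.rep a * S.rep s' \<in> JH" if "s' \<in> carrier S.Q"
      using JH_l[OF IS_JH[OF S.rep_add[OF s that]] rx[OF a]] by (simp add: algebra_simps)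
    show "X.rep (c \<odot>\<^bsub>X.Q\<^esub> a) * S.rep s - pscale c (X.rep a * S.rep s) \<in> JH"
      using JH_r[OF IX_JH[OF X.rep_smult[OF a]] rs[OF s], of c] by (simp add: left_diff_distrib pscale_mult)
    show "X.rep a * S.rep (c \<odot>\<^bsub>S.Q\<^esub> s) - pscale c (X.rep a * S.rep s) \<in> JH"
      using JH_l[OF IS_JH[OF S.rep_smult[OF s]] rx[OF a], of c] by (simp add: right_diff_distrib pscale_mult(2))
  qed
  then obtain \<phi>1 where lin: "linear_map CC T1 H.Q \<phi>1"
    and \<phi>1: "\<And>a s. a \<in> carrier X.Q \<Longrightarrow> s \<in> carrier S.Q \<Longrightarrow> \<phi>1 (pure_tensor X.Q S.Q a s) = H.cl (X.rep a * S.rep s)"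
    by blast
  interpret L: linear_map CC T1 H.Q \<phi>1 by (rule lin)
  have rh: "H.rep (\<phi>1 A) \<in> carrier FH" if "A \<in> carrier T1" for A by (rule H.rep(1)[OF L.f_im[OF that]])
  have "\<exists>\<phi>. linear_map CC TT H.Q \<phi> \<and>
      (\<forall>A\<in>carrier T1. \<forall>p\<in>carrier (polynomials n). \<phi> (pure_tensor T1 (polynomials n) A p) = H.cl (H.rep (\<phi>1 A) * ev p))"
  proof (rule H.tensor_lift[OF t2.V.vectorspace_axioms vectorspace_polynomials])
    fix A A' p p' c assume A: "A \<in> carrier T1" and p: "p \<in> carrier (polynomials n)"
    show "H.rep (\<phi>1 A) * ev p \<in> carrier FH" by (intro free_algebra_closed rh ev_closed A)
    show "H.rep (\<phi>1 (A \<oplus>\<^bsub>T1\<^esub> A')) * ev p - H.rep (\<phi>1 A) * ev p - H.rep (\<phi>1 A') * ev p \<in> JH" if "A' \<in> carrier T1"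
      using JH_r[OF H.rep_add[OF L.f_im[OF A] L.f_im[OF that]] ev_closed] L.f_add[OF A that]
      by (simp add: left_diff_distrib)
    show "H.rep (\<phi>1 A) * ev (p \<oplus>\<^bsub>polynomials n\<^esub> p') - H.rep (\<phi>1 A) * ev p - H.rep (\<phi>1 A) * ev p' \<in> JH"
      by (simp add: polynomials_simps ev_add distrib_left JH_rules)
    show "H.rep (\<phi>1 (c \<odot>\<^bsub>T1\<^esub> A)) * ev p - pscale c (H.rep (\<phi>1 A) * ev p) \<in> JH"
      using JH_r[OF H.rep_smult[OF L.f_im[OF A]] ev_closed, of c] L.f_smult[OF _ A, of c]
      by (simp add: left_diff_distrib pscale_mult)
    show "H.rep (\<phi>1 A) * ev (c \<odot>\<^bsub>polynomials n\<^esub> p) - pscale c (H.rep (\<phi>1 A) * ev p) \<in> JH"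
      by (simp add: polynomials_simps ev_scale pscale_mult(2) JH_rules)
  qed
  then obtain \<phi> where lin2: "linear_map CC TT H.Q \<phi>"
    and \<phi>: "\<And>A p. A \<in> carrier T1 \<Longrightarrow> p \<in> carrier (polynomials n) \<Longrightarrow>
      \<phi> (pure_tensor T1 (polynomials n) A p) = H.cl (H.rep (\<phi>1 A) * ev p)"
    by blast
  have "\<phi> (pure_tensor T1 (polynomials n) (pure_tensor X.Q S.Q a s) p) = H.cl (X.rep a * S.rep s * ev p)"
    if a: "a \<in> carrier X.Q" and s: "s \<in> carrier S.Q" and p: "p \<in> carrier (polynomials n)" for a s p
  proof -
    have "X.rep a * S.rep s \<in> carrier FH" by (intro free_algebra_closed rx rs a s)
    from JH_r[OF H.rep_cl[OF this] ev_closed]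
    have "H.rep (\<phi>1 (pure_tensor X.Q S.Q a s)) * ev p - X.rep a * S.rep s * ev p \<in> JH"
      unfolding \<phi>1[OF a s] by (simp add: left_diff_distrib)
    then show ?thesis unfolding \<phi>[OF t1.pure_carrier[OF a s] p] H.cl_eq .
  qed
  with lin2 show thesis by (rule that)
qed

text \<open>A formal generator rather than a tensor: sums of such generators are plain sums of
  finitely supported functions, and the class is taken once at the end.\<close>

definition oelem :: "(nat \<Rightarrow>\<^sub>0 nat) \<times> (nat \<Rightarrow>\<^sub>0 nat) \<Rightarrow> free_elem \<Rightarrow>
    (free_elem set \<times> free_elem set \<Rightarrow>\<^sub>0 complex) set \<times> ((nat \<Rightarrow>\<^sub>0 nat) \<Rightarrow>\<^sub>0 complex) \<Rightarrow>\<^sub>0 complex"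
  where "oelem k s = Poly_Mapping.single
    (pure_tensor X.Q S.Q (X.cl (xi_power n (fst k))) (S.cl s), Poly_Mapping.single (snd k) 1) 1"

text \<open>The coefficients s form a total function with value 0 off E, so that two expansions can
  be added over the union of their supports.\<close>

definition expandable where
  "expandable \<tau> \<longleftrightarrow> (\<exists>E s. finite E \<and> E \<subseteq> exponents n \<times> exponents n \<and> (\<forall>k. s k \<in> carrier FT)
    \<and> (\<forall>k. k \<notin> E \<longrightarrow> s k = 0) \<and> \<tau> = t2.T.cl (\<Sum>k\<in>E. oelem k (s k)))"

lemma mono_carrier: "\<gamma> \<in> exponents n \<Longrightarrow> Poly_Mapping.single \<gamma> c \<in> carrier (polynomials n)"
  by (simp add: polynomials_simps)

lemma oelem_carrier: "k \<in> exponents n \<times> exponents n \<Longrightarrow> s \<in> carrier FT \<Longrightarrow> oelem k s \<in> carrier t2.F"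
  unfolding oelem_def
  by (intro t2.single_F t1.pure_carrier X.cl_carrier S.cl_carrier power_closed mono_carrier) auto

lemma oelem_zero:
  assumes k: "k \<in> exponents n \<times> exponents n" and s: "s \<in> IS"
  shows "oelem k s \<in> t2.TN"
proof -
  have "S.cl s = \<zero>\<^bsub>S.Q\<^esub>" unfolding S.cl_zero S.cl_eq using s by simp
  then have z: "pure_tensor X.Q S.Q (X.cl (xi_power n (fst k))) (S.cl s) = \<zero>\<^bsub>T1\<^esub>"
    using t1.pure_zero(1)[OF X.cl_carrier[OF power_closed(1)]] by simp
  have "snd k \<in> exponents n" using k by auto
  from t2.pure_zero(2)[OF mono_carrier[OF this, of 1]] show ?thesis
    unfolding oelem_def z t2.pure_eq t2.tensor_eq t2.T.cl_zero t2.T.cl_eq by simp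
qed

lemma oelem_add:
  assumes k: "k \<in> exponents n \<times> exponents n" and s: "s \<in> carrier FT" "s' \<in> carrier FT"
  shows "oelem k (s + s') - (oelem k s + oelem k s') \<in> t2.TN"
proof -
  note x = X.cl_carrier[OF power_closed(1)[of "fst k"]]
  have "pure_tensor X.Q S.Q (X.cl (xi_power n (fst k))) (S.cl (s + s'))
      = pure_tensor X.Q S.Q (X.cl (xi_power n (fst k))) (S.cl s) \<oplus>\<^bsub>T1\<^esub> pure_tensor X.Q S.Q (X.cl (xi_power n (fst k))) (S.cl s')"
    using t1.pure_add_right[OF x S.cl_carrier[OF s(1)] S.cl_carrier[OF s(2)]] S.cl_add[OF s] by simp
  moreover have "snd k \<in> exponents n" using k by auto
  ultimately show ?thesis
    unfolding oelem_def
    using t2.TN_rules(1)[OF t1.pure_carrier[OF x S.cl_carrier[OF s(1)]] mono_carrier t1.pure_carrier[OF x S.cl_carrier[OF s(2)]]]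
    by simp
qed

lemma expandable_zero: "expandable \<zero>\<^bsub>TT\<^esub>"
  unfolding expandable_def
  by (rule exI[of _ "{}"], rule exI[of _ "\<lambda>_. 0"])
     (simp add: t2.tensor_eq t2.T.cl_zero free_algebra_closed)

lemma expandable_add:
  assumes "expandable \<sigma>" "expandable \<tau>"
  shows "expandable (\<sigma> \<oplus>\<^bsub>TT\<^esub> \<tau>)"
proof -
  let ?I = "exponents n \<times> exponents n"
  obtain E s where E: "finite E" "E \<subseteq> ?I" "\<And>k. s k \<in> carrier FT" "\<And>k. k \<notin> E \<Longrightarrow> s k = 0"
      "\<sigma> = t2.T.cl (\<Sum>k\<in>E. oelem k (s k))" using assms(1) unfolding expandable_def by blast
  obtain E' s' where E': "finite E'" "E' \<subseteq> ?I" "\<And>k. s' k \<in> carrier FT" "\<And>k. k \<notin> E' \<Longrightarrow> s' k = 0"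
      "\<tau> = t2.T.cl (\<Sum>k\<in>E'. oelem k (s' k))" using assms(2) unfolding expandable_def by blast
  let ?E = "E \<union> E'"
  have IE: "?E \<subseteq> ?I" "finite ?E" using E E' by auto
  have ext: "t2.T.cl (\<Sum>k\<in>D. oelem k (r k)) = t2.T.cl (\<Sum>k\<in>?E. oelem k (r k))"
    if "D \<subseteq> ?E" "\<And>k. k \<notin> D \<Longrightarrow> r k = 0" for D r
  proof -
    have "(\<Sum>k\<in>?E. oelem k (r k)) - (\<Sum>k\<in>D. oelem k (r k)) = (\<Sum>k\<in>?E - D. oelem k (r k))"
      by (rule sum_diff[OF IE(2) that(1), symmetric])
    also have "\<dots> \<in> t2.TN"
      by (rule t2.T.N_sum, rule oelem_zero) (use IE that in \<open>auto simp: JH_rules ideal_zero[OF ideal_IS]\<close>)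
    finally have d: "(\<Sum>k\<in>?E. oelem k (r k)) - (\<Sum>k\<in>D. oelem k (r k)) \<in> t2.TN" .
    show ?thesis by (rule sym, unfold t2.T.cl_eq) (rule d)
  qed
  have c: "(\<Sum>k\<in>?E. oelem k (r k)) \<in> carrier t2.F" if "\<And>k. r k \<in> carrier FT" for r
    by (rule t2.T.M_sum, rule oelem_carrier) (use IE that in auto)
  have "\<sigma> \<oplus>\<^bsub>TT\<^esub> \<tau> = t2.T.cl (\<Sum>k\<in>?E. oelem k (s k)) \<oplus>\<^bsub>TT\<^esub> t2.T.cl (\<Sum>k\<in>?E. oelem k (s' k))"
    unfolding E(5) E'(5) using ext[of E s] ext[of E' s'] E(4) E'(4) by simp
  also have "\<dots> = t2.T.cl ((\<Sum>k\<in>?E. oelem k (s k)) + (\<Sum>k\<in>?E. oelem k (s' k)))"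
    unfolding t2.tensor_eq by (rule t2.T.cl_add[OF c[OF E(3)] c[OF E'(3)]])
  also have "\<dots> = t2.T.cl (\<Sum>k\<in>?E. oelem k (s k + s' k))"
  proof (rule sym, unfold t2.T.cl_eq sum.distrib[symmetric] sum_subtractf[symmetric])
    show "(\<Sum>k\<in>?E. oelem k (s k + s' k) - (oelem k (s k) + oelem k (s' k))) \<in> t2.TN"
      by (rule t2.T.N_sum, rule oelem_add) (use IE E(3) E'(3) in auto)
  qed
  finally have "\<sigma> \<oplus>\<^bsub>TT\<^esub> \<tau> = t2.T.cl (\<Sum>k\<in>?E. oelem k (s k + s' k))" .
  moreover have "s k + s' k \<in> carrier FT" for k by (rule free_algebra_closed(4)[OF E(3) E'(3)])
  moreover have "s k + s' k = 0" if "k \<notin> ?E" for k using that E(4) E'(4) by simp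
  ultimately show ?thesis
    unfolding expandable_def using IE by (intro exI[of _ ?E] exI[of _ "\<lambda>k. s k + s' k"]) blast
qed

lemma expandable_monomial:
  assumes a: "\<alpha> \<in> exponents n" "\<gamma> \<in> exponents n" and s: "s \<in> carrier S.Q"
  shows "expandable (pure_tensor T1 (polynomials n) (pure_tensor X.Q S.Q (X.cl (xi_power n \<alpha>)) s) (Poly_Mapping.single \<gamma> 1))"
  unfolding expandable_def
  by (rule exI[of _ "{(\<alpha>, \<gamma>)}"], rule exI[of _ "\<lambda>k. if k = (\<alpha>, \<gamma>) then S.rep s else 0"])
     (use a S.rep[OF s] in \<open>simp add: oelem_def t2.pure_eq free_algebra_closed\<close>)

lemma expandable_all:
  assumes "\<tau> \<in> carrier TT"
  shows "expandable \<tau>"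
proof -
  let ?P = "polynomials n"
  have 1: "expandable (pure_tensor T1 ?P (pure_tensor X.Q S.Q a s) (Poly_Mapping.single \<gamma> 1))"
    if a: "a \<in> carrier X.Q" and s: "s \<in> carrier S.Q" and \<gamma>: "\<gamma> \<in> exponents n" for a s \<gamma>
  proof -
    note g = mono_carrier[OF \<gamma>, of 1]
    let ?t = "\<lambda>x. pure_tensor T1 ?P (pure_tensor X.Q S.Q (X.cl x) s) (Poly_Mapping.single \<gamma> 1)"
    have one: "expandable (?t (Poly_Mapping.single w c))" if w: "w \<in> lists GX" for w c
    proof -
      obtain w' where w': "w = map Gen_xi w'" "set w' \<subseteq> {1..n}" using w unfolding GX_def lists_image by auto
      have "Poly_Mapping.single (map Gen_xi w') c = scalar c * xmono w'"
      proof -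
        have "xmono y = Poly_Mapping.single (map Gen_xi y) 1" for y
        proof (induction y)
          case Nil
          show ?case using single_one[where 'a = "generator list" and 'b = complex] by (simp add: zero_list_def)
        next
          case (Cons a y)
          then show ?case by (simp add: xi_def Poly_Mapping.mult_single plus_list_def)
        qed
        then show ?thesis by (simp add: scalar_def Poly_Mapping.mult_single plus_list_def)
      qed
      obtain d \<alpha> where \<alpha>: "\<alpha> \<in> exponents n" "xmono w' - scalar d * xi_power n \<alpha> \<in> IX"
        using xmono_sort[OF ideal_IX _ ring.genideal_self[OF ring_free_algebra skew_FX] w'(2)]
        unfolding GX_def by blast
      note xc = X.cl_carrier[OF power_closed(1)[of \<alpha>]]
      have "Poly_Mapping.single w c - pscale (c * d) (xi_power n \<alpha>) = scalar c * (xmono w' - scalar d * xi_power n \<alpha>)"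
        unfolding w'(1) \<open>Poly_Mapping.single (map Gen_xi w') c = scalar c * xmono w'\<close> pscale_scalar scalar_values(5)[symmetric]
        by (simp add: algebra_simps)
      also have "\<dots> \<in> IX" by (rule ideal_scalar[OF ideal_IX \<alpha>(2)])
      finally have "X.cl (Poly_Mapping.single w c) = (c * d) \<odot>\<^bsub>X.Q\<^esub> X.cl (xi_power n \<alpha>)"
        unfolding X.cl_smult[OF power_closed(1)] X.cl_eq .
      \<comment> \<open>The scalar created by sorting moves over to the factor in the spin algebra,
        which leaves an exact monomial on the left.\<close>
      then have "pure_tensor X.Q S.Q (X.cl (Poly_Mapping.single w c)) s
          = pure_tensor X.Q S.Q (X.cl (xi_power n \<alpha>)) ((c * d) \<odot>\<^bsub>S.Q\<^esub> s)"
        using t1.pure_scale_left[OF xc s] t1.pure_scale_right[OF xc s] by simp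
      moreover have "(c * d) \<odot>\<^bsub>S.Q\<^esub> s \<in> carrier S.Q" using S.Q.smult_closed[of "c * d" s] s by simp
      ultimately show ?thesis using expandable_monomial[OF \<alpha>(1) \<gamma>] by simp
    qed
    have "expandable (?t (\<Sum>w\<in>A. Poly_Mapping.single w (c w)))" if "A \<subseteq> lists GX" for A c
      using that
    proof (induction A rule: infinite_finite_induct)
      case (insert w A)
      let ?r = "\<Sum>w\<in>A. Poly_Mapping.single w (c w)"
      have sF: "Poly_Mapping.single w d \<in> carrier FX" if "w \<in> lists GX" for w d
        using that by (simp add: X.M_simps)
      have r: "Poly_Mapping.single w (c w) \<in> carrier FX" "?r \<in> carrier FX"
        using insert.prems by (blast intro: X.M_sum sF)+
      have "?t (\<Sum>w\<in>insert w A. Poly_Mapping.single w (c w)) = ?t (Poly_Mapping.single w (c w)) \<oplus>\<^bsub>TT\<^esub> ?t ?r"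
        unfolding sum.insert[OF insert.hyps(1,2)] X.cl_add[OF r, symmetric]
          t1.pure_add_left[OF X.cl_carrier[OF r(1)] X.cl_carrier[OF r(2)] s]
        by (rule t2.pure_add_left[OF t1.pure_carrier[OF X.cl_carrier[OF r(1)] s] t1.pure_carrier[OF X.cl_carrier[OF r(2)] s] g])
      then show ?case using insert by (simp add: expandable_add one)
    qed (simp_all add: flip: X.cl_zero, simp_all add: t1.pure_zero(2)[OF s] t2.pure_zero(2)[OF g] expandable_zero)
    from this[of "Poly_Mapping.keys (X.rep a)" "Poly_Mapping.lookup (X.rep a)"]
    show ?thesis using X.rep[OF a] poly_mapping_sum_single[of "X.rep a"] by (simp add: X.M_simps)
  qed
  have 2: "expandable (pure_tensor T1 ?P (pure_tensor X.Q S.Q a s) p)"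
    if a: "a \<in> carrier X.Q" and s: "s \<in> carrier S.Q" and p: "p \<in> carrier ?P" for a s p
  proof -
    let ?A = "pure_tensor X.Q S.Q a s"
    note A = t1.pure_carrier[OF a s]
    have one: "expandable (pure_tensor T1 ?P ?A (Poly_Mapping.single \<gamma> c))" if \<gamma>: "\<gamma> \<in> exponents n" for \<gamma> c
    proof -
      have "Poly_Mapping.single \<gamma> c = c \<odot>\<^bsub>?P\<^esub> Poly_Mapping.single \<gamma> 1" by (simp add: polynomials_simps map_single)
      then have "pure_tensor T1 ?P ?A (Poly_Mapping.single \<gamma> c) = pure_tensor T1 ?P (c \<odot>\<^bsub>T1\<^esub> ?A) (Poly_Mapping.single \<gamma> 1)"
        using t2.pure_scale_left[OF A mono_carrier[OF \<gamma>]] t2.pure_scale_right[OF A mono_carrier[OF \<gamma>]] by simp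
      also have "c \<odot>\<^bsub>T1\<^esub> ?A = pure_tensor X.Q S.Q a (c \<odot>\<^bsub>S.Q\<^esub> s)" by (rule t1.pure_scale_right[OF a s, symmetric])
      finally show ?thesis using 1[OF a _ \<gamma>, of "c \<odot>\<^bsub>S.Q\<^esub> s"] S.Q.smult_closed[of c s] s by simp
    qed
    have "expandable (pure_tensor T1 ?P ?A (\<Sum>\<gamma>\<in>D. Poly_Mapping.single \<gamma> (c \<gamma>)))" if "D \<subseteq> exponents n" for D c
      using that
    proof (induction D rule: infinite_finite_induct)
      case (insert \<gamma> D)
      let ?r = "\<Sum>\<gamma>\<in>D. Poly_Mapping.single \<gamma> (c \<gamma>)"
      have s: "\<gamma> \<in> exponents n" "D \<subseteq> exponents n" using insert.prems by auto
      have "Poly_Mapping.keys ?r \<subseteq> D"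
        by (auto simp: in_keys_iff lookup_sum lookup_single when_def intro: sum.not_neutral_contains_not_neutral split: if_splits)
      then have r: "?r \<in> carrier ?P" using s(2) by (auto simp: polynomials_simps)
      have "pure_tensor T1 ?P ?A (\<Sum>\<gamma>\<in>insert \<gamma> D. Poly_Mapping.single \<gamma> (c \<gamma>))
          = pure_tensor T1 ?P ?A (Poly_Mapping.single \<gamma> (c \<gamma>)) \<oplus>\<^bsub>TT\<^esub> pure_tensor T1 ?P ?A ?r"
        using t2.pure_add_right[OF A mono_carrier[OF s(1)] r] insert.hyps by (simp add: polynomials_simps)
      then show ?case using insert.IH[OF s(2)] one[OF s(1)] by (simp add: expandable_add)
    qed (simp_all flip: polynomials_simps(3), simp_all add: t2.pure_zero(1)[OF A] expandable_zero)
    from this[of "Poly_Mapping.keys p" "Poly_Mapping.lookup p"]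
    show ?thesis using p poly_mapping_sum_single[of p] by (simp add: polynomials_simps)
  qed
  show ?thesis
    using assms
  proof (induction rule: t2.tensor_induct)
    case (add x y)
    then show ?case by (intro expandable_add)
  next
    case (pure A p)
    from pure(1) show ?case
    proof (induction rule: t1.tensor_induct)
      case (add x y)
      then show ?case using t2.pure_add_left[OF add(1,2) pure(2)] expandable_add by simp
    next
      case (pure a s)
      then show ?case using 2 \<open>p \<in> carrier ?P\<close> by blast
    qed
  qed
qed

section \<open>Bijectivity of the multiplication map\<close>

lemma monomial_closed: "s \<in> carrier FT \<Longrightarrow> xi_power n \<alpha> * s * y_power n \<gamma> \<in> carrier FH"
  by (intro free_algebra_closed power_closed FT_FH)

lemma multiplication_formula:
  assumes a: "a \<in> carrier X.Q" and s: "s \<in> carrier S.Q"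
  shows "to_daha W n u v a \<otimes>\<^bsub>H.Q\<^esub> to_daha W n u v s \<otimes>\<^bsub>H.Q\<^esub> poly_to_daha W n u v p
    = H.cl (X.rep a * S.rep s * ev p)"
proof -
  have r: "X.rep a \<in> carrier FH" "S.rep s \<in> carrier FH"
    by (rule FX_FH[OF X.rep(1)[OF a]], rule FT_FH[OF S.rep(1)[OF s]])
  have p: "poly_to_daha W n u v p = H.cl (ev p)"
    unfolding poly_to_daha_def algebra_eqs(4) ev_def ..
  show ?thesis
    unfolding to_daha_rep(1)[OF a] to_daha_rep(2)[OF s] p H_mult[OF r] H_mult[OF free_algebra_closed(3)[OF r] ev_closed] ..
qed

lemma monomial_formula:
  assumes s: "s \<in> carrier S.Q"
  shows "daha_class W n u v (xi_power n \<alpha>) \<otimes>\<^bsub>H.Q\<^esub> to_daha W n u v s \<otimes>\<^bsub>H.Q\<^esub> daha_class W n u v (y_power n \<gamma>)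
    = H.cl (xi_power n \<alpha> * S.rep s * y_power n \<gamma>)"
proof -
  have r: "S.rep s \<in> carrier FH" by (rule FT_FH[OF S.rep(1)[OF s]])
  show ?thesis
    unfolding algebra_eqs(4) to_daha_rep(2)[OF s] H_mult[OF power_closed(2) r]
      H_mult[OF free_algebra_closed(3)[OF power_closed(2) r] power_closed(3)] ..
qed

text \<open>An element of the kernel, expanded in the \<xi>^\<alpha> and y^\<gamma>, has all its
  spin coefficients in the ideal \<open>IS\<close> by \<open>pbw_independent\<close>, so each
  summand is already zero as a tensor. The image contains everything by
  \<open>pbw_span_induct\<close>.\<close>

lemma multiplication_bijective:
  assumes lin: "linear_map CC TT H.Q \<phi>"
    and \<phi>: "\<And>a s p. a \<in> carrier X.Q \<Longrightarrow> s \<in> carrier S.Q \<Longrightarrow> p \<in> carrier (polynomials n) \<Longrightarrow>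
      \<phi> (pure_tensor T1 (polynomials n) (pure_tensor X.Q S.Q a s) p) = H.cl (X.rep a * S.rep s * ev p)"
  shows "bij_betw \<phi> (carrier TT) (carrier H.Q)"
proof -
  interpret TT: abelian_group TT
    unfolding t2.tensor_eq by (rule t2.T.Q.M.abelian_group_axioms)
  interpret L: linear_map CC TT H.Q \<phi> by (rule lin)
  let ?I = "exponents n \<times> exponents n"
  let ?h = "\<lambda>k s. xi_power n (fst k) * s * y_power n (snd k)"
  have oc: "t2.T.cl (oelem k s) \<in> carrier TT" if "k \<in> ?I" "s \<in> carrier FT" for k s
    unfolding t2.tensor_eq by (rule t2.T.cl_carrier[OF oelem_carrier[OF that]])
  have one: "\<phi> (t2.T.cl (oelem k s)) = H.cl (?h k s)" if k: "k \<in> ?I" and s: "s \<in> carrier FT" for k s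
  proof -
    let ?x = "xi_power n (fst k)" and ?y = "y_power n (snd k)"
    have g: "snd k \<in> exponents n" using k by auto
    have s': "S.rep (S.cl s) \<in> carrier FH" by (rule FT_FH[OF S.rep(1)[OF S.cl_carrier[OF s]]])
    have "\<phi> (t2.T.cl (oelem k s)) = H.cl (X.rep (X.cl ?x) * S.rep (S.cl s) * ev (Poly_Mapping.single (snd k) 1))"
      unfolding oelem_def t2.pure_eq[symmetric]
      by (rule \<phi>[OF X.cl_carrier[OF power_closed(1)] S.cl_carrier[OF s] mono_carrier[OF g]])
    also have "\<dots> = H.cl (?h k s)"
      unfolding H.cl_eq ev_single
    proof -
      have 1: "(X.rep (X.cl ?x) - ?x) * (S.rep (S.cl s) * ?y) \<in> JH"
        by (rule JH_r[OF IX_JH[OF X.rep_cl[OF power_closed(1)]]]) (intro free_algebra_closed s' power_closed)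
      have 2: "(?x * (S.rep (S.cl s) - s)) * ?y \<in> JH"
        by (rule JH_r[OF JH_l[OF IS_JH[OF S.rep_cl[OF s]] power_closed(2)] power_closed(3)])
      have "X.rep (X.cl ?x) * S.rep (S.cl s) * ?y - ?h k s
          = (X.rep (X.cl ?x) - ?x) * (S.rep (S.cl s) * ?y) + (?x * (S.rep (S.cl s) - s)) * ?y"
        by (simp add: algebra_simps)
      then show "X.rep (X.cl ?x) * S.rep (S.cl s) * ?y - ?h k s \<in> JH"
        using JH_rules(1)[OF 1 2] by simp
    qed
    finally show ?thesis .
  qed
  have sum: "\<phi> (t2.T.cl (\<Sum>k\<in>E. oelem k (s k))) = H.cl (\<Sum>k\<in>E. ?h k (s k))"
    if E: "finite E" "E \<subseteq> ?I" and s: "\<And>k. s k \<in> carrier FT" for E s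
    using E
  proof (induction E)
    case empty
    show ?case using L.f0_is_0 unfolding t2.tensor_eq t2.T.cl_zero H.cl_zero by simp
  next
    case (insert k E)
    have k: "k \<in> ?I" "E \<subseteq> ?I" using insert.prems by auto
    have oE: "(\<Sum>k\<in>E. oelem k (s k)) \<in> carrier t2.F"
      by (rule t2.T.M_sum, rule oelem_carrier[OF _ s]) (use k in auto)
    have hE: "(\<Sum>k\<in>E. ?h k (s k)) \<in> carrier FH"
      by (rule H.M_sum, rule monomial_closed[OF s])
    have c: "t2.T.cl (\<Sum>k\<in>E. oelem k (s k)) \<in> carrier TT"
      unfolding t2.tensor_eq by (rule t2.T.cl_carrier[OF oE])
    have "\<phi> (t2.T.cl (\<Sum>k\<in>insert k E. oelem k (s k)))
        = \<phi> (t2.T.cl (oelem k (s k)) \<oplus>\<^bsub>TT\<^esub> t2.T.cl (\<Sum>k\<in>E. oelem k (s k)))"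
      unfolding sum.insert[OF insert.hyps(1,2)] t2.tensor_eq t2.T.cl_add[OF oelem_carrier[OF k(1) s] oE] ..
    also have "\<dots> = H.cl (?h k (s k)) \<oplus>\<^bsub>H.Q\<^esub> H.cl (\<Sum>k\<in>E. ?h k (s k))"
      unfolding L.f_add[OF oc[OF k(1) s] c] one[OF k(1) s] insert.IH[OF k(2)] ..
    also have "\<dots> = H.cl (\<Sum>k\<in>insert k E. ?h k (s k))"
      unfolding sum.insert[OF insert.hyps(1,2)] by (rule H.cl_add[OF monomial_closed[OF s] hE])
    finally show ?case .
  qed
  have ker: "\<tau> = \<zero>\<^bsub>TT\<^esub>" if \<tau>: "\<tau> \<in> carrier TT" and z: "\<phi> \<tau> = \<zero>\<^bsub>H.Q\<^esub>" for \<tau>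
  proof -
    obtain E s where E: "finite E" "E \<subseteq> ?I" "\<And>k. s k \<in> carrier FT" "\<tau> = t2.T.cl (\<Sum>k\<in>E. oelem k (s k))"
      using expandable_all[OF \<tau>] unfolding expandable_def by blast
    have "H.cl (\<Sum>k\<in>E. ?h k (s k)) = H.cl 0"
      using z unfolding E(4) sum[OF E(1-3)] H.cl_zero .
    then have J: "(\<Sum>k\<in>E. ?h k (s k)) \<in> JH" unfolding H.cl_eq by simp
    have "s k \<in> IS" if k: "k \<in> E" for k
    proof -
      have kI: "fst k \<in> exponents n" "snd k \<in> exponents n" using k E(2) by auto
      have "(\<Sum>e\<in>{e \<in> E. fst e = fst k \<and> snd e = snd k}. s e) \<in> IS"
        by (rule pbw_independent[OF E(1) _ _ E(3) J kI]) (use E(2) in auto)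
      also have "{e \<in> E. fst e = fst k \<and> snd e = snd k} = {k}" using k by (auto simp: prod_eq_iff)
      finally show ?thesis by simp
    qed
    then have "(\<Sum>k\<in>E. oelem k (s k)) \<in> t2.TN"
      by (intro t2.T.N_sum oelem_zero) (use E(2) in auto)
    then show ?thesis unfolding E(4) t2.tensor_eq t2.T.cl_zero t2.T.cl_eq by simp
  qed
  have "inj_on \<phi> (carrier TT)"
  proof (rule inj_onI)
    fix x y assume xy: "x \<in> carrier TT" "y \<in> carrier TT" "\<phi> x = \<phi> y"
    have "\<phi> (x \<ominus>\<^bsub>TT\<^esub> y) = \<phi> x \<ominus>\<^bsub>H.Q\<^esub> \<phi> y" by (rule L.f_minus[OF xy(1,2)])
    also have "\<dots> = \<zero>\<^bsub>H.Q\<^esub>" unfolding xy(3) a_minus_def by (rule H.Q.M.r_neg[OF L.f_im[OF xy(2)]])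
    finally have "x \<ominus>\<^bsub>TT\<^esub> y = \<zero>\<^bsub>TT\<^esub>"
      by (rule ker[rotated]) (unfold a_minus_def, rule TT.a_closed[OF xy(1) TT.a_inv_closed[OF xy(2)]])
    then have "x \<oplus>\<^bsub>TT\<^esub> (\<ominus>\<^bsub>TT\<^esub> y) = \<zero>\<^bsub>TT\<^esub>" unfolding a_minus_def .
    then have "\<ominus>\<^bsub>TT\<^esub> (\<ominus>\<^bsub>TT\<^esub> y) = x" using xy by (intro TT.minus_equality TT.a_inv_closed)
    then show "x = y" unfolding TT.minus_minus[OF xy(2)] by (rule sym)
  qed
  moreover have "\<phi> ` carrier TT = carrier H.Q"
  proof
    show "\<phi> ` carrier TT \<subseteq> carrier H.Q" using L.f_im by blast
    show "carrier H.Q \<subseteq> \<phi> ` carrier TT"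
    proof
      fix A assume "A \<in> carrier H.Q"
      from H.cl_cases[OF this] obtain q where q: "q \<in> carrier FH" "A = H.cl q" by (rule bexE)
      from q(1) have "H.cl q \<in> \<phi> ` carrier TT"
      proof (induction rule: pbw_span_induct)
        case (ideal p)
        have "\<phi> \<zero>\<^bsub>TT\<^esub> = H.cl p"
          unfolding L.f0_is_0 H.cl_zero H.cl_eq using JH_rules(4)[OF ideal] by simp
        moreover have "\<zero>\<^bsub>TT\<^esub> \<in> carrier TT" by (rule TT.zero_closed)
        ultimately show ?case by (metis image_eqI)
      next
        case (step \<alpha> s \<gamma> z)
        from step(5) obtain \<tau> where \<tau>: "H.cl z = \<phi> \<tau>" "\<tau> \<in> carrier TT" by (rule imageE)
        have k: "(\<alpha>, \<gamma>) \<in> ?I" using step by simp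
        have "H.cl (xi_power n \<alpha> * s * y_power n \<gamma> + z) = \<phi> (t2.T.cl (oelem (\<alpha>, \<gamma>) s)) \<oplus>\<^bsub>H.Q\<^esub> \<phi> \<tau>"
          unfolding one[OF k step(2)] \<tau>(1)[symmetric] fst_conv snd_conv
          by (rule H.cl_add[OF monomial_closed[OF step(2)] step(4), symmetric])
        also have "\<dots> = \<phi> (t2.T.cl (oelem (\<alpha>, \<gamma>) s) \<oplus>\<^bsub>TT\<^esub> \<tau>)"
          by (rule L.f_add[OF oc[OF k step(2)] \<tau>(2), symmetric])
        finally show ?case
          by (rule image_eqI) (rule TT.a_closed[OF oc[OF k step(2)] \<tau>(2)])
      qed
      then show "A \<in> \<phi> ` carrier TT" unfolding q(2) .
    qed
  qed
  ultimately show ?thesis unfolding bij_betw_def ..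
qed

section \<open>The monomials over a basis of the spin algebra\<close>

definition monomial where
  "monomial = (\<lambda>(\<alpha>, \<sigma>, \<gamma>). H.cl (xi_power n \<alpha> * S.rep \<sigma> * y_power n \<gamma>))"

lemma monomial_inj:
  assumes B: "S.Q.basis B"
  shows "inj_on monomial (exponents n \<times> B \<times> exponents n)"
proof (rule inj_onI)
  fix k l assume k: "k \<in> exponents n \<times> B \<times> exponents n" and l: "l \<in> exponents n \<times> B \<times> exponents n"
    and eq: "monomial k = monomial l"
  have B': "B \<subseteq> carrier S.Q" "S.Q.lin_indpt B" using B unfolding S.Q.basis_def by simp_all
  obtain \<alpha> \<sigma> \<gamma> where k': "k = (\<alpha>, \<sigma>, \<gamma>)" "\<alpha> \<in> exponents n" "\<sigma> \<in> B" "\<gamma> \<in> exponents n" using k by auto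
  obtain \<alpha>' \<sigma>' \<gamma>' where l': "l = (\<alpha>', \<sigma>', \<gamma>')" "\<alpha>' \<in> exponents n" "\<sigma>' \<in> B" "\<gamma>' \<in> exponents n" using l by auto
  have c: "\<sigma> \<in> carrier S.Q" "\<sigma>' \<in> carrier S.Q" using B' k' l' by auto
  note r = S.rep(1)[OF c(1)] S.rep(1)[OF c(2)]
  \<comment> \<open>Equality of two monomials is a relation with two terms. Indexing it by
    \<open>bool\<close> keeps the terms apart even if their exponents coincide.\<close>
  let ?a = "\<lambda>b. if b then \<alpha> else \<alpha>'" and ?g = "\<lambda>b. if b then \<gamma> else \<gamma>'"
    and ?s = "\<lambda>b. if b then S.rep \<sigma> else - S.rep \<sigma>'"
  have "(\<Sum>b\<in>UNIV. xi_power n (?a b) * ?s b * y_power n (?g b))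
      = xi_power n \<alpha> * S.rep \<sigma> * y_power n \<gamma> - xi_power n \<alpha>' * S.rep \<sigma>' * y_power n \<gamma>'"
    by (simp add: UNIV_bool)
  also have "\<dots> \<in> JH" using eq unfolding k'(1) l'(1) monomial_def prod.case H.cl_eq .
  finally have J: "(\<Sum>b\<in>UNIV. xi_power n (?a b) * ?s b * y_power n (?g b)) \<in> JH" .
  have ind: "(\<Sum>b\<in>{b \<in> UNIV. ?a b = \<alpha> \<and> ?g b = \<gamma>}. ?s b) \<in> IS"
    by (rule pbw_independent[OF finite_UNIV _ _ _ J k'(2,4)]) (use k' l' r S.M_closed(4) in auto)
  show "k = l"
  proof (cases "\<alpha>' = \<alpha> \<and> \<gamma>' = \<gamma>")
    case True
    then have "{b \<in> UNIV. ?a b = \<alpha> \<and> ?g b = \<gamma>} = {False, True}" by auto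
    with ind have "S.rep \<sigma> - S.rep \<sigma>' \<in> IS" by simp
    then have "S.cl (S.rep \<sigma>) = S.cl (S.rep \<sigma>')" unfolding S.cl_eq .
    then have "\<sigma> = \<sigma>'" unfolding S.rep(2)[OF c(1)] S.rep(2)[OF c(2)] .
    then show ?thesis using True k' l' by simp
  next
    case False
    then have "{b \<in> UNIV. ?a b = \<alpha> \<and> ?g b = \<gamma>} = {True}" by auto
    with ind have "S.rep \<sigma> - 0 \<in> IS" by simp
    then have "S.cl (S.rep \<sigma>) = \<zero>\<^bsub>S.Q\<^esub>" unfolding S.cl_zero S.cl_eq .
    then have "\<zero>\<^bsub>S.Q\<^esub> \<in> B" using k'(3) unfolding S.rep(2)[OF c(1)] by simp
    moreover have "\<zero>\<^bsub>S.Q\<^esub> \<notin> B"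
      by (rule S.Q.zero_nin_lin_indpt[OF B']) (simp, metis UNIV_I singletonD one_neq_zero)
    ultimately show ?thesis by contradiction
  qed
qed

lemma monomial_carrier: "\<sigma> \<in> carrier S.Q \<Longrightarrow> monomial (\<alpha>, \<sigma>, \<gamma>) \<in> carrier H.Q"
  unfolding monomial_def prod.case by (rule H.cl_carrier[OF monomial_closed[OF S.rep(1)]])

lemma monomial_independent:
  assumes B: "S.Q.basis B"
  shows "H.Q.lin_indpt (monomial ` (exponents n \<times> B \<times> exponents n))"
proof
  let ?I = "exponents n \<times> B \<times> exponents n"
  have B': "B \<subseteq> carrier S.Q" "S.Q.lin_indpt B" using B unfolding S.Q.basis_def by simp_all
  assume "H.Q.lin_dep (monomial ` ?I)"
  then obtain A a w where A: "finite A" "A \<subseteq> monomial ` ?I" "H.Q.lincomb a A = \<zero>\<^bsub>H.Q\<^esub>" "w \<in> A" "a w \<noteq> 0"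
    unfolding H.Q.lin_dep_def by auto
  from finite_subset_image[OF A(1,2)] obtain E where E: "E \<subseteq> ?I" "finite E" "A = monomial ` E" by blast
  have c: "fst (snd e) \<in> carrier S.Q" if "e \<in> E" for e
    using subsetD[OF E(1) that] subsetD[OF B'(1)] by (auto simp: mem_Times_iff)
  let ?h = "\<lambda>e. xi_power n (fst e) * S.rep (fst (snd e)) * y_power n (snd (snd e))"
  let ?s = "\<lambda>e. pscale (a (monomial e)) (S.rep (fst (snd e)))"
  have m: "monomial e = H.cl (?h e)" for e by (simp add: monomial_def case_prod_beta)
  have hc: "?h e \<in> carrier FH" if "e \<in> E" for e by (rule monomial_closed[OF S.rep(1)[OF c[OF that]]])
  have inj: "inj_on monomial E" by (rule inj_on_subset[OF monomial_inj[OF B] E(1)])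
  have "H.Q.lincomb a A = (\<Oplus>\<^bsub>H.Q\<^esub>e\<in>E. a (monomial e) \<odot>\<^bsub>H.Q\<^esub> monomial e)"
    unfolding H.Q.lincomb_def E(3)
  proof (rule H.Q.finsum_reindex[OF _ inj], rule funcsetI)
    fix x assume "x \<in> monomial ` E"
    then obtain e where e: "x = monomial e" "e \<in> E" by (rule imageE)
    show "a x \<odot>\<^bsub>H.Q\<^esub> x \<in> carrier H.Q"
      unfolding e(1) m H.cl_smult[OF hc[OF e(2)]] by (rule H.cl_carrier[OF H.M_closed(2)[OF hc[OF e(2)]]])
  qed
  also have "\<dots> = (\<Oplus>\<^bsub>H.Q\<^esub>e\<in>E. H.cl (pscale (a (monomial e)) (?h e)))"
  proof (rule H.Q.finsum_cong'[OF refl])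
    show "(\<lambda>e. H.cl (pscale (a (monomial e)) (?h e))) \<in> E \<rightarrow> carrier H.Q"
      by (intro funcsetI H.cl_carrier H.M_closed(2) hc)
    show "a (monomial e) \<odot>\<^bsub>H.Q\<^esub> monomial e = H.cl (pscale (a (monomial e)) (?h e))" if "e \<in> E" for e
      using H.cl_smult[OF hc[OF that], of "a (monomial e)"] by (simp only: m)
  qed
  also have "\<dots> = H.cl (\<Sum>e\<in>E. pscale (a (monomial e)) (?h e))"
    by (rule H.finsum_cl[OF E(2) H.M_closed(2)[OF hc]])
  also have "(\<lambda>e. pscale (a (monomial e)) (?h e)) = (\<lambda>e. xi_power n (fst e) * ?s e * y_power n (snd (snd e)))"
    by (simp only: pscale_mult)
  finally have "H.cl (\<Sum>e\<in>E. xi_power n (fst e) * ?s e * y_power n (snd (snd e))) = H.cl 0"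
    using A(3) unfolding H.cl_zero by simp
  then have J: "(\<Sum>e\<in>E. xi_power n (fst e) * ?s e * y_power n (snd (snd e))) \<in> JH"
    unfolding H.cl_eq by simp
  from A(4) E(3) obtain e0 where e0: "e0 \<in> E" "w = monomial e0" by blast
  obtain \<alpha>0 \<sigma>0 \<gamma>0 where k0: "e0 = (\<alpha>0, \<sigma>0, \<gamma>0)" by (cases e0)
  have ex: "\<alpha>0 \<in> exponents n" "\<gamma>0 \<in> exponents n" using e0(1) E(1) unfolding k0 by auto
  \<comment> \<open>From a dependence with nonzero coefficient at e0, only the terms with the
    exponents of e0 are kept. On them the middle component is injective, so their vanishing in the
    spin algebra is a dependence inside B that is nontrivial at \<sigma>0.\<close>
  let ?G = "{e \<in> E. fst e = \<alpha>0 \<and> snd (snd e) = \<gamma>0}"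
  have sc: "?s e \<in> carrier FT" if "e \<in> E" for e by (rule S.M_closed(2)[OF S.rep(1)[OF c[OF that]]])
  have ind: "(\<Sum>e\<in>?G. ?s e) \<in> IS"
    by (rule pbw_independent[OF E(2) _ _ sc J ex]) (use E(1) in auto)
  let ?p = "\<lambda>e. fst (snd e)"
  let ?c = "\<lambda>\<sigma>. a (monomial (\<alpha>0, \<sigma>, \<gamma>0))"
  have pinj: "inj_on ?p ?G" by (rule inj_onI) (auto simp: prod_eq_iff)
  have G: "?G \<subseteq> E" by blast
  have "S.Q.lincomb ?c (?p ` ?G) = (\<Oplus>\<^bsub>S.Q\<^esub>e\<in>?G. ?c (?p e) \<odot>\<^bsub>S.Q\<^esub> ?p e)"
    unfolding S.Q.lincomb_def
  proof (rule S.Q.finsum_reindex[OF _ pinj], rule funcsetI)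
    fix x assume "x \<in> ?p ` ?G"
    then have "x \<in> carrier S.Q" using c by blast
    then show "?c x \<odot>\<^bsub>S.Q\<^esub> x \<in> carrier S.Q" using S.Q.smult_closed[of "?c x" x] by simp
  qed
  also have "\<dots> = (\<Oplus>\<^bsub>S.Q\<^esub>e\<in>?G. S.cl (?s e))"
  proof (rule S.Q.finsum_cong'[OF refl])
    show "(\<lambda>e. S.cl (?s e)) \<in> ?G \<rightarrow> carrier S.Q"
      using sc by (auto intro: S.cl_carrier)
    show "?c (?p e) \<odot>\<^bsub>S.Q\<^esub> ?p e = S.cl (?s e)" if e: "e \<in> ?G" for e
    proof -
      have eE: "e \<in> E" and "(\<alpha>0, ?p e, \<gamma>0) = e" using e by auto
      then have "?c (?p e) = a (monomial e)" by simp
      then show ?thesis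
        using S.cl_smult[OF S.rep(1)[OF c[OF eE]], of "a (monomial e)"] unfolding S.rep(2)[OF c[OF eE]] by simp
    qed
  qed
  also have "\<dots> = S.cl (\<Sum>e\<in>?G. ?s e)"
    by (rule S.finsum_cl) (use E(2) sc in auto)
  also have "\<dots> = \<zero>\<^bsub>S.Q\<^esub>" unfolding S.cl_zero S.cl_eq using ind by simp
  finally have "S.Q.lin_dep B"
  proof (rule S.Q.lin_dep_crit[rotated -1])
    show "finite (?p ` ?G)" using E(2) by simp
    show "?p ` ?G \<subseteq> B" using E(1) by auto
    show "\<sigma>0 \<in> ?p ` ?G" using e0(1) unfolding k0 by force
    show "?c \<sigma>0 \<noteq> \<zero>\<^bsub>CC\<^esub>" using A(5) unfolding e0(2) k0 by simp
  qed simp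
  with B'(2) show False by contradiction
qed

lemma monomial_span:
  assumes B: "S.Q.basis B"
  shows "H.Q.span (monomial ` (exponents n \<times> B \<times> exponents n)) = carrier H.Q"
proof
  let ?I = "exponents n \<times> B \<times> exponents n"
  have B': "B \<subseteq> carrier S.Q" "S.Q.span B = carrier S.Q" using B unfolding S.Q.basis_def by simp_all
  have sub: "monomial ` ?I \<subseteq> carrier H.Q" using B' monomial_carrier by auto
  show "H.Q.span (monomial ` ?I) \<subseteq> carrier H.Q" by (rule H.Q.span_is_subset2[OF sub])
  interpret M: submodule CC "H.Q.span (monomial ` ?I)" H.Q by (rule H.Q.span_is_submodule[OF sub])
  have all: "monomial (\<alpha>, \<sigma>, \<gamma>) \<in> H.Q.span (monomial ` ?I)"
    if ex: "\<alpha> \<in> exponents n" "\<gamma> \<in> exponents n" and \<sigma>: "\<sigma> \<in> carrier S.Q" for \<alpha> \<sigma> \<gamma>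
  proof -
    let ?x = "xi_power n \<alpha>" and ?y = "y_power n \<gamma>"
    have cong: "H.cl (?x * s * ?y) = H.cl (?x * s' * ?y)" if "s - s' \<in> IS" for s s'
      unfolding H.cl_eq
      using JH_r[OF JH_l[OF IS_JH[OF that] power_closed(2)] power_closed(3), of \<alpha> \<gamma>]
      by (simp add: algebra_simps)
    \<comment> \<open>The class of a monomial is linear in its middle factor, although the chosen
      representative is not. So these \<sigma> form a subspace that contains B, hence
      everything.\<close>
    let ?K = "{\<sigma> \<in> carrier S.Q. monomial (\<alpha>, \<sigma>, \<gamma>) \<in> H.Q.span (monomial ` ?I)}"
    have "submodule CC ?K S.Q"
    proof (rule LinearCombinations.submodule.intro)
      show "module CC S.Q" using S.Q.vectorspace_axioms by (simp add: vectorspace_def)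
      have "monomial (\<alpha>, \<zero>\<^bsub>S.Q\<^esub>, \<gamma>) = \<zero>\<^bsub>H.Q\<^esub>"
        unfolding monomial_def prod.case H.cl_zero
        using cong[of "S.rep \<zero>\<^bsub>S.Q\<^esub>" 0] S.rep_cl[OF S.M_closed(3)] unfolding S.cl_zero by simp
      then show "\<zero>\<^bsub>S.Q\<^esub> \<in> ?K" using M.zero_closed S.Q.M.zero_closed by simp
      show "s \<oplus>\<^bsub>S.Q\<^esub> t \<in> ?K" if st: "s \<in> ?K" "t \<in> ?K" for s t
      proof -
        have c: "s \<in> carrier S.Q" "t \<in> carrier S.Q" using st by auto
        have "H.cl (?x * S.rep (s \<oplus>\<^bsub>S.Q\<^esub> t) * ?y) = H.cl (?x * (S.rep s + S.rep t) * ?y)"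
          by (rule cong) (use S.rep_add[OF c] in \<open>simp add: diff_diff_eq\<close>)
        also have "\<dots> = H.cl (?x * S.rep s * ?y) \<oplus>\<^bsub>H.Q\<^esub> H.cl (?x * S.rep t * ?y)"
          using H.cl_add[OF monomial_closed[OF S.rep(1)[OF c(1)]] monomial_closed[OF S.rep(1)[OF c(2)]], of \<alpha> \<gamma> \<alpha> \<gamma>]
          by (simp add: distrib_left distrib_right)
        finally have "monomial (\<alpha>, s \<oplus>\<^bsub>S.Q\<^esub> t, \<gamma>) = monomial (\<alpha>, s, \<gamma>) \<oplus>\<^bsub>H.Q\<^esub> monomial (\<alpha>, t, \<gamma>)"
          unfolding monomial_def prod.case .
        moreover have "s \<oplus>\<^bsub>S.Q\<^esub> t \<in> carrier S.Q" by (rule S.Q.M.a_closed[OF c])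
        ultimately show ?thesis using st M.m_closed by simp
      qed
      show "d \<odot>\<^bsub>S.Q\<^esub> s \<in> ?K" if d: "d \<in> carrier CC" and s: "s \<in> ?K" for d s
      proof -
        have c: "s \<in> carrier S.Q" using s by auto
        have "H.cl (?x * S.rep (d \<odot>\<^bsub>S.Q\<^esub> s) * ?y) = H.cl (?x * pscale d (S.rep s) * ?y)"
          by (rule cong[OF S.rep_smult[OF c]])
        also have "\<dots> = d \<odot>\<^bsub>H.Q\<^esub> H.cl (?x * S.rep s * ?y)"
          unfolding H.cl_smult[OF monomial_closed[OF S.rep(1)[OF c]]] by (simp only: pscale_mult)
        finally have "monomial (\<alpha>, d \<odot>\<^bsub>S.Q\<^esub> s, \<gamma>) = d \<odot>\<^bsub>H.Q\<^esub> monomial (\<alpha>, s, \<gamma>)"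
          unfolding monomial_def prod.case .
        moreover have "d \<odot>\<^bsub>S.Q\<^esub> s \<in> carrier S.Q" by (rule S.Q.smult_closed[OF d c])
        ultimately show ?thesis using s M.smult_closed[OF d] by simp
      qed
    qed blast
    moreover have "B \<subseteq> ?K"
    proof
      fix b assume b: "b \<in> B"
      then have "monomial (\<alpha>, b, \<gamma>) \<in> monomial ` ?I" using ex by blast
      then have "monomial (\<alpha>, b, \<gamma>) \<in> H.Q.span (monomial ` ?I)" using H.Q.in_own_span[OF sub] by blast
      then show "b \<in> ?K" using b B'(1) by blast
    qed
    ultimately have "S.Q.span B \<subseteq> ?K" by (intro S.Q.span_is_subset)
    then show ?thesis using \<sigma> B'(2) by blast
  qed
  show "carrier H.Q \<subseteq> H.Q.span (monomial ` ?I)"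
  proof
    fix A assume "A \<in> carrier H.Q"
    from H.cl_cases[OF this] obtain q where q: "q \<in> carrier FH" "A = H.cl q" by (rule bexE)
    from q(1) have "H.cl q \<in> H.Q.span (monomial ` ?I)"
    proof (induction rule: pbw_span_induct)
      case (ideal p)
      have "H.cl p = \<zero>\<^bsub>H.Q\<^esub>" unfolding H.cl_zero H.cl_eq using ideal by simp
      then show ?case using M.zero_closed by simp
    next
      case (step \<alpha> s \<gamma> z)
      let ?s = "S.rep (S.cl s)"
      have "(xi_power n \<alpha> * (?s - s)) * y_power n \<gamma> \<in> JH"
        by (rule JH_r[OF JH_l[OF IS_JH[OF S.rep_cl[OF step(2)]] power_closed(2)] power_closed(3)])
      then have "monomial (\<alpha>, S.cl s, \<gamma>) = H.cl (xi_power n \<alpha> * s * y_power n \<gamma>)"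
        unfolding monomial_def prod.case H.cl_eq by (simp add: algebra_simps)
      moreover have "monomial (\<alpha>, S.cl s, \<gamma>) \<in> H.Q.span (monomial ` ?I)"
        by (rule all[OF step(1,3) S.cl_carrier[OF step(2)]])
      ultimately have "H.cl (xi_power n \<alpha> * s * y_power n \<gamma>) \<oplus>\<^bsub>H.Q\<^esub> H.cl z \<in> H.Q.span (monomial ` ?I)"
        using M.m_closed step(5) by simp
      then show ?case unfolding H.cl_add[OF monomial_closed[OF step(2)] step(4)] .
    qed
    then show "A \<in> H.Q.span (monomial ` ?I)" unfolding q(2) .
  qed
qed

end

theorem theorem5p6:
  fixes W :: weyl_type and n :: nat and u v :: complex
  assumes "admissible W n"
  shows "let H = rational_spin_daha W n u v;
             X = skew_polynomials n;
             S = spin_weyl_algebra W n;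
             P = polynomials n;
             \<iota> = to_daha W n u v
    in (\<exists>\<phi>. linear_map CC (tensor (tensor X S) P) H \<phi>
          \<and> bij_betw \<phi> (carrier (tensor (tensor X S) P)) (carrier H)
          \<and> (\<forall>a\<in>carrier X. \<forall>s\<in>carrier S. \<forall>p\<in>carrier P.
               \<phi> (pure_tensor (tensor X S) P (pure_tensor X S a s) p)
               = \<iota> a \<otimes>\<^bsub>H\<^esub> \<iota> s \<otimes>\<^bsub>H\<^esub> poly_to_daha W n u v p))
     \<and> (\<forall>B. vectorspace.basis CC S B \<longrightarrow>
          (let m = (\<lambda>(\<alpha>, \<sigma>, \<gamma>). daha_class W n u v (xi_power n \<alpha>) \<otimes>\<^bsub>H\<^esub> \<iota> \<sigma>
                                   \<otimes>\<^bsub>H\<^esub> daha_class W n u v (y_power n \<gamma>));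
               I = exponents n \<times> B \<times> exponents n
           in inj_on m I \<and> vectorspace.basis CC H (m ` I)))"
proof -
  interpret spin_daha W n u v by (rule spin_daha.intro[OF assms])
  show ?thesis
    unfolding Let_def algebra_eqs(1-3)
  proof (intro conjI allI impI)
    obtain \<phi> where lin: "linear_map CC TT H.Q \<phi>"
      and \<phi>: "\<And>a s p. a \<in> carrier X.Q \<Longrightarrow> s \<in> carrier S.Q \<Longrightarrow> p \<in> carrier (polynomials n) \<Longrightarrow>
        \<phi> (pure_tensor T1 (polynomials n) (pure_tensor X.Q S.Q a s) p) = H.cl (X.rep a * S.rep s * ev p)"
      using multiplication_map by blast
    show "\<exists>\<phi>. linear_map CC TT H.Q \<phi> \<and> bij_betw \<phi> (carrier TT) (carrier H.Q)
          \<and> (\<forall>a\<in>carrier X.Q. \<forall>s\<in>carrier S.Q. \<forall>p\<in>carrier (polynomials n).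
               \<phi> (pure_tensor T1 (polynomials n) (pure_tensor X.Q S.Q a s) p)
               = to_daha W n u v a \<otimes>\<^bsub>H.Q\<^esub> to_daha W n u v s \<otimes>\<^bsub>H.Q\<^esub> poly_to_daha W n u v p)"
    proof (intro exI conjI ballI)
      show "linear_map CC TT H.Q \<phi>" by (rule lin)
      show "bij_betw \<phi> (carrier TT) (carrier H.Q)" by (rule multiplication_bijective[OF lin \<phi>])
    qed (simp only: \<phi> multiplication_formula)
  next
    fix B assume B: "S.Q.basis B"
    let ?I = "exponents n \<times> B \<times> exponents n"
    let ?m = "\<lambda>(\<alpha>, \<sigma>, \<gamma>). daha_class W n u v (xi_power n \<alpha>) \<otimes>\<^bsub>H.Q\<^esub> to_daha W n u v \<sigma>
      \<otimes>\<^bsub>H.Q\<^esub> daha_class W n u v (y_power n \<gamma>)"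
    have B': "B \<subseteq> carrier S.Q" using B unfolding S.Q.basis_def by simp
    \<comment> \<open>The statement multiplies three classes in the algebra, while
      \<open>monomial\<close> takes the class of one product of representatives; the two agree
      because the ideal is two-sided.\<close>
    have m: "?m k = monomial k" if "k \<in> ?I" for k
    proof -
      obtain \<alpha> \<sigma> \<gamma> where k: "k = (\<alpha>, \<sigma>, \<gamma>)" by (cases k)
      have "\<sigma> \<in> carrier S.Q" using that B' unfolding k by blast
      then show ?thesis unfolding k monomial_def prod.case by (rule monomial_formula)
    qed
    show "inj_on ?m ?I" using monomial_inj[OF B] by (subst inj_on_cong[OF m])
    have "?m ` ?I = monomial ` ?I" by (rule image_cong[OF refl m])
    moreover have "monomial ` ?I \<subseteq> carrier H.Q" using B' monomial_carrier by auto
    then have "H.Q.basis (monomial ` ?I)"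
      unfolding H.Q.basis_def using monomial_independent[OF B] monomial_span[OF B] by blast
    ultimately show "H.Q.basis (?m ` ?I)" by simp
  qed
qed

end
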